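(* Let $f=\sum_{n\in\mathbb{Z}}c_n\varphi(\cdot-\beta n)\in V_\beta^\infty(\varphi)$ with $c\in\ell^\infty(\mathbb{Z})$, let $r,\gamma,s>0$ with $r\le 2s$, put $I=[-s,s]$, and let $$0<\varepsilon\le\min\left\{\gamma^2,\frac{\gamma^3}{\|f\|_{L^\infty(I)}}\right\}.$$ Let $N,H\in\mathbb{N}$ and $h>0$ satisfy $$N\ge\left\lceil\frac2\beta\Bigl(s+\frac r2\Bigr)\right\rceil+\frac{2}{\nu\beta}\log\left(\frac{16sD_1\|c\|_\infty^2}{r\varepsilon}\right),\qquad \frac1h\ge\frac\sigma b\log\left(\frac{16sD_2\|c\|_\infty^2}{r\varepsilon}+1\right),$$ $$H\ge\left\lceil\frac{|a|\beta N}{2h}\right\rceil+\frac{b}{\sqrt2\,\pi\sigma h}\left(\log\frac{16sD_3\|c\|_\infty^2}{r\varepsilon}\right)^{1/2},$$ and let $Y_{n,k}=|S_{\check\varphi}^{\mathbf A}f(\tfrac{\beta n}{2},hk)|^2+\eta_{n,k}$ for $|n|\le N$, $|k|\le H$, where the real noise matrix $\eta=(\eta_{n,k})$ satisfies $$\|\eta\|_\infty\le\frac{r\varepsilon}{16shD_4}.$$ Run the reconstruction algorithm described in the context on the data $Y$ with parameters $r$, $\widetilde\gamma=\frac32\gamma^2$, $s$, and let $-s=p_1<\cdots<p_J=s$ ($J\ge2$) be the anchor points selected in its Step 2. Then: (1) $|f(p_j)|\ge\gamma$ for all $1\le j\le J$. (2) The phase transition factors $\rho_j$ are well defined for $1\le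 j\le J-1$ (i.e. $R_j(p_{j+1}-p_j)\ne0$), and the output $\mathcal R:[-s,s]\to\mathbb{C}$ of the algorithm satisfies $$\min_{\tau\in\mathbb{C},|\tau|=1}\|f-\tau\mathcal R\|_{L^\infty(I)}\le\frac{11}{4}\,\varepsilon\,\kappa_{f,\gamma},\qquad \kappa_{f,\gamma}:=\frac{\max\{1,\|f\|_{L^\infty(I)}\}}{\min\{\gamma,\gamma^2\}}.$$
   Context: Fix $\sigma>0$, $\beta>0$ and a real matrix $\mathbf A=\begin{pmatrix}a&b\\c&d\end{pmatrix}$ with $ad-bc=1$ and $b>0$ (the matrix entry $c$ is unrelated to the coefficient sequence $c=(c_n)$). Gaussian: $\varphi(t)=e^{-t^2/(2\sigma^2)}$; $V_\beta^\infty(\varphi)=\{\sum_{k\in\mathbb{Z}}c_k\varphi(\cdot-\beta k):(c_k)\in\ell^\infty(\mathbb{Z})\}$ with complex coefficients. Short-time linear canonical transform with window $\omega$: $S_\omega^{\mathbf A}f(x,\xi)=\int_{\mathbb{R}}f(t)\overline{\omega(t-x)}K_{\mathbf A}(\xi,t)\,dt$, $K_{\mathbf A}(\xi,t)=\frac{1}{\sqrt{ib}}e^{\frac{i\pi}{b}(at^2-2\xi t+d\xi^2)}$; the window is $\check\varphi(t)=e^{i\pi\frac ab t^2}\varphi(t)$. For a matrix, $\|\eta\|_\infty=\max_n\sum_k|\eta_{n,k}|$. Translation: $T_xf(t)=f(t-x)$. Dual generator: for $\xi\in\mathbb{R}$, $\widetilde{\varphi_\xi}=\sqrt2\,e^{\frac{\xi^2}{4\sigma^2}}T_{\frac\xi2}\mathcal{F}^{-1}\Lambda$,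 where $\mathcal{F}^{-1}\Lambda(t)=\int_{\mathbb{R}}\Lambda(u)e^{2\pi iut}du$, $\Lambda(t)=\dfrac{e^{-\pi^2\sigma^2t^2}}{\vartheta_3(\frac\beta2\pi t,\,e^{-\beta^2/(8\sigma^2)})}$, $\vartheta_3(z,q)=\sum_{n\in\mathbb{Z}}q^{n^2}e^{2niz}$. Decay constants: $K,\nu>0$ (depending on $\sigma,\beta$) are constants such that $|\mathcal{F}^{-1}\Lambda(t)|\le Ke^{-\nu|t|}$ for all $t\in\mathbb{R}$. With these, $$D_1=\tfrac{4\sqrt\pi\sigma}{\nu\beta}Ke^{\frac{r^2}{4\sigma^2}}\Bigl(1+\tfrac{2\sqrt{2\pi}\sigma}{\beta}\Bigr)^2,\quad D_2=4\sqrt\pi K\sigma e^{\frac{r^2}{4\sigma^2}}\Bigl(1+\tfrac{2\sqrt{2\pi}\sigma}{\beta}\Bigr)^2\Bigl(1+\tfrac{2}{\nu\beta}\Bigr)e^{1+\frac r\sigma},$$ $$D_3=2\sqrt\pi K\sigma e^{\frac{r^2}{4\sigma^2}}\Bigl(1+\tfrac{2\sqrt{2\pi}\sigma}{\beta}\Bigr)^2\Bigl(1+\tfrac{2}{\nu\beta}\Bigr),\quad D_4=2\sqrt2Ke^{\frac{r^2}{4\sigma^2}}\Bigl(1+\tfrac{2}{\nu\beta}\Bigr).$$ The conditions on $N,h,H,\varepsilon$ are understood with all expressions well defined, i.e. $c\neq0$ and $16sD_3\|c\|_\infty^2\ge r\varepsilon$. Reconstruction algorithm (input: $Y=(Y_{n,k})_{|n|\le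 N,|k|\le H}$, $N,H,h$, and $r,\widetilde\gamma,s>0$): Step 1. Compute $\mathcal A(t)=h\sum_{n=-N}^N\sum_{k=-H}^HY_{n,k}\,T_{\frac\beta2n}\widetilde{\varphi_0}(t)$, $t\in[-s,s]$. Step 2. Select points $-s=p_1<\cdots<p_J=s$ such that $\mathcal A(p_j)\ge\widetilde\gamma$ for all $j$, $p_{j+1}-p_j\le r$ for $1\le j\le J-1$, and, if $J\ge3$, $p_{j+2}-p_j\ge r$ for $1\le j\le J-2$. (The theorem concerns any such selection.) Step 3. Put $A_j=\mathcal A(p_j)$ and, for $|\xi|\le r$, $$R_j(\xi)=\frac{h}{\sqrt{A_j}}\sum_{n=-N}^Ne^{-\frac{\pi ia\beta n\xi}{b}}\sum_{k=-H}^HY_{n,k}\,e^{\frac{2\pi i\xi hk}{b}}\,T_{\frac\beta2n}\widetilde{\varphi_\xi}(p_j+\xi),\quad 1\le j\le J,$$ and $\rho_j=\dfrac{R_j(p_{j+1}-p_j)}{|R_j(p_{j+1}-p_j)|}$ for $1\le j\le J-1$. Step 4. With $\mu=\lceil J/2\rceil$, output $$\mathcal R(t)=\begin{cases}\overline{\rho_j\cdots\rho_{\mu-1}}\,R_j(\xi),&t=p_j+\xi\in[p_j,p_{j+1}),\ 1\le j\le\mu-1,\\ R_\mu(\xi),&t=p_\mu+\xi\in[p_\mu,p_{\mu+1}],\\ \rho_\mu\cdots\rho_{j-1}\,R_j(\xi),&t=p_j+\xi\in(p_j,p_{j+1}],\ \mu+1\le j\le J-1.\end{cases}$$ *)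

theory Defs
  imports "HOL-Analysis.Analysis" "HOL-Probability.Essential_Supremum"
begin

definition Linf_norm :: "real set \<Rightarrow> (real \<Rightarrow> complex) \<Rightarrow> ereal" where
  "Linf_norm S g = esssup (lebesgue_on S) (\<lambda>t. ereal (cmod (g t)))"

definition linf_seq_norm :: "(int \<Rightarrow> complex) \<Rightarrow> real" where
  "linf_seq_norm c = (SUP k. cmod (c k))"

definition translate :: "real \<Rightarrow> (real \<Rightarrow> complex) \<Rightarrow> real \<Rightarrow> complex" where
  "translate x f = (\<lambda>t. f (t - x))"

definition gaussian :: "real \<Rightarrow> real \<Rightarrow> complex" where
  "gaussian \<sigma> t = of_real (exp (- t\<^sup>2 / (2 * \<sigma>\<^sup>2)))"

(* For bounded c the series converges absolutely at every point; with c ranging over the bounded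
   sequences and g = gaussian sigma, these functions form the space V_beta^infinity. *)
definition shift_series :: "real \<Rightarrow> (real \<Rightarrow> complex) \<Rightarrow> (int \<Rightarrow> complex) \<Rightarrow> real \<Rightarrow> complex" where
  "shift_series \<beta> g c t = (\<Sum>\<^sub>\<infinity>k. c k * translate (\<beta> * of_int k) g t)"


subsection \<open>Linear canonical transform\<close>

text \<open>The matrix with rows (a, b) and (c, d) is \<open>A\<close> with
  \<open>a = A $ 1 $ 1\<close>, \<open>b = A $ 1 $ 2\<close>, \<open>c = A $ 2 $ 1\<close>, \<open>d = A $ 2 $ 2\<close>;
  the square root of \<open>\<i> b\<close> is the principal one.\<close>

definition lct_kernel :: "real^2^2 \<Rightarrow> real \<Rightarrow> real \<Rightarrow> complex" where
  "lct_kernel A \<xi> t =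
     1 / csqrt (\<i> * of_real (A $ 1 $ 2)) *
     cis (pi / (A $ 1 $ 2) * (A $ 1 $ 1 * t\<^sup>2 - 2 * \<xi> * t + A $ 2 $ 2 * \<xi>\<^sup>2))"

definition stlct :: "real^2^2 \<Rightarrow> (real \<Rightarrow> complex) \<Rightarrow> (real \<Rightarrow> complex) \<Rightarrow> real \<Rightarrow> real \<Rightarrow> complex" where
  "stlct A \<omega> f x \<xi> = (\<integral>t. f t * cnj (\<omega> (t - x)) * lct_kernel A \<xi> t \<partial>lborel)"

definition chirped_gaussian :: "real^2^2 \<Rightarrow> real \<Rightarrow> real \<Rightarrow> complex" where
  "chirped_gaussian A \<sigma> t = cis (pi * (A $ 1 $ 1 / A $ 1 $ 2) * t\<^sup>2) * gaussian \<sigma> t"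


subsection \<open>Dual generator\<close>

definition theta3 :: "complex \<Rightarrow> complex \<Rightarrow> complex" where
  "theta3 z q = (\<Sum>\<^sub>\<infinity>n::int. q powi (n\<^sup>2) * exp (2 * of_int n * \<i> * z))"

definition inv_fourier :: "(real \<Rightarrow> complex) \<Rightarrow> real \<Rightarrow> complex" where
  "inv_fourier g t = (\<integral>u. g u * cis (2 * pi * u * t) \<partial>lborel)"

definition Lambda :: "real \<Rightarrow> real \<Rightarrow> real \<Rightarrow> complex" where
  "Lambda \<sigma> \<beta> t =
     of_real (exp (- pi\<^sup>2 * \<sigma>\<^sup>2 * t\<^sup>2)) /
     theta3 (of_real (\<beta> / 2 * pi * t)) (of_real (exp (- \<beta>\<^sup>2 / (8 * \<sigma>\<^sup>2))))"

definition dual_generator :: "real \<Rightarrow> real \<Rightarrow> real \<Rightarrow> real \<Rightarrow> complex" where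
  "dual_generator \<sigma> \<beta> \<xi> t =
     of_real (sqrt 2 * exp (\<xi>\<^sup>2 / (4 * \<sigma>\<^sup>2))) * translate (\<xi> / 2) (inv_fourier (Lambda \<sigma> \<beta>)) t"


subsection \<open>Constants\<close>

definition D1 :: "real \<Rightarrow> real \<Rightarrow> real \<Rightarrow> real \<Rightarrow> real \<Rightarrow> real" where
  "D1 \<sigma> \<beta> K \<nu> r =
     4 * sqrt pi * \<sigma> / (\<nu> * \<beta>) * K * exp (r\<^sup>2 / (4 * \<sigma>\<^sup>2)) * (1 + 2 * sqrt (2 * pi) * \<sigma> / \<beta>)\<^sup>2"

definition D2 :: "real \<Rightarrow> real \<Rightarrow> real \<Rightarrow> real \<Rightarrow> real \<Rightarrow> real" where
  "D2 \<sigma> \<beta> K \<nu> r =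
     4 * sqrt pi * K * \<sigma> * exp (r\<^sup>2 / (4 * \<sigma>\<^sup>2)) * (1 + 2 * sqrt (2 * pi) * \<sigma> / \<beta>)\<^sup>2 *
     (1 + 2 / (\<nu> * \<beta>)) * exp (1 + r / \<sigma>)"

definition D3 :: "real \<Rightarrow> real \<Rightarrow> real \<Rightarrow> real \<Rightarrow> real \<Rightarrow> real" where
  "D3 \<sigma> \<beta> K \<nu> r =
     2 * sqrt pi * K * \<sigma> * exp (r\<^sup>2 / (4 * \<sigma>\<^sup>2)) * (1 + 2 * sqrt (2 * pi) * \<sigma> / \<beta>)\<^sup>2 *
     (1 + 2 / (\<nu> * \<beta>))"

definition D4 :: "real \<Rightarrow> real \<Rightarrow> real \<Rightarrow> real \<Rightarrow> real \<Rightarrow> real" where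
  "D4 \<sigma> \<beta> K \<nu> r = 2 * sqrt 2 * K * exp (r\<^sup>2 / (4 * \<sigma>\<^sup>2)) * (1 + 2 / (\<nu> * \<beta>))"

definition kappa :: "real set \<Rightarrow> (real \<Rightarrow> complex) \<Rightarrow> real \<Rightarrow> ereal" where
  "kappa S f \<gamma> = max 1 (Linf_norm S f) / ereal (min \<gamma> (\<gamma>\<^sup>2))"

text \<open>Matrices with rows \<open>-N, \<dots>, N\<close> and columns \<open>-H, \<dots>, H\<close> are functions on \<open>int \<times> int\<close>
  of which only these entries are used.\<close>

definition row_sum_norm :: "nat \<Rightarrow> nat \<Rightarrow> (int \<Rightarrow> int \<Rightarrow> real) \<Rightarrow> real" where
  "row_sum_norm N H \<eta> = (MAX n\<in>{- int N..int N}. \<Sum>k\<in>{- int H..int H}. \<bar>\<eta> n k\<bar>)"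


subsection \<open>Reconstruction algorithm\<close>

text \<open>The sum in Step 1 is real, because \<open>Lambda\<close> is real and even; taking the real part
  only makes the comparison with the threshold and the square root well typed.\<close>

definition alg_A ::
  "real \<Rightarrow> real \<Rightarrow> real \<Rightarrow> nat \<Rightarrow> nat \<Rightarrow> (int \<Rightarrow> int \<Rightarrow> real) \<Rightarrow> real \<Rightarrow> real" where
  "alg_A \<sigma> \<beta> h N H Y t =
     Re (of_real h * (\<Sum>n\<in>{- int N..int N}. \<Sum>k\<in>{- int H..int H}.
           of_real (Y n k) * translate (\<beta> / 2 * of_int n) (dual_generator \<sigma> \<beta> 0) t))"

text \<open>The anchor points are \<open>p 1, \<dots>, p J\<close>.\<close>

definition anchor_points ::
  "(real \<Rightarrow> real) \<Rightarrow> real \<Rightarrow> real \<Rightarrow> real \<Rightarrow> nat \<Rightarrow> (nat \<Rightarrow> real) \<Rightarrow> bool" where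
  "anchor_points \<A> r \<gamma>' s J p \<longleftrightarrow>
     J \<ge> 2 \<and> p 1 = - s \<and> p J = s \<and>
     (\<forall>j\<in>{1..J-1}. p j < p (j + 1)) \<and>
     (\<forall>j\<in>{1..J}. \<A> (p j) \<ge> \<gamma>') \<and>
     (\<forall>j\<in>{1..J-1}. p (j + 1) - p j \<le> r) \<and>
     (J \<ge> 3 \<longrightarrow> (\<forall>j\<in>{1..J-2}. p (j + 2) - p j \<ge> r))"

definition alg_R ::
  "real^2^2 \<Rightarrow> real \<Rightarrow> real \<Rightarrow> real \<Rightarrow> nat \<Rightarrow> nat \<Rightarrow> (int \<Rightarrow> int \<Rightarrow> real) \<Rightarrow> (nat \<Rightarrow> real) \<Rightarrow>
   nat \<Rightarrow> real \<Rightarrow> complex" where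
  "alg_R A \<sigma> \<beta> h N H Y p j \<xi> =
     of_real (h / sqrt (alg_A \<sigma> \<beta> h N H Y (p j))) *
     (\<Sum>n\<in>{- int N..int N}. cis (- (pi * A $ 1 $ 1 * \<beta> * of_int n * \<xi> / A $ 1 $ 2)) *
       (\<Sum>k\<in>{- int H..int H}. of_real (Y n k) * cis (2 * pi * \<xi> * h * of_int k / A $ 1 $ 2) *
          translate (\<beta> / 2 * of_int n) (dual_generator \<sigma> \<beta> \<xi>) (p j + \<xi>)))"

text \<open>The remaining steps only depend on the local functions \<open>R j\<close> and the anchor points.\<close>

definition alg_rho :: "(nat \<Rightarrow> real \<Rightarrow> complex) \<Rightarrow> (nat \<Rightarrow> real) \<Rightarrow> nat \<Rightarrow> complex" where
  "alg_rho R p j = R j (p (j + 1) - p j) / of_real (cmod (R j (p (j + 1) - p j)))"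

definition alg_mu :: "nat \<Rightarrow> nat" where
  "alg_mu J = nat \<lceil>real J / 2\<rceil>"

definition alg_piece :: "nat \<Rightarrow> (nat \<Rightarrow> real) \<Rightarrow> nat \<Rightarrow> real set" where
  "alg_piece J p j =
     (if j < alg_mu J then {p j..<p (j + 1)}
      else if j = alg_mu J then {p j..p (j + 1)}
      else {p j<..p (j + 1)})"

definition alg_phase :: "nat \<Rightarrow> (nat \<Rightarrow> real \<Rightarrow> complex) \<Rightarrow> (nat \<Rightarrow> real) \<Rightarrow> nat \<Rightarrow> complex" where
  "alg_phase J R p j =
     (if j < alg_mu J then cnj (\<Prod>i\<in>{j..<alg_mu J}. alg_rho R p i)
      else (\<Prod>i\<in>{alg_mu J..<j}. alg_rho R p i))"

text \<open>The pieces with index \<open>1, \<dots>, J - 1\<close> partition \<open>{p 1..p J}\<close>, so \<open>j\<close> below is well defined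
  for \<open>t\<close> in this interval; values outside of it are irrelevant.\<close>

definition alg_output ::
  "nat \<Rightarrow> (nat \<Rightarrow> real \<Rightarrow> complex) \<Rightarrow> (nat \<Rightarrow> real) \<Rightarrow> real \<Rightarrow> complex" where
  "alg_output J R p t =
     (let j = (THE j. j \<in> {1..J-1} \<and> t \<in> alg_piece J p j)
      in alg_phase J R p j * R j (t - p j))"

end

theory Submission
  imports Defs "HOL-Probability.Characteristic_Functions"
begin

text \<open>The squared modulus of the short-time transform at time \<open>\<beta> n / 2\<close> is, up to a chirp, the squared
  modulus of the Fourier transform of a Gaussian-windowed piece of \<open>f\<close>. Integrated over the frequency
  against a character of parameter \<open>\<xi>\<close>, it gives a Gaussian average \<open>gram n \<xi>\<close> of
  \<open>f (\<cdot> + \<xi>) * cnj f\<close>. This product lies in a Gaussian shift-invariant space over the lattice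
  \<open>\<beta> / 2 \<int>\<close>, and the dual generator inverts the averaging, so that summing
  \<open>gram n \<xi>\<close> against its shifts returns \<open>f (p + \<xi>) * cnj (f p)\<close> exactly.

  The algorithm replaces the integral by a finite Riemann sum, truncates the sum over \<open>n\<close> and adds
  noise. The Riemann sum is compared with the integral by Poisson summation for Gaussians. Each of the four
  errors is at most \<open>r \<epsilon> / (16 s)\<close>. Dividing by \<open>\<bar>f p\<bar>\<close> determines \<open>f\<close> near each anchor up to a phase;
  the phases are glued outwards from the middle anchor, which takes at most \<open>2 s / r\<close> steps in each
  direction, so the phase errors add up to a multiple of \<open>\<epsilon>\<close>.\<close>


subsection \<open>Sums over the integers\<close>

text \<open>The inversion is exact because of one algebraic identity: completing squares splits the
  weight of a pair (k, l) into a factor free of n and a Gaussian in \<open>k + l - n\<close>. For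
  every pair, summing over n against shifts of \<open>L\<close> is therefore the same lattice
  convolution, and its symbol is the theta function that \<open>Lambda\<close> has in its
  denominator. As n is compared with k + l, the natural step is half of \<beta>.

  \<open>gram\<close> is given in closed form, so the frequency integral itself is never evaluated:
  Poisson summation turns the Riemann sum into a series of displaced copies of \<open>gram\<close>,
  and the undisplaced copy is the wanted value.

  The constants have a common core. \<open>D4\<close> bounds the sum of the generator values that
  multiply the row errors; \<open>D3\<close> is \<open>D4\<close> times a bound on
  \<open>gram\<close>, up to the square of the coefficient bound; \<open>D2\<close> has the further
  factor \<open>2 * exp (1 + r / \<sigma>)\<close> from summing the copies; \<open>D1\<close> has
  the tail of a geometric series where \<open>D3\<close> has a full lattice sum.\<close>

lemma summable_on_norm_le:
  fixes f :: "'a \<Rightarrow> 'b::banach"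
  assumes "g summable_on A" "\<And>x. x \<in> A \<Longrightarrow> norm (f x) \<le> g x"
  shows "f summable_on A"
proof -
  have "(\<lambda>x. norm (f x)) summable_on A"
    by (rule summable_on_comparison_test[OF assms(1)]) (use assms(2) in auto)
  then show ?thesis by (rule abs_summable_summable)
qed

lemma norm_infsum_le_infsum:
  fixes f :: "'a \<Rightarrow> 'b::banach"
  assumes "g summable_on A" "\<And>x. x \<in> A \<Longrightarrow> norm (f x) \<le> g x"
  shows "norm (infsum f A) \<le> infsum g A"
  using norm_infsum_le[OF has_sum_infsum[OF summable_on_norm_le[OF assms]] has_sum_infsum[OF assms(1)] assms(2)]
  by simp

lemma bij_int_neg: "bij_betw (\<lambda>i. - int i - 1) UNIV {..<0}"
  by (rule bij_betwI[where g = "\<lambda>k. nat (- k - 1)"]) auto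

lemma bij_int_nonneg: "bij_betw int UNIV {0..}"
  by (rule bij_betwI[where g = nat]) auto

lemma has_sum_suminf_nonneg:
  fixes f :: "nat \<Rightarrow> real"
  assumes "summable f" "\<And>i. f i \<ge> 0"
  shows "(f has_sum suminf f) UNIV"
  using assms by (intro sums_nonneg_imp_has_sum) (auto intro: summable_sums)

lemma has_sum_int_split:
  fixes f :: "int \<Rightarrow> 'a::{topological_comm_monoid_add,t2_space}"
  assumes "((\<lambda>i. f (int i)) has_sum a) UNIV" "((\<lambda>i. f (- int i - 1)) has_sum b) UNIV"
  shows "(f has_sum (a + b)) UNIV"
proof -
  have "(f has_sum a) {0..}"
    using has_sum_reindex_bij_betw[OF bij_int_nonneg, of f a] assms(1) by simp
  moreover have "(f has_sum b) {..<0}"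
    using has_sum_reindex_bij_betw[OF bij_int_neg, of f b] assms(2) by simp
  ultimately have "(f has_sum (a + b)) ({0..} \<union> {..<0})"
    by (intro has_sum_Un_disjoint) auto
  also have "{0..} \<union> {..<0} = (UNIV :: int set)" by auto
  finally show ?thesis .
qed

text \<open>The negative half is indexed by \<open>- int i - 1\<close>, so that 0 is counted once
  and both majorants are sums over the naturals, where geometric and Gaussian series are
  available.\<close>

lemma int_infsum_le:
  fixes f :: "int \<Rightarrow> real"
  assumes nn: "\<And>k. f k \<ge> 0"
    and g: "(g has_sum a) UNIV" "\<And>i. f (int i) \<le> g i"
    and g': "(g' has_sum b) UNIV" "\<And>i. f (- int i - 1) \<le> g' i"
  shows "f summable_on UNIV" "infsum f UNIV \<le> a + b"
proof -
  have s1: "(\<lambda>i. f (int i)) summable_on UNIV"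
    using g(2) nn by (intro summable_on_norm_le[OF has_sum_imp_summable[OF g(1)]]) auto
  have s2: "(\<lambda>i. f (- int i - 1)) summable_on UNIV"
    using g'(2) nn by (intro summable_on_norm_le[OF has_sum_imp_summable[OF g'(1)]]) auto
  have s: "(f has_sum (infsum (\<lambda>i. f (int i)) UNIV + infsum (\<lambda>i. f (- int i - 1)) UNIV)) UNIV"
    by (rule has_sum_int_split) (use s1 s2 in auto)
  then show "f summable_on UNIV" by (rule has_sum_imp_summable)
  have "infsum (\<lambda>i. f (int i)) UNIV \<le> a"
    using has_sum_mono[OF has_sum_infsum[OF s1] g(1)] g(2) by auto
  moreover have "infsum (\<lambda>i. f (- int i - 1)) UNIV \<le> b"
    using has_sum_mono[OF has_sum_infsum[OF s2] g'(1)] g'(2) by auto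
  ultimately show "infsum f UNIV \<le> a + b"
    using infsumI[OF s] by simp
qed

lemma has_sum_geometric_nat:
  fixes x :: real
  assumes "0 \<le> x" "x < 1"
  shows "((\<lambda>i. C * x ^ i) has_sum (C / (1 - x))) (UNIV :: nat set)"
proof -
  have "((\<lambda>i. x ^ i) has_sum (1 / (1 - x))) (UNIV :: nat set)"
    using assms geometric_sums[of x] by (intro sums_nonneg_imp_has_sum) auto
  from has_sum_cmult_right[OF this, of C] show ?thesis by simp
qed

lemma summable_on_exp_abs_int:
  assumes "a > 0"
  shows "(\<lambda>k::int. exp (- a * \<bar>real_of_int k\<bar>)) summable_on UNIV"
proof (rule int_infsum_le(1))
  have lt: "exp (- a) < 1" using assms by simp
  show "((\<lambda>i. 1 * exp (- a) ^ i) has_sum (1 / (1 - exp (- a)))) UNIV"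
    by (rule has_sum_geometric_nat) (use lt in auto)
  show "((\<lambda>i. 1 * exp (- a) ^ i) has_sum (1 / (1 - exp (- a)))) UNIV"
    by (rule has_sum_geometric_nat) (use lt in auto)
  show "exp (- a * \<bar>real_of_int (int i)\<bar>) \<le> 1 * exp (- a) ^ i" for i
    by (simp add: exp_of_nat_mult[symmetric] mult.commute)
  show "exp (- a * \<bar>real_of_int (- int i - 1)\<bar>) \<le> 1 * exp (- a) ^ i" for i
    using assms by (simp add: exp_of_nat_mult[symmetric] algebra_simps)
qed auto

lemma summable_on_gauss_int:
  assumes "a > 0"
  shows "(\<lambda>k::int. exp (- a * (real_of_int k)\<^sup>2)) summable_on UNIV"
proof (rule summable_on_norm_le[OF summable_on_exp_abs_int[OF assms]])
  fix k :: int
  have "\<bar>real_of_int k\<bar> \<le> (real_of_int k)\<^sup>2"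
  proof -
    have "\<bar>k\<bar> \<le> k\<^sup>2" using mult_mono[of 1 "\<bar>k\<bar>" "\<bar>k\<bar>" "\<bar>k\<bar>"] by (cases "k = 0") (auto simp: power2_eq_square)
    then have "real_of_int \<bar>k\<bar> \<le> real_of_int (k\<^sup>2)" by linarith
    then show ?thesis by simp
  qed
  then show "norm (exp (- a * (real_of_int k)\<^sup>2)) \<le> exp (- a * \<bar>real_of_int k\<bar>)"
    using assms by (simp add: mult_left_mono)
qed

text \<open>From (x - 2 y)^2 >= 0. Half of the decay is traded for a factor depending on the shift
  only, which gives majorants uniform over bounded sets of shifts.\<close>

lemma gauss_shift_le:
  fixes a x y :: real
  assumes "a > 0"
  shows "exp (- a * (x - y)\<^sup>2) \<le> exp (a * y\<^sup>2) * exp (- (a / 2) * x\<^sup>2)"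
proof -
  have "0 \<le> (x - 2 * y)\<^sup>2" by simp
  then have "x\<^sup>2 / 2 - y\<^sup>2 \<le> (x - y)\<^sup>2"
    by (simp add: power2_eq_square algebra_simps)
  then have "a * (x\<^sup>2 / 2 - y\<^sup>2) \<le> a * (x - y)\<^sup>2"
    using assms by (intro mult_left_mono) auto
  then show ?thesis by (simp add: exp_add[symmetric] algebra_simps)
qed

lemma summable_on_gauss_shift:
  assumes "a > 0"
  shows "(\<lambda>k::int. exp (- a * (real_of_int k - y)\<^sup>2)) summable_on UNIV"
proof (rule summable_on_norm_le)
  show "(\<lambda>k::int. exp (a * y\<^sup>2) * exp (- (a / 2) * (real_of_int k)\<^sup>2)) summable_on UNIV"
    using assms summable_on_gauss_int[of "a / 2"] by (intro summable_on_cmult_right) auto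
qed (use assms gauss_shift_le in auto)

section \<open>Interchange of sums and integrals\<close>

lemma int_infsum_integral:
  fixes f :: "int \<Rightarrow> 'a \<Rightarrow> complex"
  assumes int: "\<And>i. integrable M (f i)"
    and sum: "(\<lambda>i. \<integral>x. norm (f i x) \<partial>M) summable_on UNIV"
    and pt: "\<And>x. x \<in> space M \<Longrightarrow> (\<lambda>i. norm (f i x)) summable_on UNIV"
  shows "integrable M (\<lambda>x. \<Sum>\<^sub>\<infinity>i. f i x)"
    and "(\<integral>x. (\<Sum>\<^sub>\<infinity>i. f i x) \<partial>M) = (\<Sum>\<^sub>\<infinity>i. \<integral>x. f i x \<partial>M)"
proof -
  \<comment> \<open>Enumerating the integers by \<open>int_decode\<close> turns the sum into a
    series, for which integration term by term is available; absolute summability makes the order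
    immaterial.\<close>
  define h where "h = (\<lambda>n. f (int_decode n))"
  have eq: "(\<Sum>\<^sub>\<infinity>i. F i) = (\<Sum>n. F (int_decode n))" if "(\<lambda>i. norm (F i)) summable_on UNIV" for F :: "int \<Rightarrow> complex"
  proof -
    have 1: "(\<Sum>\<^sub>\<infinity>i. F i) = (\<Sum>\<^sub>\<infinity>n. F (int_decode n))"
      using infsum_reindex_bij_betw[OF bij_int_decode, of F] by simp
    have "(\<lambda>n. F (int_decode n)) summable_on UNIV"
      using abs_summable_summable[OF that] summable_on_reindex_bij_betw[OF bij_int_decode, of F] by simp
    then have "(\<lambda>n. F (int_decode n)) sums (\<Sum>\<^sub>\<infinity>n. F (int_decode n))"
      by (intro has_sum_imp_sums) simp
    then show ?thesis using 1 by (simp add: sums_iff)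
  qed
  have summ: "summable (\<lambda>n. G (int_decode n))" if "G summable_on UNIV" for G :: "int \<Rightarrow> real"
    using that summable_on_reindex_bij_betw[OF bij_int_decode, of G] summable_on_imp_summable by simp
  have i1: "integrable M (h n)" for n unfolding h_def by (rule int)
  have i2: "AE x in M. summable (\<lambda>n. norm (h n x))"
    unfolding h_def by (intro AE_I2) (rule summ[OF pt])
  have i3: "summable (\<lambda>n. \<integral>x. norm (h n x) \<partial>M)"
    unfolding h_def by (rule summ[OF sum])
  have e: "(\<Sum>\<^sub>\<infinity>i. f i x) = (\<Sum>n. h n x)" if "x \<in> space M" for x
    unfolding h_def by (rule eq[OF pt[OF that]])
  show "integrable M (\<lambda>x. \<Sum>\<^sub>\<infinity>i. f i x)"
    using integrable_suminf[OF i1 i2 i3] e by (subst Bochner_Integration.integrable_cong[OF refl e]) auto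
  have "(\<lambda>i. norm (\<integral>x. f i x \<partial>M)) summable_on UNIV"
    by (rule summable_on_norm_le[OF sum]) simp
  then have "(\<Sum>\<^sub>\<infinity>i. \<integral>x. f i x \<partial>M) = (\<Sum>n. \<integral>x. h n x \<partial>M)"
    unfolding h_def by (rule eq)
  moreover have "(\<integral>x. (\<Sum>\<^sub>\<infinity>i. f i x) \<partial>M) = (\<integral>x. (\<Sum>n. h n x) \<partial>M)"
    by (rule Bochner_Integration.integral_cong) (use e in auto)
  ultimately show "(\<integral>x. (\<Sum>\<^sub>\<infinity>i. f i x) \<partial>M) = (\<Sum>\<^sub>\<infinity>i. \<integral>x. f i x \<partial>M)"
    using integral_suminf[OF i1 i2 i3] by simp
qed

lemma continuous_on_int_infsum:
  fixes f :: "int \<Rightarrow> real \<Rightarrow> complex"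
  assumes "\<And>k. continuous_on S (f k)" "\<And>k x. x \<in> S \<Longrightarrow> norm (f k x) \<le> g k" "g summable_on UNIV"
  shows "continuous_on S (\<lambda>x. \<Sum>\<^sub>\<infinity>k. f k x)"
proof -
  have "uniform_limit S (\<lambda>X y. \<Sum>k\<in>X. f k y) (\<lambda>y. \<Sum>\<^sub>\<infinity>k. f k y) (finite_subsets_at_top UNIV)"
    by (rule Weierstrass_m_test_general[OF _ assms(3)]) (use assms(2) in auto)
  then show ?thesis
    by (rule uniform_limit_theorem[rotated]) (use assms(1) in \<open>auto intro!: always_eventually continuous_on_sum\<close>)
qed

text \<open>Tonelli, then Fubini: the row sums of the majorant \<open>G\<close> are bounded by the
  summable \<open>h\<close>, so \<open>G\<close> is summable over the product, and \<open>f\<close>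
  with it.\<close>

lemma infsum_swap_dominated:
  fixes f :: "'a \<Rightarrow> 'b \<Rightarrow> 'c::banach"
  assumes f: "\<And>x y. norm (f x y) \<le> G x y" and G: "\<And>x. G x summable_on UNIV"
    and h: "\<And>x. infsum (G x) UNIV \<le> h x" "h summable_on UNIV"
  shows "(\<Sum>\<^sub>\<infinity>x. \<Sum>\<^sub>\<infinity>y. f x y) = (\<Sum>\<^sub>\<infinity>y. \<Sum>\<^sub>\<infinity>x. f x y)"
    and "(\<lambda>(x, y). f x y) summable_on UNIV \<times> UNIV"
proof -
  have nn: "G x y \<ge> 0" for x y
    using f[of x y] norm_ge_zero order_trans by blast
  have "(\<lambda>(x, y). G x y) summable_on UNIV \<times> UNIV"
  proof (rule summable_on_SigmaI)
    show "((\<lambda>y. case (x, y) of (x, y) \<Rightarrow> G x y) has_sum infsum (G x) UNIV) UNIV" for x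
      using G[of x] by simp
    show "(\<lambda>x. infsum (G x) UNIV) summable_on UNIV"
      by (rule summable_on_norm_le[OF h(2)]) (use h(1) nn in \<open>auto simp: abs_of_nonneg infsum_nonneg\<close>)
  qed (use nn in auto)
  then show s: "(\<lambda>(x, y). f x y) summable_on UNIV \<times> UNIV"
    by (rule summable_on_norm_le) (use f in auto)
  show "(\<Sum>\<^sub>\<infinity>x. \<Sum>\<^sub>\<infinity>y. f x y) = (\<Sum>\<^sub>\<infinity>y. \<Sum>\<^sub>\<infinity>x. f x y)"
    by (rule infsum_swap_banach[OF s])
qed

lemma has_sum_times:
  fixes f :: "'a \<Rightarrow> 'c::{banach,real_normed_algebra}" and g :: "'b \<Rightarrow> 'c"
  assumes F: "F summable_on UNIV" "\<And>x. norm (f x) \<le> F x"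
    and G: "G summable_on UNIV" "\<And>y. norm (g y) \<le> G y"
  shows "((\<lambda>(x, y). f x * g y) has_sum (infsum f UNIV * infsum g UNIV)) UNIV"
proof -
  have sf: "f summable_on UNIV" by (rule summable_on_norm_le[OF F(1)]) (rule F(2))
  have sg: "g summable_on UNIV" by (rule summable_on_norm_le[OF G(1)]) (rule G(2))
  have F0: "F x \<ge> 0" for x using F(2)[of x] norm_ge_zero order_trans by blast
  have s: "(\<lambda>(x, y). f x * g y) summable_on UNIV \<times> UNIV"
  proof (rule infsum_swap_dominated(2))
    show "norm (f x * g y) \<le> F x * G y" for x y
      using mult_mono[OF F(2) G(2), of x y] norm_mult_ineq[of "f x" "g y"] F0 by (auto intro: order_trans)
    show "(\<lambda>y. F x * G y) summable_on UNIV" for x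
      by (intro summable_on_cmult_right G)
    show "infsum (\<lambda>y. F x * G y) UNIV \<le> F x * infsum G UNIV" for x
      using G by (simp add: infsum_cmult_right)
    show "(\<lambda>x. F x * infsum G UNIV) summable_on UNIV"
      by (intro summable_on_cmult_left F)
  qed
  have "((\<lambda>(x, y). f x * g y) has_sum (infsum f UNIV * infsum g UNIV)) (UNIV \<times> UNIV)"
  proof (rule has_sum_SigmaI[OF _ _ s])
    show "((\<lambda>y. case (x, y) of (x, y) \<Rightarrow> f x * g y) has_sum f x * infsum g UNIV) UNIV" for x
      using sg by (auto intro!: has_sum_cmult_right)
    show "((\<lambda>x. f x * infsum g UNIV) has_sum (infsum f UNIV * infsum g UNIV)) UNIV"
      using sf by (auto intro!: has_sum_cmult_left)
  qed
  then show ?thesis by simp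
qed

text \<open>Both tails are indexed by the distance past the cut. The same form serves the truncation
  in time, the truncation in frequency and, with \<open>N = 0\<close>, the sum over the nonzero
  aliases.\<close>

lemma infsum_outside_le:
  fixes f :: "int \<Rightarrow> real"
  assumes nn: "\<And>k. f k \<ge> 0"
    and g: "(g has_sum a) UNIV" "\<And>i. f (int N + 1 + int i) \<le> g i"
    and g': "(g' has_sum b) UNIV" "\<And>i. f (- (int N + 1 + int i)) \<le> g' i"
  shows "infsum f (- {- int N..int N}) \<le> a + b"
proof -
  have s1: "(\<lambda>i. f (int N + 1 + int i)) summable_on UNIV"
    using g(2) nn by (intro summable_on_norm_le[OF has_sum_imp_summable[OF g(1)]]) auto
  have s2: "(\<lambda>i. f (- (int N + 1 + int i))) summable_on UNIV"
    using g'(2) nn by (intro summable_on_norm_le[OF has_sum_imp_summable[OF g'(1)]]) auto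
  have b1: "bij_betw (\<lambda>i. int N + 1 + int i) UNIV {int N + 1..}"
    by (rule bij_betwI[where g = "\<lambda>k. nat (k - int N - 1)"]) auto
  have b2: "bij_betw (\<lambda>i. - (int N + 1 + int i)) UNIV {..- int N - 1}"
    by (rule bij_betwI[where g = "\<lambda>k. nat (- k - int N - 1)"]) auto
  have "(f has_sum infsum (\<lambda>i. f (int N + 1 + int i)) UNIV) {int N + 1..}"
    by (rule has_sum_reindex_bij_betw[OF b1, THEN iffD1, OF has_sum_infsum[OF s1]])
  moreover have "(f has_sum infsum (\<lambda>i. f (- (int N + 1 + int i))) UNIV) {..- int N - 1}"
    by (rule has_sum_reindex_bij_betw[OF b2, THEN iffD1, OF has_sum_infsum[OF s2]])
  ultimately have "(f has_sum (infsum (\<lambda>i. f (int N + 1 + int i)) UNIV + infsum (\<lambda>i. f (- (int N + 1 + int i))) UNIV)) ({int N + 1..} \<union> {..- int N - 1})"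
    by (intro has_sum_Un_disjoint) auto
  also have "{int N + 1..} \<union> {..- int N - 1} = - {- int N..int N}" by auto
  finally have "infsum f (- {- int N..int N}) = infsum (\<lambda>i. f (int N + 1 + int i)) UNIV + infsum (\<lambda>i. f (- (int N + 1 + int i))) UNIV"
    by (rule infsumI)
  moreover have "infsum (\<lambda>i. f (int N + 1 + int i)) UNIV \<le> a"
    using has_sum_mono[OF has_sum_infsum[OF s1] g(1)] g(2) by auto
  moreover have "infsum (\<lambda>i. f (- (int N + 1 + int i))) UNIV \<le> b"
    using has_sum_mono[OF has_sum_infsum[OF s2] g'(1)] g'(2) by auto
  ultimately show ?thesis by simp
qed

lemma infsum_split_outside:
  fixes f :: "int \<Rightarrow> 'a::banach"
  assumes "f summable_on UNIV"
  shows "infsum f UNIV = sum f {- int N..int N} + infsum f (- {- int N..int N})"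
proof -
  have "f summable_on (- {- int N..int N})"
    using assms by (rule summable_on_subset_banach) auto
  then have "infsum f ({- int N..int N} \<union> - {- int N..int N}) = infsum f {- int N..int N} + infsum f (- {- int N..int N})"
    by (intro infsum_Un_disjoint) auto
  then show ?thesis by simp
qed

section \<open>Exponential sums over a lattice\<close>

lemma geometric_le:
  fixes x :: real
  assumes "x > 0"
  shows "1 / (1 - exp (- x)) \<le> 1 + 1 / x"
proof -
  have "exp (- x) \<le> 1 / (1 + x)"
    using exp_ge_add_one_self[of x] assms by (simp add: exp_minus inverse_eq_divide frac_le)
  then have "x / (1 + x) \<le> 1 - exp (- x)"
    using assms by (simp add: field_simps)
  then have "1 / (1 - exp (- x)) \<le> 1 / (x / (1 + x))"
    using assms by (intro divide_left_mono) auto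
  then show ?thesis using assms by (simp add: field_simps)
qed

text \<open>After recentring at \<open>\<lceil>t / d\<rceil>\<close>, the i-th point of each half
  has distance at least \<open>d * i\<close> from \<open>t\<close>, so a geometric series dominates.
  With d = \<beta> / 2 this is the origin of the factor \<open>1 + 2 / (\<nu> * \<beta>)\<close> in
  the constants.\<close>

lemma exp_abs_lattice_sum:
  fixes t d :: real
  assumes "\<nu> > 0" "d > 0"
  shows "(\<lambda>n::int. exp (- \<nu> * \<bar>t - d * of_int n\<bar>)) summable_on UNIV"
    and "(\<Sum>\<^sub>\<infinity>n::int. exp (- \<nu> * \<bar>t - d * of_int n\<bar>)) \<le> 2 * (1 + 1 / (\<nu> * d))"
proof -
  let ?f = "\<lambda>n::int. exp (- \<nu> * \<bar>t - d * of_int n\<bar>)"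
  define n0 where "n0 = \<lceil>t / d\<rceil>"
  have bij: "bij_betw (\<lambda>m. n0 + m) UNIV UNIV"
    by (rule bij_betwI[where g = "\<lambda>k. k - n0"]) auto
  define x where "x = \<nu> * d"
  have x: "x > 0" using assms by (simp add: x_def)
  have up: "t \<le> d * of_int n0"
  proof -
    have "t / d \<le> of_int n0" unfolding n0_def by (rule le_of_int_ceiling)
    then show ?thesis using assms by (simp add: pos_divide_le_eq mult.commute)
  qed
  have dn: "d * (of_int n0 - 1) \<le> t"
  proof -
    have "of_int n0 - 1 < t / d" unfolding n0_def using ceiling_correct[of "t / d"] by simp
    then show ?thesis using assms by (simp add: pos_less_divide_eq mult.commute)
  qed
  have pw: "exp (- x) ^ i = exp (- \<nu> * (d * real i))" for i
    by (simp add: exp_of_nat_mult[symmetric] x_def mult_ac)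
  have g: "((\<lambda>i. 1 * exp (- x) ^ i) has_sum (1 / (1 - exp (- x)))) UNIV"
    by (rule has_sum_geometric_nat) (use x in auto)
  have l1: "?f (n0 + int i) \<le> 1 * exp (- x) ^ i" for i
  proof -
    have "d * real i \<le> \<bar>t - d * of_int (n0 + int i)\<bar>"
      using up by (simp add: algebra_simps)
    then show ?thesis unfolding pw using assms by simp
  qed
  have l2: "?f (n0 + (- int i - 1)) \<le> 1 * exp (- x) ^ i" for i
  proof -
    have "d * real i \<le> \<bar>t - d * of_int (n0 + (- int i - 1))\<bar>"
      using dn by (simp add: algebra_simps)
    then show ?thesis unfolding pw using assms by simp
  qed
  have "(\<lambda>m. ?f (n0 + m)) summable_on UNIV" "(\<Sum>\<^sub>\<infinity>m. ?f (n0 + m)) \<le> 1 / (1 - exp (- x)) + 1 / (1 - exp (- x))"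
    by (rule int_infsum_le[OF _ g l1 g l2]; simp)+
  then show "?f summable_on UNIV" "infsum ?f UNIV \<le> 2 * (1 + 1 / (\<nu> * d))"
    using summable_on_reindex_bij_betw[OF bij, of ?f] infsum_reindex_bij_betw[OF bij, of ?f] geometric_le[OF x]
    by (simp_all add: x_def)
qed

subsection \<open>Poisson summation\<close>

text \<open>The half-open interval makes the integer translates tile the line without overlap, so
  unfolding an integral over the line needs no correction at endpoints.\<close>

definition period_measure :: "real measure" where
  "period_measure = restrict_space lborel {-1/2..<1/2}"

lemma space_period_measure: "space period_measure = {-1/2..<1/2}"
  by (simp add: period_measure_def space_restrict_space)

lemma integral_period_measure:
  fixes F :: "real \<Rightarrow> 'a::{banach,second_countable_topology}"
  shows "(\<integral>t. F t \<partial>period_measure) = (\<integral>t. indicator {-1/2..<1/2} t *\<^sub>R F t \<partial>lborel)"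
  unfolding period_measure_def by (subst integral_restrict_space) auto

lemma integrable_period_measure:
  fixes F :: "real \<Rightarrow> 'a::{banach,second_countable_topology}"
  assumes "continuous_on {-1/2..1/2} F"
  shows "integrable period_measure F"
proof -
  have "set_integrable lborel {-1/2..1/2} F"
    using borel_integrable_compact[OF _ assms] by (simp add: set_integrable_def)
  then have "set_integrable lborel {-1/2..<1/2} F"
    by (rule set_integrable_subset) auto
  then show ?thesis
    unfolding period_measure_def set_integrable_def by (subst integrable_restrict_space) auto
qed

text \<open>Only the frequencies -1, 0 and 1 occur. Multiplication by this function thus stays
  within trigonometric polynomials, and an induction reaches all its powers.\<close>

lemma cos_sq_cis: "complex_of_real ((cos (pi * t))\<^sup>2) = 1 / 2 + cis (2 * pi * t) / 4 + cis (2 * pi * (- t)) / 4"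
proof -
  have "cos (2 * (pi * t)) = 2 * (cos (pi * t))\<^sup>2 - 1"
    by (rule cos_double_cos)
  then show ?thesis
    by (simp add: complex_eq_iff algebra_simps)
qed

text \<open>The trigonometric polynomials \<open>cos (\<pi> t) ^ (2 n)\<close> concentrate at \<open>0\<close>, so their integrals against
  \<open>D\<close>, which all vanish, would eventually see the sign of \<open>Re (cnj (D 0) * D t)\<close> near \<open>0\<close>.\<close>

lemma fourier_zero_imp_zero:
  fixes D :: "real \<Rightarrow> complex"
  assumes cont: "continuous_on {-1/2..1/2} D"
    and zero: "\<And>j::int. (\<integral>t. D t * cis (2 * pi * of_int j * t) \<partial>period_measure) = 0"
  shows "D 0 = 0"
proof (rule ccontr)
  assume nz: "D 0 \<noteq> 0"
  define k where "k = (\<lambda>t::real. (cos (pi * t))\<^sup>2)"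
  have kc: "continuous_on S (\<lambda>t. complex_of_real (k t ^ n))" for S n
    unfolding k_def by (intro continuous_intros)
  have int: "integrable period_measure (\<lambda>t. D t * cis (2 * pi * of_int j * t) * of_real (k t ^ n))" for j :: int and n
    by (intro integrable_period_measure continuous_intros cont kc)
  \<comment> \<open>The frequency j stays arbitrary in the induction, because one more factor
    \<open>k t\<close> combines the frequencies j - 1, j and j + 1.\<close>
  have z: "(\<integral>t. D t * cis (2 * pi * of_int j * t) * of_real (k t ^ n) \<partial>period_measure) = 0" for j :: int and n
  proof (induction n arbitrary: j)
    case 0
    then show ?case using zero by simp
  next
    case (Suc n)
    define F where "F = (\<lambda>j t. D t * cis (2 * pi * of_int j * t) * of_real (k t ^ n))"
    have F0: "integrable period_measure (F j)" "(\<integral>t. F j t \<partial>period_measure) = 0" for j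
      using int[of j n] Suc[of j] by (simp_all add: F_def)
    have "D t * cis (2 * pi * of_int j * t) * of_real (k t ^ Suc n) = F j t / 2 + F (j + 1) t / 4 + F (j - 1) t / 4" for t
    proof -
      have "cis (2 * pi * of_int (j + 1) * t) = cis (2 * pi * of_int j * t) * cis (2 * pi * t)"
        "cis (2 * pi * of_int (j - 1) * t) = cis (2 * pi * of_int j * t) * cis (2 * pi * (- t))"
        by (simp_all add: cis_mult algebra_simps)
      then show ?thesis
        using cos_sq_cis[of t] by (simp add: k_def F_def algebra_simps)
    qed
    then show ?case
      using F0 by (simp del: power_Suc)
  qed
  \<comment> \<open>The factor \<open>cnj (D 0)\<close> rotates the value at 0 onto the positive
    axis, so that signs of a real function can be compared.\<close>
  define u where "u = (\<lambda>t. Re (cnj (D 0) * D t))"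
  have uc: "continuous_on {-1/2..1/2} u"
    unfolding u_def by (intro continuous_intros cont)
  have uz: "(\<integral>t. u t * k t ^ n \<partial>period_measure) = 0" for n
  proof -
    have i0: "integrable period_measure (\<lambda>t. cnj (D 0) * (D t * of_real (k t ^ n)))"
      by (intro integrable_period_measure continuous_intros cont kc)
    have "(\<integral>t. u t * k t ^ n \<partial>period_measure) = (\<integral>t. Re (cnj (D 0) * (D t * of_real (k t ^ n))) \<partial>period_measure)"
      by (intro Bochner_Integration.integral_cong) (auto simp: u_def algebra_simps)
    also have "\<dots> = Re (\<integral>t. cnj (D 0) * (D t * of_real (k t ^ n)) \<partial>period_measure)"
      using i0 by (rule integral_Re)
    also have "(\<integral>t. cnj (D 0) * (D t * of_real (k t ^ n)) \<partial>period_measure) = 0"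
      using z[of 0 n] by simp
    finally show ?thesis by simp
  qed
  define d where "d = (cmod (D 0))\<^sup>2"
  have d: "d > 0" using nz by (simp add: d_def)
  have u0: "u 0 = d"
    unfolding u_def d_def cmod_power2 by (simp add: power2_eq_square)
  obtain \<delta>0 where d0: "\<delta>0 > 0" "\<And>t. t \<in> {-1/2..1/2} \<Longrightarrow> dist t 0 < \<delta>0 \<Longrightarrow> dist (u t) (u 0) < d / 2"
    using uc[unfolded continuous_on_iff, rule_format, of 0 "d / 2"] d by auto
  define \<delta> where "\<delta> = min (\<delta>0 / 2) (1 / 4)"
  have \<delta>: "\<delta> > 0" "\<delta> < \<delta>0" "\<delta> < 1/2" using d0(1) by (auto simp: \<delta>_def)
  have "bounded (u ` {-1/2..1/2})"
    by (intro compact_imp_bounded compact_continuous_image uc) auto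
  then obtain B where "\<forall>x\<in>u ` {-1/2..1/2}. norm x \<le> B"
    unfolding bounded_iff by blast
  then have B: "\<And>t. t \<in> {-1/2..1/2} \<Longrightarrow> norm (u t) \<le> B"
    by auto
  have B0: "B \<ge> 0" using B[of 0] by auto
  \<comment> \<open>\<open>a\<close> is the minimum of \<open>k\<close> on the interval of radius
    \<delta> / 2, and \<open>b\<close> its maximum on the period outside the interval of radius
    \<delta>. Because of the gap \<open>b < a\<close>, the inner mass outgrows the outer one as the
    power increases.\<close>
  define a where "a = (cos (pi * (\<delta> / 2)))\<^sup>2"
  define b where "b = (cos (pi * \<delta>))\<^sup>2"
  have cpos: "0 < cos (pi * \<delta>)" "cos (pi * \<delta>) < cos (pi * (\<delta> / 2))"
    using \<delta> by (auto intro!: cos_gt_zero cos_monotone_0_pi)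
  have ab: "0 < b" "b < a"
    unfolding a_def b_def using cpos by (auto intro!: power_strict_mono)
  have cosmono: "cos (pi * y) \<le> cos (pi * x)" if "0 \<le> x" "x \<le> y" "y \<le> 1/2" for x y
    using that by (intro cos_monotone_0_pi_le) auto
  have keven: "k t = (cos (pi * \<bar>t\<bar>))\<^sup>2" for t
    by (cases "t \<ge> 0") (auto simp: k_def)
  \<comment> \<open>Three zones: a gain of at least \<open>d / 2 * a ^ n\<close> near 0, a
    nonnegative contribution in between, a loss of at most \<open>B * b ^ n\<close> outside.
    Subtracting the loss everywhere covers them by one formula.\<close>
  have key: "d / 2 * a ^ n * indicator {-\<delta>/2..\<delta>/2} t - B * b ^ n \<le> u t * k t ^ n"
    if t: "t \<in> {-1/2..1/2}" for t n
  proof (cases "\<bar>t\<bar> \<le> \<delta>")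
    case True
    have "dist (u t) (u 0) < d / 2"
      using d0(2)[OF t] True \<delta> by auto
    then have ut: "u t \<ge> d / 2" unfolding u0 dist_real_def by linarith
    show ?thesis
    proof (cases "t \<in> {-\<delta>/2..\<delta>/2}")
      case True
      then have "\<bar>t\<bar> \<le> \<delta> / 2" by auto
      then have "k t \<ge> a" unfolding keven a_def
        using \<delta> cosmono[of "\<bar>t\<bar>" "\<delta> / 2"] cpos by (intro power_mono) auto
      then have "k t ^ n \<ge> a ^ n" using ab by (intro power_mono) auto
      then have "d / 2 * a ^ n \<le> u t * k t ^ n"
        using ut d ab by (intro mult_mono) auto
      moreover have "B * b ^ n \<ge> 0" using B0 ab by auto
      ultimately show ?thesis using True by simp
    next
      case False
      have "u t * k t ^ n \<ge> 0" using ut d by (auto simp: k_def)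
      moreover have "B * b ^ n \<ge> 0" using B0 ab by auto
      ultimately show ?thesis using False by simp
    qed
  next
    case False
    have "0 \<le> pi * \<bar>t\<bar>" "pi * \<bar>t\<bar> \<le> pi * (1 / 2)"
      using t by (auto intro!: mult_left_mono simp: abs_le_iff)
    then have "0 \<le> cos (pi * \<bar>t\<bar>)"
      using pi_gt_zero by (intro cos_ge_zero) linarith+
    moreover have "cos (pi * \<bar>t\<bar>) \<le> cos (pi * \<delta>)"
      using False \<delta> t by (intro cosmono) (auto simp: abs_le_iff)
    ultimately have "k t \<le> b" unfolding keven b_def
      by (intro power_mono)
    then have "k t ^ n \<le> b ^ n" by (intro power_mono) (auto simp: k_def)
    moreover have "\<bar>u t\<bar> \<le> B" using B[OF t] by simp
    ultimately have "\<bar>u t\<bar> * k t ^ n \<le> B * b ^ n"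
      using B0 by (intro mult_mono) (auto simp: k_def)
    moreover have "- (\<bar>u t\<bar> * k t ^ n) \<le> u t * k t ^ n"
    proof -
      have "- \<bar>u t\<bar> * k t ^ n \<le> u t * k t ^ n"
        by (intro mult_right_mono) (auto simp: k_def)
      then show ?thesis by simp
    qed
    ultimately show ?thesis using False \<delta> by (auto simp: indicator_def)
  qed
  have fin: "finite_measure period_measure"
    unfolding period_measure_def by (rule finite_measureI) (simp add: emeasure_restrict_space space_restrict_space)
  interpret finite_measure period_measure by (rule fin)
  have meas[simp]: "{-\<delta>/2..\<delta>/2} \<in> sets period_measure"
    unfolding period_measure_def using \<delta> by (auto simp: sets_restrict_space image_iff intro!: exI[of _ "{-\<delta>/2..\<delta>/2}"])
  have ind [simp]: "integrable period_measure (indicat_real {- (\<delta> / 2)..\<delta> / 2})"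
    using meas by (intro integrable_real_indicator) (auto simp: less_top[symmetric])
  have sp: "{- (\<delta> / 2)..\<delta> / 2} \<inter> space period_measure = {- (\<delta> / 2)..\<delta> / 2}"
    using \<delta> by (auto simp: space_period_measure)
  have m1: "measure period_measure {- (\<delta> / 2)..\<delta> / 2} = \<delta>"
    unfolding period_measure_def using \<delta> by (subst measure_restrict_space) auto
  have m2: "measure period_measure (space period_measure) = 1"
    unfolding period_measure_def by (subst measure_restrict_space) (auto simp: space_restrict_space)
  have le: "d / 2 * \<delta> * a ^ n \<le> B * b ^ n" for n
  proof -
    have i1: "integrable period_measure (\<lambda>t. d / 2 * a ^ n * indicator {-\<delta>/2..\<delta>/2} t - B * b ^ n)"
      by (intro Bochner_Integration.integrable_diff integrable_mult_right) auto
    have i2: "integrable period_measure (\<lambda>t. u t * k t ^ n)"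
      unfolding k_def by (intro integrable_period_measure continuous_intros uc)
    have "(\<integral>t. d / 2 * a ^ n * indicator {-\<delta>/2..\<delta>/2} t - B * b ^ n \<partial>period_measure) \<le> (\<integral>t. u t * k t ^ n \<partial>period_measure)"
      by (rule integral_mono[OF i1 i2]) (use key in \<open>auto simp: space_period_measure\<close>)
    also have "(\<integral>t. d / 2 * a ^ n * indicator {-\<delta>/2..\<delta>/2} t - B * b ^ n \<partial>period_measure) = d / 2 * a ^ n * \<delta> - B * b ^ n"
      by (subst Bochner_Integration.integral_diff) (auto simp: m1 m2 sp)
    finally show ?thesis using uz by (simp add: mult_ac)
  qed
  have "(\<lambda>n. B * (b / a) ^ n) \<longlonglongrightarrow> B * 0"
    using ab by (intro tendsto_mult tendsto_const LIMSEQ_realpow_zero) auto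
  moreover have "d / 2 * \<delta> \<le> B * (b / a) ^ n" for n
    using le[of n] ab by (simp add: field_simps)
  ultimately have "d / 2 * \<delta> \<le> 0"
    by (intro LIMSEQ_le_const[of "\<lambda>n. B * (b / a) ^ n"]) auto
  then show False using d \<delta> by (simp add: mult_le_0_iff)
qed

text \<open>For each y exactly one translate of the half-open period contains it, the one with
  \<open>m = \<lfloor>y + 1/2\<rfloor>\<close>.\<close>

lemma has_sum_indicator_unit_partition:
  fixes G :: "real \<Rightarrow> complex"
  shows "((\<lambda>m::int. indicator {-1/2..<1/2} (y - of_int m) *\<^sub>R G y) has_sum G y) UNIV"
proof -
  define m0 where "m0 = \<lfloor>y + 1/2\<rfloor>"
  have iff: "y - of_int m \<in> {-1/2..<1/2} \<longleftrightarrow> m = m0" for m :: int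
    unfolding m0_def by (auto simp: floor_eq_iff) linarith+
  have "((\<lambda>m::int. indicator {-1/2..<1/2} (y - of_int m) *\<^sub>R G y) has_sum G y) {m0}"
    using iff[of m0] by (intro has_sum_finiteI) (auto simp: indicator_def)
  then show ?thesis
    by (rule has_sum_cong_neutral[THEN iffD1, rotated -1]) (use iff in \<open>auto simp: indicator_def\<close>)
qed

lemma cis_int_period: "cis (2 * pi * of_int j * (x + of_int m)) = cis (2 * pi * of_int j * x)"
proof -
  have "2 * pi * of_int j * (x + of_int m) = 2 * pi * of_int j * x + 2 * pi * of_int (j * m)"
    by (simp add: algebra_simps)
  then show ?thesis by (simp add: cis_mult[symmetric] cis_multiple_2pi)
qed

lemma integral_cis_period:
  "(\<integral>t. cis (2 * pi * of_int j * t) \<partial>period_measure) = (if j = 0 then 1 else 0)"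
proof (cases "j = 0")
  case True
  then show ?thesis
    by (simp add: period_measure_def measure_restrict_space space_restrict_space)
next
  case False
  have meas [measurable]: "(\<lambda>t. cis (2 * pi * of_int j * t)) \<in> borel_measurable borel"
    by (intro borel_measurable_continuous_onI continuous_intros)
  \<comment> \<open>Adding the null set {1/2} gives the closed interval on which the fundamental
    theorem of calculus is applied.\<close>
  have "(\<integral>t. cis (2 * pi * of_int j * t) \<partial>period_measure)
      = (\<integral>t. indicator {-1/2..1/2} t *\<^sub>R cis (2 * pi * of_int j * t) \<partial>lborel)"
    unfolding integral_period_measure
  proof (rule integral_cong_AE)
    have "AE t in lborel. t \<noteq> (1/2::real)" by (rule AE_lborel_singleton)
    then show "AE t in lborel. indicator {-1/2..<1/2} t *\<^sub>R cis (2 * pi * of_int j * t)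
       = indicator {-1/2..1/2} t *\<^sub>R cis (2 * pi * of_int j * t)"
      by eventually_elim (auto simp: indicator_def)
  qed (use meas in measurable)
  also have "\<dots> = cis (2 * pi * of_int j * (1/2)) / (\<i> * of_real (2 * pi * of_int j)) - cis (2 * pi * of_int j * (-1/2)) / (\<i> * of_real (2 * pi * of_int j))"
  proof (rule integral_FTC_Icc)
    show "((\<lambda>t. cis (2 * pi * of_int j * t) / (\<i> * of_real (2 * pi * of_int j))) has_vector_derivative cis (2 * pi * of_int j * x)) (at x within {-1/2..1/2})" for x
    proof -
      have "((\<lambda>z. exp (\<i> * of_real (2 * pi * of_int j) * z) / (\<i> * of_real (2 * pi * of_int j)))
          has_field_derivative exp (\<i> * of_real (2 * pi * of_int j) * of_real x)) (at (of_real x))"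
        using False by (auto intro!: derivative_eq_intros)
      from has_vector_derivative_real_field[OF this] show ?thesis
        by (simp add: cis_conv_exp mult.assoc)
    qed
  qed (auto intro!: continuous_intros)
  also have "cis (2 * pi * of_int j * (1/2)) = cis (2 * pi * of_int j * (-1/2))"
    using cis_int_period[of j "-1/2" 1] by simp
  finally show ?thesis using False by simp
qed

text \<open>The periodization of \<open>g\<close> and the Fourier series with coefficients
  \<open>ghat\<close> are both continuous and have equal Fourier coefficients. Their difference
  \<open>D\<close> then vanishes at 0 by \<open>fourier_zero_imp_zero\<close>, and its value at 0 is
  the difference of the two sides.\<close>

theorem poisson_summation:
  fixes g ghat :: "_ \<Rightarrow> complex" and bnd :: "int \<Rightarrow> real"
  assumes cont: "continuous_on UNIV g"
    and bnd: "\<And>x m. \<bar>x\<bar> \<le> 1/2 \<Longrightarrow> norm (g (x + of_int m)) \<le> bnd m" "bnd summable_on UNIV"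
    and ghat: "\<And>j::int. (\<integral>t. g t * cis (- (2 * pi * of_int j * t)) \<partial>lborel) = ghat j"
    and ghat_sum: "(\<lambda>j. norm (ghat j)) summable_on UNIV"
  shows "(\<Sum>\<^sub>\<infinity>m::int. g (of_int m)) = (\<Sum>\<^sub>\<infinity>j. ghat j)"
proof -
  let ?M = "period_measure"
  have gc: "continuous_on S (\<lambda>x. g (x + of_int m))" for S m
    by (intro continuous_on_compose2[OF cont] continuous_intros) auto
  have ms: "measure ?M (space ?M) = 1"
    by (simp add: period_measure_def measure_restrict_space space_restrict_space)
  interpret finite_measure ?M
    unfolding period_measure_def by (rule finite_measureI) (simp add: emeasure_restrict_space space_restrict_space)
  define D where "D = (\<lambda>x. (\<Sum>\<^sub>\<infinity>m::int. g (x + of_int m)) - (\<Sum>\<^sub>\<infinity>j::int. ghat j * cis (2 * pi * of_int j * x)))"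
  have c1: "continuous_on {-1/2..1/2} (\<lambda>x. \<Sum>\<^sub>\<infinity>m::int. g (x + of_int m))"
    by (rule continuous_on_int_infsum[OF gc bnd(1) bnd(2)]) auto
  have c2: "continuous_on {-1/2..1/2} (\<lambda>x. \<Sum>\<^sub>\<infinity>j::int. ghat j * cis (2 * pi * of_int j * x))"
    by (rule continuous_on_int_infsum[OF _ _ ghat_sum]) (auto intro!: continuous_intros simp: norm_mult)
  have "D 0 = 0"
  proof (rule fourier_zero_imp_zero)
    show "continuous_on {-1/2..1/2} D"
      unfolding D_def by (intro continuous_intros c1 c2)
    fix l :: int
    \<comment> \<open>The character is invariant under integer shifts, so testing the periodization
      of \<open>g\<close> against it amounts to periodizing \<open>G\<close>.\<close>
    define G where "G = (\<lambda>y. g y * cis (2 * pi * of_int l * y))"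
    have Gm: "G (x + of_int m) = g (x + of_int m) * cis (2 * pi * of_int l * x)" for x m
      unfolding G_def by (simp add: cis_int_period)
    have Gc: "continuous_on S G" for S
      unfolding G_def by (intro continuous_intros continuous_on_subset[OF cont]) auto
    have Gc': "continuous_on S (\<lambda>x. G (x + of_int m))" for S m
      by (intro continuous_on_compose2[OF Gc[of UNIV]] continuous_intros) auto
    have nG: "norm (G (x + of_int m)) \<le> bnd m" if "\<bar>x\<bar> \<le> 1/2" for x m
      unfolding Gm using bnd(1)[OF that] by (simp add: norm_mult)
    have [measurable]: "G \<in> borel_measurable borel"
      by (rule borel_measurable_continuous_onI) (rule Gc)
    have int_m: "(\<integral>x. norm (G (x + of_int m)) \<partial>?M) \<le> bnd m" for m
    proof -
      have "(\<integral>x. norm (G (x + of_int m)) \<partial>?M) \<le> (\<integral>x. bnd m \<partial>?M)"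
      proof (rule integral_mono)
        show "integrable ?M (\<lambda>x. norm (G (x + of_int m)))"
          by (intro integrable_period_measure continuous_intros Gc')
        show "norm (G (x + of_int m)) \<le> bnd m" if "x \<in> space ?M" for x
          using that by (intro nG) (auto simp: space_period_measure)
      qed auto
      also have "\<dots> = bnd m" using ms by simp
      finally show ?thesis .
    qed
    have G_int: "integrable ?M (\<lambda>x. G (x + of_int m))" for m
      by (intro integrable_period_measure Gc')
    have G_sum: "(\<lambda>m. \<integral>x. norm (G (x + of_int m)) \<partial>?M) summable_on UNIV"
      by (rule summable_on_norm_le[OF bnd(2)]) (use int_m in auto)
    have G_pt: "(\<lambda>m. norm (G (x + of_int m))) summable_on UNIV" if "x \<in> space ?M" for x
      by (rule summable_on_norm_le[OF bnd(2)]) (use nG that in \<open>auto simp: space_period_measure\<close>)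
    note first = int_infsum_integral[of ?M "\<lambda>m x. G (x + of_int m)", OF G_int G_sum G_pt]
    define E where "E = (\<lambda>m y. indicator {-1/2..<1/2} (y - of_int m :: real) *\<^sub>R G y)"
    have shift: "(\<integral>x. indicator {-1/2..<1/2} x *\<^sub>R F (x + of_int m) \<partial>lborel)
        = (\<integral>y. indicator {-1/2..<1/2} (y - of_int m) *\<^sub>R F y \<partial>lborel)"
      for m :: int and F :: "real \<Rightarrow> 'b::{banach,second_countable_topology}"
      using lborel_integral_real_affine[of 1 "\<lambda>y. indicator {-1/2..<1/2} (y - of_int m) *\<^sub>R F y" "of_int m"]
      by (simp add: add.commute)
    have shiftE: "(\<integral>x. G (x + of_int m) \<partial>?M) = (\<integral>y. E m y \<partial>lborel)" for m
      unfolding integral_period_measure E_def by (rule shift)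
    have normE: "norm (E m y) = indicator {-1/2..<1/2} (y - of_int m :: real) *\<^sub>R norm (G y)" for m y
      by (simp add: E_def)
    have shiftN: "(\<integral>x. norm (G (x + of_int m)) \<partial>?M) = (\<integral>y. norm (E m y) \<partial>lborel)" for m
      unfolding integral_period_measure normE by (rule shift)
    have Eint: "integrable lborel (E m)" for m
    proof -
      have "integrable ?M (\<lambda>x. G (x + of_int m))"
        by (intro integrable_period_measure Gc')
      then have "integrable lborel (\<lambda>x. indicator {-1/2..<1/2} x *\<^sub>R G (x + of_int m))"
        unfolding period_measure_def by (subst (asm) integrable_restrict_space) auto
      then show ?thesis
        using lborel_integrable_real_affine_iff[of 1 "E m" "of_int m"] by (simp add: E_def add.commute)
    qed
    \<comment> \<open>Unfolding: the integrals over the translated periods add up to the integral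
      over the line, which is the coefficient with index \<open>- l\<close>.\<close>
    have "(\<Sum>\<^sub>\<infinity>m::int. \<integral>y. E m y \<partial>lborel) = (\<integral>y. (\<Sum>\<^sub>\<infinity>m::int. E m y) \<partial>lborel)"
    proof (rule int_infsum_integral(2)[symmetric])
      show "integrable lborel (E m)" for m by (rule Eint)
      show "(\<lambda>m. \<integral>y. norm (E m y) \<partial>lborel) summable_on UNIV"
        by (rule summable_on_norm_le[OF bnd(2)]) (use int_m in \<open>auto simp: shiftN[symmetric]\<close>)
      fix y :: real
      have "((\<lambda>m::int. indicator {-1/2..<1/2} (y - of_int m) *\<^sub>R complex_of_real (norm (G y))) has_sum complex_of_real (norm (G y))) UNIV"
        by (rule has_sum_indicator_unit_partition)
      then have "((\<lambda>m. complex_of_real (norm (E m y))) has_sum complex_of_real (norm (G y))) UNIV"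
        unfolding normE by (simp add: scaleR_conv_of_real)
      then show "(\<lambda>m. norm (E m y)) summable_on UNIV"
        using has_sum_imp_summable has_sum_of_real_iff by blast
    qed
    also have "\<dots> = (\<integral>y. G y \<partial>lborel)"
      unfolding E_def infsumI[OF has_sum_indicator_unit_partition] ..
    also have "\<dots> = ghat (- l)"
      using ghat[of "- l"] by (simp add: G_def)
    finally have fst: "(\<integral>x. (\<Sum>\<^sub>\<infinity>m::int. G (x + of_int m)) \<partial>?M) = ghat (- l)"
      using first(2) by (simp add: shiftE)
    define C where "C = (\<lambda>j x. ghat j * cis (2 * pi * of_int (j + l) * x))"
    have Cn: "norm (C j x) = norm (ghat j)" for j x
      by (simp add: C_def norm_mult)
    have Ci: "integrable ?M (C j)" for j
      unfolding C_def by (intro integrable_period_measure continuous_intros)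
    have C_sum: "(\<lambda>j. \<integral>x. norm (C j x) \<partial>?M) summable_on UNIV"
      using ghat_sum ms by (simp add: Cn)
    have C_pt: "(\<lambda>j. norm (C j x)) summable_on UNIV" for x
      using ghat_sum by (simp add: Cn)
    note second = int_infsum_integral[of ?M C, OF Ci C_sum C_pt]
    \<comment> \<open>Orthogonality of the characters: of the Fourier series, too, only the
      coefficient with index \<open>- l\<close> survives.\<close>
    have "(\<integral>x. C j x \<partial>?M) = (if j = - l then ghat j else 0)" for j
      using integral_cis_period[of "j + l"] by (auto simp: C_def add_eq_0_iff)
    then have "(\<Sum>\<^sub>\<infinity>j. \<integral>x. C j x \<partial>?M) = (\<Sum>\<^sub>\<infinity>j\<in>{- l}. ghat j)"
      by (intro infsum_cong_neutral) auto
    then have snd: "(\<integral>x. (\<Sum>\<^sub>\<infinity>j. C j x) \<partial>?M) = ghat (- l)"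
      using second(2) by simp
    have "D x * cis (2 * pi * of_int l * x) = (\<Sum>\<^sub>\<infinity>m::int. G (x + of_int m)) - (\<Sum>\<^sub>\<infinity>j. C j x)" for x
      unfolding D_def Gm C_def left_diff_distrib infsum_cmult_left'[symmetric]
      by (simp add: cis_mult algebra_simps)
    then show "(\<integral>t. D t * cis (2 * pi * of_int l * t) \<partial>?M) = 0"
      using first(1) second(1) fst snd by simp
  qed
  then show ?thesis by (simp add: D_def)
qed

subsection \<open>Gaussian sums\<close>

lemma gauss_integrable:
  assumes "a > 0"
  shows "integrable lborel (\<lambda>t::real. exp (- a * (t - u)\<^sup>2))"
proof -
  define \<sigma> where "\<sigma> = 1 / sqrt (2 * a)"
  have \<sigma>: "\<sigma> > 0" "\<sigma>\<^sup>2 = 1 / (2 * a)" using assms by (auto simp: \<sigma>_def power_divide)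
  have "integrable lborel (\<lambda>x. normal_density u \<sigma> x * (x - u) ^ 0)"
    using integrable_normal_moment[of \<sigma> u 0] \<sigma> by simp
  then have "integrable lborel (\<lambda>x. sqrt (2 * pi * \<sigma>\<^sup>2) * (normal_density u \<sigma> x * (x - u) ^ 0))"
    by (rule integrable_mult_right)
  then show ?thesis
    using assms by (simp add: normal_density_def \<sigma> mult.commute)
qed

text \<open>Rescaling by \<open>1 / sqrt (2 * a)\<close> turns the integrand into a standard normal
  density times a character, so the value comes from the characteristic function of the normal
  distribution.\<close>

lemma gauss_fourier:
  assumes a: "a > 0"
  shows "(\<integral>t. of_real (exp (- a * (t - u)\<^sup>2)) * cis (b * t) \<partial>lborel)
       = of_real (sqrt (pi / a) * exp (- b\<^sup>2 / (4 * a))) * cis (b * u)"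
proof -
  define c where "c = 1 / sqrt (2 * a)"
  have c: "c > 0" "c\<^sup>2 = 1 / (2 * a)" using a by (auto simp: c_def power_divide)
  define F where "F = (\<lambda>t. complex_of_real (exp (- a * (t - u)\<^sup>2)) * cis (b * t))"
  have "(\<integral>t. F t \<partial>lborel) = c *\<^sub>R (\<integral>x. F (u + c * x) \<partial>lborel)"
    using lborel_integral_real_affine[of c F u] c by simp
  also have "(\<lambda>x. F (u + c * x)) = (\<lambda>x. (of_real (sqrt (2 * pi)) * cis (b * u)) * (std_normal_density x *\<^sub>R iexp ((b * c) * x)))"
  proof
    fix x
    have "a * (u + c * x - u)\<^sup>2 = x\<^sup>2 / 2"
      using a by (simp add: power_mult_distrib c)
    moreover have "cis (b * (u + c * x)) = cis (b * u) * iexp ((b * c) * x)"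
      by (simp add: cis_conv_exp exp_add[symmetric] algebra_simps)
    ultimately show "F (u + c * x) = (of_real (sqrt (2 * pi)) * cis (b * u)) * (std_normal_density x *\<^sub>R iexp ((b * c) * x))"
      by (simp add: F_def std_normal_density_def scaleR_conv_of_real)
  qed
  also have "(\<integral>x. (of_real (sqrt (2 * pi)) * cis (b * u)) * (std_normal_density x *\<^sub>R iexp ((b * c) * x)) \<partial>lborel)
     = (of_real (sqrt (2 * pi)) * cis (b * u)) * (\<integral>x. std_normal_density x *\<^sub>R iexp ((b * c) * x) \<partial>lborel)"
    by (rule integral_mult_right_zero)
  also have "(\<integral>x. std_normal_density x *\<^sub>R iexp ((b * c) * x) \<partial>lborel) = char std_normal_distribution (b * c)"
    unfolding char_def by (subst integral_density) (auto simp: mult.assoc)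
  also have "\<dots> = of_real (exp (- (b * c)\<^sup>2 / 2))"
    by (simp add: char_std_normal_distribution)
  also have "(b * c)\<^sup>2 / 2 = b\<^sup>2 / (4 * a)"
    by (simp add: power_mult_distrib c)
  then have "exp (- (b * c)\<^sup>2 / 2) = exp (- b\<^sup>2 / (4 * a))"
    by simp
  finally show ?thesis
    using a by (simp add: F_def scaleR_conv_of_real c_def real_sqrt_divide real_sqrt_mult)
qed

lemma gauss_integral:
  assumes a: "a > 0"
  shows "(\<integral>t. exp (- a * (t - u)\<^sup>2) \<partial>lborel) = sqrt (pi / a)"
proof -
  have "complex_of_real (\<integral>t. exp (- a * (t - u)\<^sup>2) \<partial>lborel) = (\<integral>t. complex_of_real (exp (- a * (t - u)\<^sup>2)) \<partial>lborel)"
    by (rule integral_of_real[OF gauss_integrable[OF a], symmetric])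
  also have "\<dots> = complex_of_real (sqrt (pi / a))"
    using gauss_fourier[OF a, of u 0] by simp
  finally show ?thesis by (simp only: of_real_eq_iff)
qed

text \<open>Keeping both a shift \<open>u\<close> and a modulation \<open>b\<close> makes the two
  sides symmetric. This one form serves the theta function, the Riemann sums in frequency and the
  bound on shifted lattice sums.\<close>

theorem gauss_poisson:
  assumes a: "a > 0"
  shows "(\<Sum>\<^sub>\<infinity>m::int. of_real (exp (- a * (of_int m - u)\<^sup>2)) * cis (b * of_int m))
     = (\<Sum>\<^sub>\<infinity>j::int. of_real (sqrt (pi / a) * exp (- (b - 2 * pi * of_int j)\<^sup>2 / (4 * a))) * cis ((b - 2 * pi * of_int j) * u))"
proof (rule poisson_summation)
  let ?g = "\<lambda>x. complex_of_real (exp (- a * (x - u)\<^sup>2)) * cis (b * x)"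
  show "continuous_on UNIV ?g"
    by (intro continuous_intros)
  show "norm (?g (x + of_int m)) \<le> exp (a * (\<bar>u\<bar> + 1/2)\<^sup>2) * exp (- (a / 2) * (of_int m)\<^sup>2)" if "\<bar>x\<bar> \<le> 1/2" for x and m :: int
  proof -
    have "norm (?g (x + of_int m)) = exp (- a * (of_int m - (u - x))\<^sup>2)"
      by (simp add: norm_mult algebra_simps)
    also have "\<dots> \<le> exp (a * (u - x)\<^sup>2) * exp (- (a / 2) * (of_int m)\<^sup>2)"
      by (rule gauss_shift_le[OF a])
    also have "(u - x)\<^sup>2 \<le> (\<bar>u\<bar> + 1/2)\<^sup>2"
      using that by (intro abs_le_square_iff[THEN iffD1]) auto
    then have "exp (a * (u - x)\<^sup>2) * exp (- (a / 2) * (of_int m)\<^sup>2) \<le> exp (a * (\<bar>u\<bar> + 1/2)\<^sup>2) * exp (- (a / 2) * (of_int m)\<^sup>2)"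
      using a by (intro mult_right_mono) auto
    finally show ?thesis .
  qed
  show "(\<lambda>m::int. exp (a * (\<bar>u\<bar> + 1/2)\<^sup>2) * exp (- (a / 2) * (of_int m)\<^sup>2)) summable_on UNIV"
    by (intro summable_on_cmult_right summable_on_gauss_int) (use a in auto)
  show "(\<integral>t. ?g t * cis (- (2 * pi * of_int j * t)) \<partial>lborel)
      = of_real (sqrt (pi / a) * exp (- (b - 2 * pi * of_int j)\<^sup>2 / (4 * a))) * cis ((b - 2 * pi * of_int j) * u)" for j :: int
  proof -
    have "cis ((b - 2 * pi * of_int j) * t) = cis (b * t) * cis (- (2 * pi * of_int j * t))" for t
      by (simp add: cis_mult algebra_simps)
    then show ?thesis
      using gauss_fourier[OF a, of u "b - 2 * pi * of_int j"] by (simp only: mult.assoc)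
  qed
  have "exp (- (b - 2 * pi * of_int j)\<^sup>2 / (4 * a)) = exp (- (pi\<^sup>2 / a) * (of_int j - b / (2 * pi))\<^sup>2)" for j :: int
    using a by (simp add: power2_eq_square field_simps)
  then show "(\<lambda>j::int. norm (complex_of_real (sqrt (pi / a) * exp (- (b - 2 * pi * of_int j)\<^sup>2 / (4 * a))) * cis ((b - 2 * pi * of_int j) * u))) summable_on UNIV"
    using a summable_on_gauss_shift[of "pi\<^sup>2 / a" "b / (2 * pi)"]
    by (simp add: norm_mult abs_mult summable_on_cmult_right)
qed

lemma gauss_poisson_summable:
  assumes a: "a > 0"
  shows "(\<lambda>j::int. exp (- (b - 2 * pi * of_int j)\<^sup>2 / (4 * a))) summable_on UNIV"
proof -
  have "exp (- (b - 2 * pi * of_int j)\<^sup>2 / (4 * a)) = exp (- (pi\<^sup>2 / a) * (of_int j - b / (2 * pi))\<^sup>2)" for j :: int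
    using a by (simp add: power2_eq_square field_simps)
  then show ?thesis
    using a summable_on_gauss_shift[of "pi\<^sup>2 / a" "b / (2 * pi)"] by simp
qed

lemma integral_gauss_half_line_le:
  assumes a: "a > 0"
  shows "integral {0..y} (\<lambda>x. exp (- a * x\<^sup>2)) \<le> sqrt (pi / a) / 2"
proof (cases "y \<ge> 0")
  case True
  let ?g = "\<lambda>x::real. exp (- a * x\<^sup>2)"
  have i: "integrable lborel ?g" using gauss_integrable[OF a, where u = 0] by (simp only: diff_zero)
  have c: "continuous_on S ?g" for S by (intro continuous_intros)
  have "set_integrable lborel {-y..y} ?g"
    unfolding set_integrable_def using borel_integrable_compact[OF compact_Icc c] by simp
  then have "(LINT x:{-y..y}|lborel. ?g x) = integral {-y..y} ?g"
    by (rule set_borel_integral_eq_integral(2))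
  moreover have "(LINT x:{-y..y}|lborel. ?g x) \<le> (\<integral>x. ?g x \<partial>lborel)"
    unfolding set_lebesgue_integral_def using i
    by (intro integral_mono borel_integrable_compact[OF compact_Icc c]) (auto simp: indicator_def)
  moreover have "integral {-y..0} ?g + integral {0..y} ?g = integral {-y..y} ?g"
    using True by (intro Henstock_Kurzweil_Integration.integral_combine integrable_continuous_real c) auto
  moreover have "integral {-y..0} ?g = integral {0..y} ?g"
    using Henstock_Kurzweil_Integration.integral_reflect_real[of y 0 "?g"] by simp
  ultimately show ?thesis using gauss_integral[OF a, of 0] by simp
next
  case False
  then show ?thesis using a by simp
qed

text \<open>The partial sums are right-endpoint Riemann sums of a decreasing function with step 1,
  hence below the integral over the half line.\<close>

lemma gauss_tail_sum:
  assumes a: "a > 0"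
  shows "summable (\<lambda>i::nat. exp (- a * (real i + 1)\<^sup>2))"
    and "(\<Sum>i::nat. exp (- a * (real i + 1)\<^sup>2)) \<le> sqrt (pi / a) / 2"
proof -
  let ?g = "\<lambda>x::real. exp (- a * x\<^sup>2)"
  have c: "continuous_on S ?g" for S by (intro continuous_intros)
  have le: "(\<Sum>i<n. ?g (real i + 1)) \<le> integral {0..real n} ?g" for n
  proof (induction n)
    case (Suc n)
    have "?g (real n + 1) = integral {real n..real (Suc n)} (\<lambda>_. ?g (real n + 1))"
      by simp
    also have "\<dots> \<le> integral {real n..real (Suc n)} ?g"
      using a by (intro integral_le integrable_continuous_real c) (auto intro!: mult_left_mono power_mono)
    moreover have "integral {0..real n} ?g + integral {real n..real (Suc n)} ?g = integral {0..real (Suc n)} ?g"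
      by (intro Henstock_Kurzweil_Integration.integral_combine integrable_continuous_real c) auto
    ultimately show ?case using Suc by simp
  qed simp
  have le': "(\<Sum>i<n. ?g (real i + 1)) \<le> sqrt (pi / a) / 2" for n
    using le[of n] integral_gauss_half_line_le[OF a, of "real n"] by linarith
  show s: "summable (\<lambda>i::nat. ?g (real i + 1))"
    by (rule summableI_nonneg_bounded[OF _ le']) simp
  show "(\<Sum>i::nat. ?g (real i + 1)) \<le> sqrt (pi / a) / 2"
    by (rule suminf_le_const[OF s le'])
qed

text \<open>By Poisson summation the sum is a Fourier series in \<open>u\<close> with positive coefficients, hence maximal
  at \<open>u = 0\<close>.\<close>

lemma gauss_shift_sum_le:
  assumes a: "a > 0"
  shows "(\<Sum>\<^sub>\<infinity>k::int. exp (- a * (of_int k - u)\<^sup>2)) \<le> 1 + sqrt (pi / a)"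
proof -
  define S where "S = (\<lambda>u. \<Sum>\<^sub>\<infinity>k::int. exp (- a * (of_int k - u)\<^sup>2))"
  define w where "w = (\<lambda>j::int. sqrt (pi / a) * exp (- (2 * pi * of_int j)\<^sup>2 / (4 * a)))"
  have cS: "complex_of_real (S u) = (\<Sum>\<^sub>\<infinity>k::int. complex_of_real (exp (- a * (of_int k - u)\<^sup>2)))" for u
    unfolding S_def using summable_on_gauss_shift[OF a, of u]
    by (intro infsumI[symmetric] has_sum_of_real) auto
  have P: "complex_of_real (S u) = (\<Sum>\<^sub>\<infinity>j. complex_of_real (w j) * cis (- 2 * pi * of_int j * u))" for u
    using gauss_poisson[OF a, of u 0] unfolding cS w_def by simp
  have ws: "w summable_on UNIV"
    unfolding w_def using gauss_poisson_summable[OF a, of 0] by (intro summable_on_cmult_right) simp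
  have "S u = norm (complex_of_real (S u))"
    unfolding norm_of_real S_def by (intro abs_of_nonneg[symmetric] infsum_nonneg) auto
  also have "\<dots> \<le> infsum w UNIV"
    unfolding P using ws a by (intro norm_infsum_le_infsum) (auto simp: norm_mult w_def abs_mult)
  also have "infsum w UNIV = S 0"
  proof -
    have "complex_of_real (S 0) = (\<Sum>\<^sub>\<infinity>j. complex_of_real (w j))"
      using P[of 0] by simp
    also have "\<dots> = complex_of_real (infsum w UNIV)"
      using ws by (intro infsumI has_sum_of_real) auto
    finally show ?thesis by simp
  qed
  also have "S 0 \<le> 1 + sqrt (pi / a)"
  proof -
    note t = gauss_tail_sum[OF a]
    let ?h = "\<lambda>i::nat. exp (- a * (real i)\<^sup>2)"
    let ?t = "\<lambda>i::nat. exp (- a * (real i + 1)\<^sup>2)"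
    have "?h (Suc i) = ?t i" for i by (simp add: add.commute)
    then have Suc: "(\<lambda>i. ?h (Suc i)) = ?t" by blast
    have sh: "summable ?h"
      using t(1) unfolding Suc[symmetric] by (rule summable_Suc_iff[THEN iffD1])
    have "suminf ?h = suminf ?t + 1"
      using suminf_split_head[OF sh] unfolding Suc by simp
    moreover have "S 0 \<le> suminf ?h + suminf ?t"
      unfolding S_def
    proof (rule int_infsum_le(2))
      show "(?h has_sum suminf ?h) UNIV"
        by (rule has_sum_suminf_nonneg[OF sh]) auto
      show "(?t has_sum suminf ?t) UNIV"
        by (rule has_sum_suminf_nonneg[OF t(1)]) auto
      show "exp (- a * (of_int (- int i - 1) - 0)\<^sup>2) \<le> ?t i" for i
        by (simp add: power2_eq_square algebra_simps)
    qed auto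
    ultimately show ?thesis using t(2) by linarith
  qed
  finally show ?thesis by (simp add: S_def)
qed

lemma summable_on_gauss_lattice:
  assumes "a > 0" "\<beta> > 0"
  shows "(\<lambda>k::int. exp (- (\<beta> * of_int k - y)\<^sup>2 / a)) summable_on UNIV"
    and "(\<Sum>\<^sub>\<infinity>k::int. exp (- (\<beta> * of_int k - y)\<^sup>2 / a)) \<le> 1 + sqrt (pi * a) / \<beta>"
proof -
  have eq: "exp (- (\<beta> * of_int k - y)\<^sup>2 / a) = exp (- (\<beta>\<^sup>2 / a) * (of_int k - y / \<beta>)\<^sup>2)" for k :: int
  proof -
    have "\<beta> * of_int k - y = \<beta> * (of_int k - y / \<beta>)" using assms by (simp add: field_simps)
    then show ?thesis by (simp add: power_mult_distrib)
  qed
  have p: "\<beta>\<^sup>2 / a > 0" using assms by simp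
  show "(\<lambda>k::int. exp (- (\<beta> * of_int k - y)\<^sup>2 / a)) summable_on UNIV"
    unfolding eq by (rule summable_on_gauss_shift[OF p])
  show "(\<Sum>\<^sub>\<infinity>k::int. exp (- (\<beta> * of_int k - y)\<^sup>2 / a)) \<le> 1 + sqrt (pi * a) / \<beta>"
    unfolding eq using gauss_shift_sum_le[OF p, of "y / \<beta>"] assms by (simp add: real_sqrt_divide)
qed

text \<open>The term \<open>m = 0\<close> on the right is the integral that the Riemann sum on the
  left approximates. The other terms are its aliases, displaced by \<open>m / \<tau>\<close>; the
  offset \<open>w\<close> of the nodes affects only their phases.\<close>

lemma gauss_riemann_poisson:
  assumes "\<sigma> > 0" "\<tau> > 0"
  shows "of_real \<tau> * (\<Sum>\<^sub>\<infinity>j::int. of_real (exp (- 2 * pi\<^sup>2 * \<sigma>\<^sup>2 * (\<tau> * of_int j + w)\<^sup>2)) * cis (2 * pi * (\<tau> * of_int j + w) * s))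
     = (\<Sum>\<^sub>\<infinity>m::int. of_real (1 / (\<sigma> * sqrt (2 * pi)) * exp (- (s - of_int m / \<tau>)\<^sup>2 / (2 * \<sigma>\<^sup>2))) * cis (2 * pi * of_int m * w / \<tau>))"
proof -
  define a where "a = 2 * pi\<^sup>2 * \<sigma>\<^sup>2 * \<tau>\<^sup>2"
  have a: "a > 0" using assms by (simp add: a_def)
  have sq: "sqrt (pi / a) = 1 / (\<sigma> * sqrt (2 * pi)) / \<tau>"
  proof (rule real_sqrt_unique)
    show "(1 / (\<sigma> * sqrt (2 * pi)) / \<tau>)\<^sup>2 = pi / a"
      using assms by (simp add: a_def power_divide power_mult_distrib power2_eq_square)
  qed (use assms in auto)
  have t1: "of_real (exp (- 2 * pi\<^sup>2 * \<sigma>\<^sup>2 * (\<tau> * of_int j + w)\<^sup>2)) * cis (2 * pi * (\<tau> * of_int j + w) * s)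
     = cis (2 * pi * w * s) * (of_real (exp (- a * (of_int j - (- w / \<tau>))\<^sup>2)) * cis (2 * pi * \<tau> * s * of_int j))" for j :: int
  proof -
    have "\<tau> * of_int j + w = \<tau> * (of_int j - (- w / \<tau>))" using assms by (simp add: field_simps)
    then have "- 2 * pi\<^sup>2 * \<sigma>\<^sup>2 * (\<tau> * of_int j + w)\<^sup>2 = - a * (of_int j - (- w / \<tau>))\<^sup>2"
      by (simp add: a_def power_mult_distrib)
    moreover have "cis (2 * pi * (\<tau> * of_int j + w) * s) = cis (2 * pi * w * s) * cis (2 * pi * \<tau> * s * of_int j)"
      by (simp add: cis_mult algebra_simps)
    ultimately show ?thesis by simp
  qed
  have t2: "cis (2 * pi * w * s) * (of_real (sqrt (pi / a) * exp (- (2 * pi * \<tau> * s - 2 * pi * of_int m)\<^sup>2 / (4 * a))) * cis ((2 * pi * \<tau> * s - 2 * pi * of_int m) * (- w / \<tau>)))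
     = of_real (1 / \<tau>) * (of_real (1 / (\<sigma> * sqrt (2 * pi)) * exp (- (s - of_int m / \<tau>)\<^sup>2 / (2 * \<sigma>\<^sup>2))) * cis (2 * pi * of_int m * w / \<tau>))" for m :: int
  proof -
    have "2 * pi * \<tau> * s - 2 * pi * of_int m = 2 * pi * \<tau> * (s - of_int m / \<tau>)"
      using assms by (simp add: field_simps)
    then have "(2 * pi * \<tau> * s - 2 * pi * of_int m)\<^sup>2 / (4 * a) = (s - of_int m / \<tau>)\<^sup>2 / (2 * \<sigma>\<^sup>2)"
      using assms by (simp add: a_def power_mult_distrib)
    moreover have "cis (2 * pi * of_int m * w / \<tau>) = cis (2 * pi * w * s) * cis ((2 * pi * \<tau> * s - 2 * pi * of_int m) * (- w / \<tau>))"
      unfolding cis_mult using assms by (intro arg_cong[where f = cis]) (simp add: field_simps)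
    ultimately show ?thesis by (simp add: sq mult_ac)
  qed
  have "of_real \<tau> * (\<Sum>\<^sub>\<infinity>j::int. of_real (exp (- 2 * pi\<^sup>2 * \<sigma>\<^sup>2 * (\<tau> * of_int j + w)\<^sup>2)) * cis (2 * pi * (\<tau> * of_int j + w) * s))
    = of_real \<tau> * (cis (2 * pi * w * s) * (\<Sum>\<^sub>\<infinity>j::int. of_real (exp (- a * (of_int j - (- w / \<tau>))\<^sup>2)) * cis (2 * pi * \<tau> * s * of_int j)))"
    unfolding t1 infsum_cmult_right' ..
  also have "\<dots> = of_real \<tau> * (\<Sum>\<^sub>\<infinity>m::int. cis (2 * pi * w * s) * (of_real (sqrt (pi / a) * exp (- (2 * pi * \<tau> * s - 2 * pi * of_int m)\<^sup>2 / (4 * a))) * cis ((2 * pi * \<tau> * s - 2 * pi * of_int m) * (- w / \<tau>))))"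
    unfolding gauss_poisson[OF a] infsum_cmult_right' ..
  also have "\<dots> = (\<Sum>\<^sub>\<infinity>m::int. of_real (1 / (\<sigma> * sqrt (2 * pi)) * exp (- (s - of_int m / \<tau>)\<^sup>2 / (2 * \<sigma>\<^sup>2))) * cis (2 * pi * of_int m * w / \<tau>))"
    unfolding t2 infsum_cmult_right' using assms by simp
  finally show ?thesis .
qed

subsection \<open>Spectrogram samples\<close>

locale gauss_shift_space =
  fixes \<sigma> \<beta> C :: real and c :: "int \<Rightarrow> complex"
  assumes sigma: "\<sigma> > 0" and beta: "\<beta> > 0" and c_le: "\<And>k. cmod (c k) \<le> C"
begin

text \<open>A bound for the sums of \<open>\<alpha> n k\<close> over k, rounded up to the form in
  which it enters \<open>D1\<close>, \<open>D2\<close> and \<open>D3\<close>.\<close>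

definition B :: real where "B = 1 + 2 * sqrt (2 * pi) * \<sigma> / \<beta>"

text \<open>What is left over when the product of the generator at \<open>\<beta> * k\<close> and
  the window at \<open>\<beta> * n / 2\<close> is written as a Gaussian around the midpoint of the
  two centres.\<close>

definition \<alpha> :: "int \<Rightarrow> int \<Rightarrow> real" where
  "\<alpha> n k = exp (- (\<beta> * of_int k - \<beta> / 2 * of_int n)\<^sup>2 / (4 * \<sigma>\<^sup>2))"

text \<open>Up to the constant in \<open>gram\<close>, the inverse Fourier transform at \<xi> of the
  term (k, l) in the expanded squared modulus.\<close>

definition pair_weight :: "int \<Rightarrow> real \<Rightarrow> int \<times> int \<Rightarrow> real" where
  "pair_weight n \<xi> = (\<lambda>(k, l). \<alpha> n k * \<alpha> n l * exp (- (\<xi> - \<beta> / 2 * (of_int k - of_int l))\<^sup>2 / (2 * \<sigma>\<^sup>2)))"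

text \<open>Up to a Gaussian and a phase factor, \<open>U n w\<close> is the short-time Fourier transform at time \<open>\<beta> n / 2\<close> and
  frequency \<open>w\<close>; \<open>gram n \<xi>\<close> is the inverse Fourier transform at \<open>\<xi>\<close> of the squared modulus of the short-time
  Fourier transform at that time.\<close>

definition gram :: "int \<Rightarrow> real \<Rightarrow> complex" where
  "gram n \<xi> = of_real (\<sigma> * sqrt (pi / 2)) * (\<Sum>\<^sub>\<infinity>(k, l). c k * cnj (c l) * of_real (pair_weight n \<xi> (k, l)))"

definition U :: "int \<Rightarrow> real \<Rightarrow> complex" where
  "U n w = (\<Sum>\<^sub>\<infinity>k. c k * of_real (\<alpha> n k) * cis (- pi * w * \<beta> * of_int k))"

lemma C_nonneg: "C \<ge> 0"
  using c_le[of 0] norm_ge_zero order_trans by blast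

lemma B_ge_1: "B \<ge> 1"
  using sigma beta by (simp add: B_def)

lemma lattice_sum:
  shows lattice_summable: "(\<lambda>k::int. exp (- (\<beta> * of_int k - y)\<^sup>2 / (4 * \<sigma>\<^sup>2))) summable_on UNIV"
    and lattice_sum_le: "(\<Sum>\<^sub>\<infinity>k::int. exp (- (\<beta> * of_int k - y)\<^sup>2 / (4 * \<sigma>\<^sup>2))) \<le> B"
proof -
  have p: "4 * \<sigma>\<^sup>2 > 0" using sigma by simp
  show "(\<lambda>k::int. exp (- (\<beta> * of_int k - y)\<^sup>2 / (4 * \<sigma>\<^sup>2))) summable_on UNIV"
    by (rule summable_on_gauss_lattice(1)[OF p beta])
  have "sqrt (pi * (4 * \<sigma>\<^sup>2)) = 2 * sqrt pi * \<sigma>"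
    using sigma by (simp add: real_sqrt_mult)
  also have "\<dots> \<le> 2 * sqrt (2 * pi) * \<sigma>"
    using sigma by (intro mult_right_mono mult_left_mono) auto
  finally have "1 + sqrt (pi * (4 * \<sigma>\<^sup>2)) / \<beta> \<le> B"
    unfolding B_def using beta by (intro add_left_mono divide_right_mono) auto
  with summable_on_gauss_lattice(2)[OF p beta, of y]
  show "(\<Sum>\<^sub>\<infinity>k::int. exp (- (\<beta> * of_int k - y)\<^sup>2 / (4 * \<sigma>\<^sup>2))) \<le> B" by linarith
qed

lemma alpha_pos: "\<alpha> n k > 0"
  by (simp add: \<alpha>_def)

lemma alpha_summable: "\<alpha> n summable_on UNIV"
  unfolding \<alpha>_def by (rule lattice_summable)

lemma alpha_sum_le: "infsum (\<alpha> n) UNIV \<le> B"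
  unfolding \<alpha>_def by (rule lattice_sum_le)

lemma pair_weight_pos: "pair_weight n \<xi> z > 0"
  by (cases z) (simp add: pair_weight_def alpha_pos)

text \<open>The parallelogram law, used twice. Now n occurs only in a Gaussian of
  \<open>k + l - n\<close>, with the exponent that belongs to the theta function in
  \<open>Lambda\<close>; this makes a sum over n a lattice convolution.\<close>

lemma pair_weight_eq:
  "pair_weight n \<xi> (k, l) = exp (- \<xi>\<^sup>2 / (4 * \<sigma>\<^sup>2)) * exp (- (\<beta> * (of_int k - of_int l) - \<xi>)\<^sup>2 / (4 * \<sigma>\<^sup>2))
     * exp (- \<beta>\<^sup>2 / (8 * \<sigma>\<^sup>2) * (of_int (k + l - n))\<^sup>2)"
proof -
  have "- (\<beta> * of_int k - \<beta> / 2 * of_int n)\<^sup>2 / (4 * \<sigma>\<^sup>2) + - (\<beta> * of_int l - \<beta> / 2 * of_int n)\<^sup>2 / (4 * \<sigma>\<^sup>2)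
        + - (\<xi> - \<beta> / 2 * (of_int k - of_int l))\<^sup>2 / (2 * \<sigma>\<^sup>2)
    = - \<xi>\<^sup>2 / (4 * \<sigma>\<^sup>2) + - (\<beta> * (of_int k - of_int l) - \<xi>)\<^sup>2 / (4 * \<sigma>\<^sup>2)
      + - \<beta>\<^sup>2 / (8 * \<sigma>\<^sup>2) * (of_int (k + l - n))\<^sup>2"
    using sigma by (simp add: field_simps power2_eq_square)
  then show ?thesis
    unfolding pair_weight_def \<alpha>_def by (simp add: exp_add[symmetric])
qed

text \<open>Weakening the exponent of \<open>pair_weight_eq\<close> decouples k from l, so that the
  pair sum factors into two lattice sums, while the full Gaussian factor in \<xi> survives. Its
  decay is what makes the aliases small.\<close>

lemma pair_weight_le:
  "pair_weight n \<xi> (k, l) \<le> exp (- \<xi>\<^sup>2 / (4 * \<sigma>\<^sup>2)) *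
     (exp (- (\<beta> * of_int k - (\<beta> / 2 * of_int n + \<xi> / 2))\<^sup>2 / (4 * \<sigma>\<^sup>2)) * exp (- (\<beta> * of_int l - (\<beta> / 2 * of_int n - \<xi> / 2))\<^sup>2 / (4 * \<sigma>\<^sup>2)))"
proof -
  define p where "p = \<beta> * of_int k - (\<beta> / 2 * of_int n + \<xi> / 2)"
  define q where "q = \<beta> * of_int l - (\<beta> / 2 * of_int n - \<xi> / 2)"
  have 1: "\<beta> * (of_int k - of_int l) - \<xi> = p - q"
    by (simp add: p_def q_def algebra_simps)
  have 2: "\<beta> * of_int (k + l - n) = p + q"
    by (simp add: p_def q_def algebra_simps)
  \<comment> \<open>The difference of the two sides is (p - q)^2 / 2.\<close>
  have "p\<^sup>2 + q\<^sup>2 \<le> (p - q)\<^sup>2 + (p + q)\<^sup>2 / 2"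
  proof -
    have "0 \<le> (p - q)\<^sup>2" by simp
    then show ?thesis by (simp add: power2_eq_square algebra_simps)
  qed
  then have "(p\<^sup>2 + q\<^sup>2) / (4 * \<sigma>\<^sup>2) \<le> ((p - q)\<^sup>2 + (p + q)\<^sup>2 / 2) / (4 * \<sigma>\<^sup>2)"
    by (rule divide_right_mono) simp
  moreover have "- \<beta>\<^sup>2 / (8 * \<sigma>\<^sup>2) * (of_int (k + l - n))\<^sup>2 = - ((p + q)\<^sup>2 / 2 / (4 * \<sigma>\<^sup>2))"
    unfolding 2[symmetric] by (simp add: power_mult_distrib)
  ultimately have "- (p - q)\<^sup>2 / (4 * \<sigma>\<^sup>2) + - \<beta>\<^sup>2 / (8 * \<sigma>\<^sup>2) * (of_int (k + l - n))\<^sup>2 \<le> - p\<^sup>2 / (4 * \<sigma>\<^sup>2) + - q\<^sup>2 / (4 * \<sigma>\<^sup>2)"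
    unfolding add_divide_distrib by linarith
  then show ?thesis
    unfolding pair_weight_eq 1 p_def[symmetric] q_def[symmetric] mult.assoc
    by (intro mult_left_mono) (simp_all add: exp_add[symmetric])
qed

lemma pair_weight_sum:
  shows pair_weight_summable: "pair_weight n \<xi> summable_on UNIV"
    and pair_weight_sum_le: "infsum (pair_weight n \<xi>) UNIV \<le> exp (- \<xi>\<^sup>2 / (4 * \<sigma>\<^sup>2)) * B\<^sup>2"
proof -
  define F where "F = (\<lambda>k::int. exp (- (\<beta> * of_int k - (\<beta> / 2 * of_int n + \<xi> / 2))\<^sup>2 / (4 * \<sigma>\<^sup>2)))"
  define G where "G = (\<lambda>l::int. exp (- (\<beta> * of_int l - (\<beta> / 2 * of_int n - \<xi> / 2))\<^sup>2 / (4 * \<sigma>\<^sup>2)))"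
  have s: "F summable_on UNIV" "G summable_on UNIV"
    unfolding F_def G_def by (rule lattice_summable)+
  have i: "infsum F UNIV \<le> B" "infsum G UNIV \<le> B"
    unfolding F_def G_def by (rule lattice_sum_le)+
  have nn: "infsum G UNIV \<ge> 0" unfolding G_def by (rule infsum_nonneg) auto
  have "((\<lambda>(k, l). F k * G l) has_sum (infsum F UNIV * infsum G UNIV)) UNIV"
    by (rule has_sum_times[OF s(1) _ s(2)]) (auto simp: F_def G_def)
  from has_sum_cmult_right[OF this, of "exp (- \<xi>\<^sup>2 / (4 * \<sigma>\<^sup>2))"]
  have hs: "((\<lambda>z. exp (- \<xi>\<^sup>2 / (4 * \<sigma>\<^sup>2)) * (case z of (k, l) \<Rightarrow> F k * G l)) has_sum (exp (- \<xi>\<^sup>2 / (4 * \<sigma>\<^sup>2)) * (infsum F UNIV * infsum G UNIV))) UNIV" .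
  have le: "pair_weight n \<xi> z \<le> exp (- \<xi>\<^sup>2 / (4 * \<sigma>\<^sup>2)) * (case z of (k, l) \<Rightarrow> F k * G l)" for z
    using pair_weight_le by (cases z) (auto simp: F_def G_def)
  show sm: "pair_weight n \<xi> summable_on UNIV"
    by (rule summable_on_norm_le[OF has_sum_imp_summable[OF hs]]) (use le pair_weight_pos in \<open>auto simp: abs_of_pos\<close>)
  have "infsum (pair_weight n \<xi>) UNIV \<le> exp (- \<xi>\<^sup>2 / (4 * \<sigma>\<^sup>2)) * (infsum F UNIV * infsum G UNIV)"
    using has_sum_mono[OF has_sum_infsum[OF sm] hs] le by simp
  also have "\<dots> \<le> exp (- \<xi>\<^sup>2 / (4 * \<sigma>\<^sup>2)) * (B * B)"
    using i nn B_ge_1 by (intro mult_left_mono mult_mono) auto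
  finally show "infsum (pair_weight n \<xi>) UNIV \<le> exp (- \<xi>\<^sup>2 / (4 * \<sigma>\<^sup>2)) * B\<^sup>2"
    by (simp add: power2_eq_square)
qed

lemma cc_le: "cmod (c k * cnj (c l)) \<le> C\<^sup>2"
  using mult_mono[OF c_le[of k] c_le[of l] C_nonneg] by (simp add: norm_mult power2_eq_square)

lemma norm_gram_le:
  "cmod (gram n \<xi>) \<le> C\<^sup>2 * (\<sigma> * sqrt (pi / 2)) * B\<^sup>2 * exp (- \<xi>\<^sup>2 / (4 * \<sigma>\<^sup>2))"
proof -
  have "cmod (\<Sum>\<^sub>\<infinity>(k, l). c k * cnj (c l) * of_real (pair_weight n \<xi> (k, l))) \<le> (\<Sum>\<^sub>\<infinity>z. C\<^sup>2 * pair_weight n \<xi> z)"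
  proof (rule norm_infsum_le_infsum)
    show "(\<lambda>z. C\<^sup>2 * pair_weight n \<xi> z) summable_on UNIV"
      by (intro summable_on_cmult_right pair_weight_summable)
    show "cmod (case z of (k, l) \<Rightarrow> c k * cnj (c l) * of_real (pair_weight n \<xi> (k, l))) \<le> C\<^sup>2 * pair_weight n \<xi> z" for z
      using cc_le pair_weight_pos[of n \<xi> z] by (cases z) (auto simp: norm_mult abs_of_pos intro!: mult_right_mono)
  qed
  also have "\<dots> = C\<^sup>2 * infsum (pair_weight n \<xi>) UNIV"
    by (rule infsum_cmult_right) (use pair_weight_summable in auto)
  also have "\<dots> \<le> C\<^sup>2 * (exp (- \<xi>\<^sup>2 / (4 * \<sigma>\<^sup>2)) * B\<^sup>2)"
    by (intro mult_left_mono pair_weight_sum_le) auto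
  finally have "(\<sigma> * sqrt (pi / 2)) * cmod (\<Sum>\<^sub>\<infinity>(k, l). c k * cnj (c l) * of_real (pair_weight n \<xi> (k, l)))
      \<le> (\<sigma> * sqrt (pi / 2)) * (C\<^sup>2 * (exp (- \<xi>\<^sup>2 / (4 * \<sigma>\<^sup>2)) * B\<^sup>2))"
    using sigma by (intro mult_left_mono) auto
  then show ?thesis
    unfolding gram_def norm_mult norm_of_real using sigma by (simp add: abs_mult mult_ac)
qed

lemma U_term_le: "cmod (c k * of_real (\<alpha> n k) * cis x) \<le> C * \<alpha> n k"
  using c_le[of k] alpha_pos[of n k] by (simp add: norm_mult abs_of_pos)

lemma norm_U_le: "cmod (U n w) \<le> C * B"
proof -
  have "cmod (U n w) \<le> (\<Sum>\<^sub>\<infinity>k. C * \<alpha> n k)"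
    unfolding U_def
    by (rule norm_infsum_le_infsum) (use U_term_le in \<open>auto intro!: summable_on_cmult_right alpha_summable\<close>)
  also have "\<dots> = C * infsum (\<alpha> n) UNIV"
    by (rule infsum_cmult_right) (use alpha_summable in auto)
  also have "\<dots> \<le> C * B"
    by (intro mult_left_mono alpha_sum_le C_nonneg)
  finally show ?thesis .
qed

lemma norm_U_sq:
  "complex_of_real ((cmod (U n w))\<^sup>2)
   = (\<Sum>\<^sub>\<infinity>(k, l). c k * cnj (c l) * of_real (\<alpha> n k * \<alpha> n l) * cis (- pi * w * \<beta> * (of_int k - of_int l)))"
proof -
  define F where "F = (\<lambda>k. c k * of_real (\<alpha> n k) * cis (- pi * w * \<beta> * of_int k))"
  have s: "(\<lambda>k. C * \<alpha> n k) summable_on UNIV"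
    by (intro summable_on_cmult_right alpha_summable)
  have F: "cmod (F k) \<le> C * \<alpha> n k" "cmod (cnj (F k)) \<le> C * \<alpha> n k" for k
    using U_term_le by (simp_all only: F_def complex_mod_cnj)
  have "complex_of_real ((cmod (U n w))\<^sup>2) = infsum F UNIV * infsum (\<lambda>l. cnj (F l)) UNIV"
    unfolding complex_norm_square U_def F_def infsum_cnj ..
  also have "\<dots> = (\<Sum>\<^sub>\<infinity>(k, l). F k * cnj (F l))"
    by (rule infsumI[symmetric], rule has_sum_times[OF s F(1) s F(2)])
  also have "\<dots> = (\<Sum>\<^sub>\<infinity>(k, l). c k * cnj (c l) * of_real (\<alpha> n k * \<alpha> n l) * cis (- pi * w * \<beta> * (of_int k - of_int l)))"
  proof (rule infsum_cong, clarify)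
    fix k l :: int
    have "cis (- pi * w * \<beta> * (of_int k - of_int l)) = cis (- pi * w * \<beta> * of_int k) * cis (- (- pi * w * \<beta> * of_int l))"
      by (simp add: cis_mult algebra_simps)
    then show "F k * cnj (F l) = c k * cnj (c l) * of_real (\<alpha> n k * \<alpha> n l) * cis (- pi * w * \<beta> * (of_int k - of_int l))"
      by (simp add: F_def cis_cnj)
  qed
  finally show ?thesis .
qed

section \<open>The signal and the modulus of its transform\<close>

definition f :: "real \<Rightarrow> complex" where "f = shift_series \<beta> (gaussian \<sigma>) c"

lemma f_eq: "f t = (\<Sum>\<^sub>\<infinity>k. c k * of_real (exp (- (\<beta> * of_int k - t)\<^sup>2 / (2 * \<sigma>\<^sup>2))))"
  unfolding f_def shift_series_def translate_def gaussian_def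
  by (simp add: power2_commute)

lemma f_term_summable: "(\<lambda>k::int. C * exp (- (\<beta> * of_int k - t)\<^sup>2 / (2 * \<sigma>\<^sup>2))) summable_on UNIV"
  using sigma beta by (intro summable_on_cmult_right summable_on_gauss_lattice) auto

lemma f_term_le: "cmod (c k * of_real (exp x)) \<le> C * exp x"
  using c_le by (simp add: norm_mult mult_right_mono)

lemma norm_f_le: "cmod (f t) \<le> C * (1 + sqrt (pi * (2 * \<sigma>\<^sup>2)) / \<beta>)"
proof -
  have "cmod (f t) \<le> (\<Sum>\<^sub>\<infinity>k::int. C * exp (- (\<beta> * of_int k - t)\<^sup>2 / (2 * \<sigma>\<^sup>2)))"
    unfolding f_eq by (rule norm_infsum_le_infsum[OF f_term_summable f_term_le])
  also have "\<dots> = C * (\<Sum>\<^sub>\<infinity>k::int. exp (- (\<beta> * of_int k - t)\<^sup>2 / (2 * \<sigma>\<^sup>2)))"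
    using sigma beta by (intro infsum_cmult_right summable_on_gauss_lattice) auto
  also have "\<dots> \<le> C * (1 + sqrt (pi * (2 * \<sigma>\<^sup>2)) / \<beta>)"
    using sigma beta C_nonneg by (intro mult_left_mono summable_on_gauss_lattice) auto
  finally show ?thesis .
qed

lemma continuous_on_f: "continuous_on S f"
proof -
  \<comment> \<open>The majorant depends on a bound for t, so continuity is shown on bounded open
    intervals, from which continuity at each point follows.\<close>
  have "continuous_on {-T<..<T} f" for T
    unfolding f_eq[abs_def]
  proof (rule continuous_on_int_infsum)
    define a where "a = 1 / (2 * \<sigma>\<^sup>2)"
    have a: "a > 0" using sigma by (simp add: a_def)
    show "continuous_on {-T<..<T} (\<lambda>t. c k * of_real (exp (- (\<beta> * of_int k - t)\<^sup>2 / (2 * \<sigma>\<^sup>2))))" for k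
      using sigma by (intro continuous_intros) auto
    show "cmod (c k * of_real (exp (- (\<beta> * of_int k - t)\<^sup>2 / (2 * \<sigma>\<^sup>2)))) \<le> C * (exp (a * T\<^sup>2) * exp (- (a / 2 * \<beta>\<^sup>2) * (of_int k)\<^sup>2))"
      if t: "t \<in> {-T<..<T}" for k t
    proof -
      have "t\<^sup>2 \<le> T\<^sup>2" using t by (intro abs_le_square_iff[THEN iffD1]) auto
      have "exp (- (\<beta> * of_int k - t)\<^sup>2 / (2 * \<sigma>\<^sup>2)) = exp (- a * (\<beta> * of_int k - t)\<^sup>2)"
        by (simp add: a_def)
      also have "\<dots> \<le> exp (a * t\<^sup>2) * exp (- (a / 2) * (\<beta> * of_int k)\<^sup>2)"
        by (rule gauss_shift_le[OF a])
      also have "\<dots> \<le> exp (a * T\<^sup>2) * exp (- (a / 2) * (\<beta> * of_int k)\<^sup>2)"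
        using a \<open>t\<^sup>2 \<le> T\<^sup>2\<close> by (intro mult_right_mono) auto
      finally have "C * exp (- (\<beta> * of_int k - t)\<^sup>2 / (2 * \<sigma>\<^sup>2)) \<le> C * (exp (a * T\<^sup>2) * exp (- (a / 2 * \<beta>\<^sup>2) * (of_int k)\<^sup>2))"
        using C_nonneg by (intro mult_left_mono) (auto simp: power_mult_distrib mult.assoc)
      with f_term_le show ?thesis by (rule order_trans)
    qed
    show "(\<lambda>k::int. C * (exp (a * T\<^sup>2) * exp (- (a / 2 * \<beta>\<^sup>2) * (of_int k)\<^sup>2))) summable_on UNIV"
      using a beta by (intro summable_on_cmult_right summable_on_gauss_int) auto
  qed
  then have loc: "isCont f t" if "t \<in> {-T<..<T}" for t T
    using that continuous_on_eq_continuous_at[OF open_greaterThanLessThan] by blast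
  have "isCont f t" for t
    by (rule loc[of t "\<bar>t\<bar> + 1"]) auto
  then show ?thesis by (simp add: continuous_at_imp_continuous_on)
qed

text \<open>The chirp in the window cancels the quadratic phase of the kernel in t. What remains is
  a linear phase of frequency \<open>w\<close>, an affine function of \<eta>: steps of length h in
  \<eta> become steps of length h / b in \<open>w\<close>.\<close>

lemma norm_stlct_sq:
  assumes b: "A $ 1 $ 2 > 0"
    and w_def: "w = (\<eta> - A $ 1 $ 1 * (\<beta> / 2 * of_int n)) / (A $ 1 $ 2)"
  shows "(cmod (stlct A (chirped_gaussian A \<sigma>) f (\<beta> * of_int n / 2) \<eta>))\<^sup>2
    = 1 / (A $ 1 $ 2) * (\<sigma>\<^sup>2 * pi * exp (- 2 * pi\<^sup>2 * \<sigma>\<^sup>2 * w\<^sup>2) * (cmod (U n w))\<^sup>2)"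
proof -
  let ?a = "A $ 1 $ 1" and ?b = "A $ 1 $ 2" and ?d = "A $ 2 $ 2"
  define x where "x = \<beta> / 2 * of_int n"
  \<comment> \<open>Everything independent of t and k: a phase and the normalization of the kernel,
    of squared modulus 1 / b.\<close>
  define \<kappa> where "\<kappa> = cis (- (pi * ?a / ?b) * x\<^sup>2 + pi / ?b * ?d * \<eta>\<^sup>2) / csqrt (\<i> * of_real ?b)"
  define E where "E = (\<lambda>k t. c k * of_real (\<alpha> n k) * (of_real (exp (- (1 / \<sigma>\<^sup>2) * (t - (\<beta> * of_int k + x) / 2)\<^sup>2)) * cis (- 2 * pi * w * t)))"
  have s2: "1 / \<sigma>\<^sup>2 > 0" using sigma by simp
  have x': "\<beta> * of_int n / 2 = x" by (simp add: x_def)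
  have w_x: "w = (\<eta> - ?a * x) / ?b" by (simp add: w_def x_def)
  have phase: "cnj (cis (pi * (?a / ?b) * (t - x)\<^sup>2)) * cis (pi / ?b * (?a * t\<^sup>2 - 2 * \<eta> * t + ?d * \<eta>\<^sup>2))
    = cis (- (pi * ?a / ?b) * x\<^sup>2 + pi / ?b * ?d * \<eta>\<^sup>2) * cis (- 2 * pi * w * t)" for t
    unfolding cis_cnj cis_mult
    by (intro arg_cong[where f = cis]) (use b in \<open>simp add: w_x field_simps power2_eq_square\<close>)
  have gprod: "exp (- (\<beta> * of_int k - t)\<^sup>2 / (2 * \<sigma>\<^sup>2)) * exp (- (t - x)\<^sup>2 / (2 * \<sigma>\<^sup>2))
     = \<alpha> n k * exp (- (1 / \<sigma>\<^sup>2) * (t - (\<beta> * of_int k + x) / 2)\<^sup>2)" for k t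
    unfolding \<alpha>_def x_def[symmetric] exp_add[symmetric]
    by (intro arg_cong[where f = exp]) (use sigma in \<open>simp add: field_simps power2_eq_square\<close>)
  have integrand: "f t * cnj (chirped_gaussian A \<sigma> (t - x)) * lct_kernel A \<eta> t = \<kappa> * (\<Sum>\<^sub>\<infinity>k. E k t)" for t
  proof -
    have "E k t = c k * of_real (exp (- (\<beta> * of_int k - t)\<^sup>2 / (2 * \<sigma>\<^sup>2))) * (of_real (exp (- (t - x)\<^sup>2 / (2 * \<sigma>\<^sup>2))) * cis (- 2 * pi * w * t))" for k
      using gprod[of k t, symmetric] by (simp add: E_def flip: of_real_mult)
    then have "(\<Sum>\<^sub>\<infinity>k. E k t) = f t * (of_real (exp (- (t - x)\<^sup>2 / (2 * \<sigma>\<^sup>2))) * cis (- 2 * pi * w * t))"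
      unfolding f_eq by (simp only: infsum_cmult_left')
    moreover have "cnj (chirped_gaussian A \<sigma> (t - x)) * lct_kernel A \<eta> t = \<kappa> * (of_real (exp (- (t - x)\<^sup>2 / (2 * \<sigma>\<^sup>2))) * cis (- 2 * pi * w * t))"
      using phase[of t] by (simp add: chirped_gaussian_def lct_kernel_def \<kappa>_def gaussian_def)
    ultimately show ?thesis by simp
  qed
  have nE: "cmod (E k t) = cmod (c k) * \<alpha> n k * exp (- (1 / \<sigma>\<^sup>2) * (t - (\<beta> * of_int k + x) / 2)\<^sup>2)" for k t
    using alpha_pos[of n k] by (simp add: E_def norm_mult abs_of_pos)
  have Cs: "(\<lambda>k. C * \<alpha> n k) summable_on UNIV"
    by (intro summable_on_cmult_right alpha_summable)
  have cal: "cmod (c k) * \<alpha> n k \<le> C * \<alpha> n k" for k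
    using c_le[of k] alpha_pos[of n k] by (intro mult_right_mono) auto
  have Ei: "integrable lborel (E k)" for k
  proof (rule Bochner_Integration.integrable_bound)
    show "integrable lborel (\<lambda>t. cmod (c k) * \<alpha> n k * exp (- (1 / \<sigma>\<^sup>2) * (t - (\<beta> * of_int k + x) / 2)\<^sup>2))"
      by (intro integrable_mult_right gauss_integrable[OF s2])
    have "continuous_on UNIV (E k)" unfolding E_def by (intro continuous_intros)
    then show "E k \<in> borel_measurable lborel" using borel_measurable_continuous_onI by simp
  qed (use alpha_pos[of n k] in \<open>simp add: nE\<close>)
  have "(\<integral>t. f t * cnj (chirped_gaussian A \<sigma> (t - x)) * lct_kernel A \<eta> t \<partial>lborel) = \<kappa> * (\<integral>t. (\<Sum>\<^sub>\<infinity>k. E k t) \<partial>lborel)"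
    unfolding integrand by (rule integral_mult_right_zero)
  also have "(\<integral>t. (\<Sum>\<^sub>\<infinity>k. E k t) \<partial>lborel) = (\<Sum>\<^sub>\<infinity>k. \<integral>t. E k t \<partial>lborel)"
  proof (rule int_infsum_integral(2)[OF Ei])
    have "(\<integral>t. cmod (E k t) \<partial>lborel) = cmod (c k) * \<alpha> n k * sqrt (pi / (1 / \<sigma>\<^sup>2))" for k
      unfolding nE integral_mult_right_zero gauss_integral[OF s2] ..
    then show "(\<lambda>k. \<integral>t. cmod (E k t) \<partial>lborel) summable_on UNIV"
      by (intro summable_on_norm_le[OF summable_on_cmult_left[OF Cs, of "sqrt (pi / (1 / \<sigma>\<^sup>2))"]])
        (use cal alpha_pos in \<open>auto simp: abs_mult abs_of_pos intro!: mult_right_mono\<close>)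
    show "(\<lambda>k. cmod (E k t)) summable_on UNIV" for t
    proof (rule summable_on_norm_le[OF Cs])
      fix k
      have "cmod (c k) * \<alpha> n k * exp (- (1 / \<sigma>\<^sup>2) * (t - (\<beta> * of_int k + x) / 2)\<^sup>2) \<le> C * \<alpha> n k * 1"
        using cal[of k] C_nonneg alpha_pos[of n k] by (intro mult_mono) auto
      then have "cmod (E k t) \<le> C * \<alpha> n k" by (simp add: nE)
      then show "norm (cmod (E k t)) \<le> C * \<alpha> n k" by simp
    qed
  qed
  also have "(\<lambda>k. \<integral>t. E k t \<partial>lborel) = (\<lambda>k. c k * of_real (\<alpha> n k) * cis (- pi * w * \<beta> * of_int k) * (of_real (\<sigma> * sqrt pi * exp (- pi\<^sup>2 * \<sigma>\<^sup>2 * w\<^sup>2)) * cis (- pi * w * x)))"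
  proof
    fix k
    have "sqrt (pi / (1 / \<sigma>\<^sup>2)) = \<sigma> * sqrt pi" using sigma by (simp add: real_sqrt_mult)
    moreover have "- (- 2 * pi * w)\<^sup>2 / (4 * (1 / \<sigma>\<^sup>2)) = - pi\<^sup>2 * \<sigma>\<^sup>2 * w\<^sup>2"
      using sigma by (simp add: field_simps power2_eq_square)
    moreover have "cis (- 2 * pi * w * ((\<beta> * of_int k + x) / 2)) = cis (- pi * w * \<beta> * of_int k) * cis (- pi * w * x)"
      unfolding cis_mult by (intro arg_cong[where f = cis]) (simp add: field_simps)
    ultimately have "(\<integral>t. of_real (exp (- (1 / \<sigma>\<^sup>2) * (t - (\<beta> * of_int k + x) / 2)\<^sup>2)) * cis (- 2 * pi * w * t) \<partial>lborel)
      = of_real (\<sigma> * sqrt pi * exp (- pi\<^sup>2 * \<sigma>\<^sup>2 * w\<^sup>2)) * (cis (- pi * w * \<beta> * of_int k) * cis (- pi * w * x))"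
      using gauss_fourier[OF s2, of "(\<beta> * of_int k + x) / 2" "- 2 * pi * w"] by (simp only:)
    then show "(\<integral>t. E k t \<partial>lborel) = c k * of_real (\<alpha> n k) * cis (- pi * w * \<beta> * of_int k) * (of_real (\<sigma> * sqrt pi * exp (- pi\<^sup>2 * \<sigma>\<^sup>2 * w\<^sup>2)) * cis (- pi * w * x))"
      unfolding E_def integral_mult_right_zero by (simp only: mult_ac)
  qed
  also have "(\<Sum>\<^sub>\<infinity>k. c k * of_real (\<alpha> n k) * cis (- pi * w * \<beta> * of_int k) * (of_real (\<sigma> * sqrt pi * exp (- pi\<^sup>2 * \<sigma>\<^sup>2 * w\<^sup>2)) * cis (- pi * w * x)))
     = U n w * (of_real (\<sigma> * sqrt pi * exp (- pi\<^sup>2 * \<sigma>\<^sup>2 * w\<^sup>2)) * cis (- pi * w * x))"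
    unfolding U_def infsum_cmult_left' ..
  finally have "cmod (stlct A (chirped_gaussian A \<sigma>) f (\<beta> * of_int n / 2) \<eta>)
     = cmod \<kappa> * (cmod (U n w) * (\<sigma> * sqrt pi * exp (- pi\<^sup>2 * \<sigma>\<^sup>2 * w\<^sup>2)))"
    unfolding stlct_def x' using sigma by (simp add: norm_mult)
  moreover have "(cmod \<kappa>)\<^sup>2 = 1 / ?b"
    using b by (simp add: \<kappa>_def norm_divide power_divide norm_mult)
  moreover have "(exp (- pi\<^sup>2 * \<sigma>\<^sup>2 * w\<^sup>2))\<^sup>2 = exp (- 2 * pi\<^sup>2 * \<sigma>\<^sup>2 * w\<^sup>2)"
    by (simp add: exp_double[symmetric])
  ultimately show ?thesis
    by (simp add: power_mult_distrib mult_ac)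
qed

text \<open>For \<open>\<tau>\<close> = h / b and \<open>w\<close> = - a \<beta> n / (2 b) this is h
  times the squared modulus of the transform at (\<beta> n / 2, h j), times the combined phase
  factor that the algorithm applies to that sample.\<close>

definition riemann_term :: "real \<Rightarrow> real \<Rightarrow> int \<Rightarrow> real \<Rightarrow> int \<Rightarrow> complex" where
  "riemann_term \<tau> w n \<xi> j = of_real (\<tau> * (\<sigma>\<^sup>2 * pi * exp (- 2 * pi\<^sup>2 * \<sigma>\<^sup>2 * (\<tau> * of_int j + w)\<^sup>2) * (cmod (U n (\<tau> * of_int j + w)))\<^sup>2))
     * cis (2 * pi * (\<tau> * of_int j + w) * \<xi>)"

lemma summable_on_gauss_grid:
  assumes "\<tau> > 0"
  shows "(\<lambda>j::int. exp (- 2 * pi\<^sup>2 * \<sigma>\<^sup>2 * (\<tau> * of_int j + w)\<^sup>2)) summable_on UNIV"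
proof -
  have "1 / (2 * pi\<^sup>2 * \<sigma>\<^sup>2) > 0" using sigma by simp
  from summable_on_gauss_lattice(1)[OF this assms, of "- w"] show ?thesis
    by (simp add: mult_ac)
qed

lemma norm_riemann_term_le:
  assumes "\<tau> > 0"
  shows "cmod (riemann_term \<tau> w n \<xi> j) \<le> \<tau> * (\<sigma>\<^sup>2 * pi * (C * B)\<^sup>2) * exp (- 2 * pi\<^sup>2 * \<sigma>\<^sup>2 * (\<tau> * of_int j + w)\<^sup>2)"
proof -
  let ?e = "exp (- 2 * pi\<^sup>2 * \<sigma>\<^sup>2 * (\<tau> * of_int j + w)\<^sup>2)"
  have "cmod (riemann_term \<tau> w n \<xi> j) = \<tau> * (\<sigma>\<^sup>2 * pi * ?e * (cmod (U n (\<tau> * of_int j + w)))\<^sup>2)"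
    unfolding riemann_term_def norm_mult norm_of_real using assms by simp
  also have "\<dots> \<le> \<tau> * (\<sigma>\<^sup>2 * pi * ?e * (C * B)\<^sup>2)"
    using assms by (intro mult_left_mono power_mono norm_U_le) auto
  finally show ?thesis by (simp add: mult_ac)
qed

lemma riemann_term_summable:
  assumes "\<tau> > 0"
  shows "riemann_term \<tau> w n \<xi> summable_on UNIV"
  by (rule summable_on_norm_le[OF summable_on_cmult_right[OF summable_on_gauss_grid[OF assms]] norm_riemann_term_le[OF assms]])

lemma gauss_constant_eq: "\<sigma>\<^sup>2 * pi * (1 / (\<sigma> * sqrt (2 * pi))) = \<sigma> * sqrt (pi / 2)"
proof -
  have "sqrt (pi / 2) * sqrt (2 * pi) = pi"
    by (simp add: real_sqrt_mult[symmetric] power2_eq_square[symmetric])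
  then show ?thesis using sigma by (simp add: field_simps power2_eq_square)
qed

text \<open>Poisson summation of the sampled spectrogram: replacing the integral by a Riemann sum of
  step \<open>\<tau>\<close> adds the aliases of \<open>gram n\<close> at distance \<open>m / \<tau>\<close>.\<close>

lemma riemann_sum_eq:
  assumes tau: "\<tau> > 0"
  shows "(\<Sum>\<^sub>\<infinity>j. riemann_term \<tau> w n \<xi> j) = (\<Sum>\<^sub>\<infinity>m::int. cis (2 * pi * of_int m * w / \<tau>) * gram n (\<xi> - of_int m / \<tau>))"
    and "(\<lambda>m::int. cis (2 * pi * of_int m * w / \<tau>) * gram n (\<xi> - of_int m / \<tau>)) summable_on UNIV"
proof -
  define cc where "cc = (\<lambda>(k, l). c k * cnj (c l) * of_real (\<alpha> n k * \<alpha> n l))"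
  define AA where "AA = (\<lambda>(k, l). C\<^sup>2 * (\<alpha> n k * \<alpha> n l))"
  define sh where "sh = (\<lambda>(k, l). \<xi> - \<beta> / 2 * (of_int k - of_int l))"
  define e where "e = (\<lambda>j::int. exp (- 2 * pi\<^sup>2 * \<sigma>\<^sup>2 * (\<tau> * of_int j + w)\<^sup>2))"
  \<comment> \<open>\<open>T\<close> expands the sample j into pairs z = (k, l), and
    \<open>T'\<close> holds the terms that Poisson summation over j yields for a fixed pair. As it
    acts pair by pair, one interchange of sums comes before it and one after it.\<close>
  define T where "T = (\<lambda>j z. of_real (\<tau> * (\<sigma>\<^sup>2 * pi * e j)) * (cc z * cis (2 * pi * (\<tau> * of_int j + w) * sh z)))"
  define T' where "T' = (\<lambda>m::int. \<lambda>z. cis (2 * pi * of_int m * w / \<tau>) *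
     (of_real (\<sigma> * sqrt (pi / 2)) * (cc z * of_real (exp (- (sh z - of_int m / \<tau>)\<^sup>2 / (2 * \<sigma>\<^sup>2))))))"
  have cc_le: "cmod (cc z) \<le> AA z" for z
    using cc_le alpha_pos[of n] by (cases z) (auto simp: cc_def AA_def norm_mult abs_mult abs_of_pos intro!: mult_right_mono)
  have AAs: "AA summable_on UNIV"
  proof -
    have "((\<lambda>(k, l). \<alpha> n k * \<alpha> n l) has_sum (infsum (\<alpha> n) UNIV * infsum (\<alpha> n) UNIV)) UNIV"
      using alpha_pos[of n] by (intro has_sum_times[OF alpha_summable _ alpha_summable]) (auto simp: abs_of_pos)
    from has_sum_cmult_right[OF this, of "C\<^sup>2"] show ?thesis
      unfolding AA_def by (rule has_sum_imp_summable[OF has_sum_cong[THEN iffD1, rotated]]) auto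
  qed
  have row: "riemann_term \<tau> w n \<xi> j = (\<Sum>\<^sub>\<infinity>z. T j z)" for j
  proof -
    define y where "y = \<tau> * of_int j + w"
    have "T j (k, l) = of_real (\<tau> * (\<sigma>\<^sup>2 * pi * e j)) * cis (2 * pi * y * \<xi>) *
        (c k * cnj (c l) * of_real (\<alpha> n k * \<alpha> n l) * cis (- pi * y * \<beta> * (of_int k - of_int l)))" for k l
    proof -
      have "cis (2 * pi * y * sh (k, l)) = cis (2 * pi * y * \<xi>) * cis (- pi * y * \<beta> * (of_int k - of_int l))"
        unfolding cis_mult sh_def by (intro arg_cong[where f = cis]) (simp add: field_simps)
      then show ?thesis unfolding T_def cc_def y_def[symmetric] by simp
    qed
    then have "(\<Sum>\<^sub>\<infinity>z. T j z) = (\<Sum>\<^sub>\<infinity>z. of_real (\<tau> * (\<sigma>\<^sup>2 * pi * e j)) * cis (2 * pi * y * \<xi>) *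
        (case z of (k, l) \<Rightarrow> c k * cnj (c l) * of_real (\<alpha> n k * \<alpha> n l) * cis (- pi * y * \<beta> * (of_int k - of_int l))))"
      by (intro infsum_cong) auto
    also have "\<dots> = of_real (\<tau> * (\<sigma>\<^sup>2 * pi * e j)) * cis (2 * pi * y * \<xi>) * of_real ((cmod (U n y))\<^sup>2)"
      unfolding infsum_cmult_right' norm_U_sq ..
    also have "\<dots> = riemann_term \<tau> w n \<xi> j"
      by (simp add: riemann_term_def y_def e_def)
    finally show ?thesis ..
  qed
  have swap1: "(\<Sum>\<^sub>\<infinity>j. \<Sum>\<^sub>\<infinity>z. T j z) = (\<Sum>\<^sub>\<infinity>z. \<Sum>\<^sub>\<infinity>j. T j z)"
  proof (rule infsum_swap_dominated(1))
    show "cmod (T j z) \<le> \<tau> * (\<sigma>\<^sup>2 * pi * e j) * AA z" for j z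
      using cc_le[of z] tau unfolding T_def norm_mult norm_of_real
      by (auto simp: e_def abs_mult intro!: mult_left_mono)
    show "(\<lambda>z. \<tau> * (\<sigma>\<^sup>2 * pi * e j) * AA z) summable_on UNIV" for j
      by (intro summable_on_cmult_right AAs)
    show "(\<Sum>\<^sub>\<infinity>z. \<tau> * (\<sigma>\<^sup>2 * pi * e j) * AA z) \<le> \<tau> * (\<sigma>\<^sup>2 * pi * e j) * infsum AA UNIV" for j
      unfolding infsum_cmult_right' ..
    show "(\<lambda>j. \<tau> * (\<sigma>\<^sup>2 * pi * e j) * infsum AA UNIV) summable_on UNIV"
      unfolding e_def by (intro summable_on_cmult_left summable_on_cmult_right summable_on_gauss_grid tau)
  qed
  have col: "(\<Sum>\<^sub>\<infinity>j. T j z) = (\<Sum>\<^sub>\<infinity>m. T' m z)" for z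
  proof -
    have "(\<Sum>\<^sub>\<infinity>j. T j z) = (\<Sum>\<^sub>\<infinity>j. of_real (\<sigma>\<^sup>2 * pi) * cc z * of_real \<tau> * (of_real (e j) * cis (2 * pi * (\<tau> * of_int j + w) * sh z)))"
      unfolding T_def by (simp add: mult_ac)
    also have "\<dots> = of_real (\<sigma>\<^sup>2 * pi) * cc z * (of_real \<tau> * (\<Sum>\<^sub>\<infinity>j. (of_real (e j) * cis (2 * pi * (\<tau> * of_int j + w) * sh z))))"
      unfolding infsum_cmult_right' by (simp add: mult_ac)
    also have "\<dots> = (\<Sum>\<^sub>\<infinity>m::int. of_real (\<sigma>\<^sup>2 * pi) * cc z * (of_real (1 / (\<sigma> * sqrt (2 * pi)) * exp (- (sh z - of_int m / \<tau>)\<^sup>2 / (2 * \<sigma>\<^sup>2))) * cis (2 * pi * of_int m * w / \<tau>)))"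
      unfolding e_def gauss_riemann_poisson[OF sigma tau] infsum_cmult_right' ..
    also have "\<dots> = (\<Sum>\<^sub>\<infinity>m. T' m z)"
      unfolding T'_def gauss_constant_eq[symmetric] by (intro infsum_cong) (simp add: mult_ac)
    finally show ?thesis .
  qed
  have pw: "\<alpha> n k * \<alpha> n l * exp (- (sh (k, l) - of_int m / \<tau>)\<^sup>2 / (2 * \<sigma>\<^sup>2)) = pair_weight n (\<xi> - of_int m / \<tau>) (k, l)" for k l and m :: int
    unfolding pair_weight_def sh_def by (simp add: algebra_simps)
  have T'_le: "cmod (T' m z) \<le> \<sigma> * sqrt (pi / 2) * C\<^sup>2 * pair_weight n (\<xi> - of_int m / \<tau>) z" for m z
  proof -
    obtain k l where z: "z = (k, l)" by (cases z)
    have "cmod (cc z) * exp (- (sh z - of_int m / \<tau>)\<^sup>2 / (2 * \<sigma>\<^sup>2)) \<le> AA z * exp (- (sh z - of_int m / \<tau>)\<^sup>2 / (2 * \<sigma>\<^sup>2))"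
      by (intro mult_right_mono cc_le) auto
    also have "\<dots> = C\<^sup>2 * pair_weight n (\<xi> - of_int m / \<tau>) z"
      unfolding z pw[symmetric] AA_def by simp
    finally have "\<sigma> * sqrt (pi / 2) * (cmod (cc z) * exp (- (sh z - of_int m / \<tau>)\<^sup>2 / (2 * \<sigma>\<^sup>2))) \<le> \<sigma> * sqrt (pi / 2) * (C\<^sup>2 * pair_weight n (\<xi> - of_int m / \<tau>) z)"
      using sigma by (intro mult_left_mono) auto
    then show ?thesis
      unfolding T'_def norm_mult norm_of_real using sigma by (simp add: mult.assoc)
  qed
  have gram_eq: "(\<Sum>\<^sub>\<infinity>z. T' m z) = cis (2 * pi * of_int m * w / \<tau>) * gram n (\<xi> - of_int m / \<tau>)" for m
  proof -
    have "cc z * of_real (exp (- (sh z - of_int m / \<tau>)\<^sup>2 / (2 * \<sigma>\<^sup>2))) = (case z of (k, l) \<Rightarrow> c k * cnj (c l) * of_real (pair_weight n (\<xi> - of_int m / \<tau>) (k, l)))" for z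
      by (cases z) (simp add: cc_def pw[symmetric])
    then show ?thesis
      unfolding T'_def infsum_cmult_right' gram_def by simp
  qed
  \<comment> \<open>The rows of \<open>T'\<close> are bounded through the Gaussian decay of the pair
    sums in the alias distance, which is summable over m.\<close>
  define hm where "hm = (\<lambda>m::int. \<sigma> * sqrt (pi / 2) * C\<^sup>2 * (exp (- (\<xi> - of_int m / \<tau>)\<^sup>2 / (4 * \<sigma>\<^sup>2)) * B\<^sup>2))"
  have hms: "hm summable_on UNIV"
  proof -
    have "(\<lambda>m::int. exp (- (1 / \<tau> * of_int m - \<xi>)\<^sup>2 / (4 * \<sigma>\<^sup>2))) summable_on UNIV"
      using sigma tau by (intro summable_on_gauss_lattice) auto
    then have "(\<lambda>m::int. exp (- (\<xi> - of_int m / \<tau>)\<^sup>2 / (4 * \<sigma>\<^sup>2))) summable_on UNIV"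
      by (simp add: power2_commute)
    then show ?thesis
      unfolding hm_def by (intro summable_on_cmult_left summable_on_cmult_right)
  qed
  have G: "(\<lambda>z. \<sigma> * sqrt (pi / 2) * C\<^sup>2 * pair_weight n (\<xi> - of_int m / \<tau>) z) summable_on UNIV" for m :: int
    by (intro summable_on_cmult_right pair_weight_summable)
  have Gle: "(\<Sum>\<^sub>\<infinity>z. \<sigma> * sqrt (pi / 2) * C\<^sup>2 * pair_weight n (\<xi> - of_int m / \<tau>) z) \<le> hm m" for m
    unfolding infsum_cmult_right' hm_def using sigma by (intro mult_left_mono pair_weight_sum_le) auto
  have swap2: "(\<Sum>\<^sub>\<infinity>m. \<Sum>\<^sub>\<infinity>z. T' m z) = (\<Sum>\<^sub>\<infinity>z. \<Sum>\<^sub>\<infinity>m. T' m z)"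
    and sm: "(\<lambda>(m, z). T' m z) summable_on UNIV \<times> UNIV"
    by (rule infsum_swap_dominated[OF T'_le G Gle hms])+
  show "(\<Sum>\<^sub>\<infinity>j. riemann_term \<tau> w n \<xi> j) = (\<Sum>\<^sub>\<infinity>m::int. cis (2 * pi * of_int m * w / \<tau>) * gram n (\<xi> - of_int m / \<tau>))"
    unfolding row swap1 col swap2[symmetric] gram_eq ..
  show "(\<lambda>m::int. cis (2 * pi * of_int m * w / \<tau>) * gram n (\<xi> - of_int m / \<tau>)) summable_on UNIV"
    using summable_on_Sigma_banach[OF sm] unfolding gram_eq .
qed

section \<open>Aliasing and truncation in frequency\<close>

lemma exp_gauss_le_exp_lin: "exp (- x\<^sup>2 / (4 * \<sigma>\<^sup>2)) \<le> exp (1 - \<bar>x\<bar> / \<sigma>)"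
proof -
  \<comment> \<open>The tangent to the parabola at |x| = 2 \<sigma>. The linear exponent lets the
    aliases be summed as a geometric series and is the origin of
    \<open>exp (1 + r / \<sigma>)\<close> in \<open>D2\<close>.\<close>
  have "0 \<le> (\<bar>x\<bar> / (2 * \<sigma>) - 1)\<^sup>2" by simp
  also have "\<dots> = \<bar>x\<bar>\<^sup>2 / (4 * \<sigma>\<^sup>2) + 1 - \<bar>x\<bar> / \<sigma>"
    using sigma by (simp add: power2_diff power_divide power_mult_distrib)
  finally show ?thesis by simp
qed

text \<open>The alias m = 0 is \<open>gram n \<xi>\<close> itself. The others lie at distance at
  least \<open>\<bar>m\<bar> / \<tau> - r\<close> and decay geometrically with ratio
  \<open>x = exp (- 1 / (\<tau> * \<sigma>))\<close>. The condition on \<open>Q\<close> amounts to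
  \<open>x / (1 - x) \<le> 1 / Q\<close>, whence the + 1 under the logarithm in the condition on
  h.\<close>

lemma aliasing_error:
  assumes tau: "\<tau> > 0" and xi: "\<bar>\<xi>\<bar> \<le> r" and Q: "Q > 0" "Q + 1 \<le> exp (1 / (\<tau> * \<sigma>))"
  shows "cmod ((\<Sum>\<^sub>\<infinity>j. riemann_term \<tau> w n \<xi> j) - gram n \<xi>) \<le> C\<^sup>2 * (\<sigma> * sqrt (pi / 2)) * B\<^sup>2 * (2 * exp (1 + r / \<sigma>) / Q)"
proof -
  define M where "M = C\<^sup>2 * (\<sigma> * sqrt (pi / 2)) * B\<^sup>2"
  have M: "M \<ge> 0" using sigma by (simp add: M_def)
  define F where "F = (\<lambda>m::int. cis (2 * pi * of_int m * w / \<tau>) * gram n (\<xi> - of_int m / \<tau>))"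
  define G where "G = (\<lambda>m::int. M * exp (- (\<xi> - of_int m / \<tau>)\<^sup>2 / (4 * \<sigma>\<^sup>2)))"
  have Fs: "F summable_on UNIV" unfolding F_def by (rule riemann_sum_eq(2)[OF tau])
  have "(\<Sum>\<^sub>\<infinity>j. riemann_term \<tau> w n \<xi> j) - gram n \<xi> = infsum F (- {- int 0..int 0})"
    unfolding riemann_sum_eq(1)[OF tau] F_def[symmetric] infsum_split_outside[OF Fs, of 0]
    by (simp add: F_def)
  also have "cmod \<dots> \<le> infsum G (- {- int 0..int 0})"
  proof (rule norm_infsum_le_infsum)
    have "(\<lambda>m::int. exp (- (1 / \<tau> * of_int m - \<xi>)\<^sup>2 / (4 * \<sigma>\<^sup>2))) summable_on UNIV"
      using sigma tau by (intro summable_on_gauss_lattice) auto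
    then have "G summable_on UNIV"
      unfolding G_def by (intro summable_on_cmult_right) (simp add: power2_commute)
    then show "G summable_on (- {- int 0..int 0})"
      by (rule summable_on_subset_banach) auto
    show "cmod (F m) \<le> G m" for m
      using norm_gram_le[of n "\<xi> - of_int m / \<tau>"] by (simp add: F_def G_def M_def norm_mult)
  qed
  also have "\<dots> \<le> M * exp (1 + r / \<sigma>) / Q + M * exp (1 + r / \<sigma>) / Q"
  proof -
    define x where "x = exp (- (1 / (\<tau> * \<sigma>)))"
    have x: "0 < x" "x < 1" using tau sigma by (simp_all add: x_def)
    have pw: "x ^ i = exp (- (real i / \<tau>) / \<sigma>)" for i
      unfolding x_def exp_of_nat_mult[symmetric] by (simp add: field_simps)
    have "(Q + 1) * x \<le> exp (1 / (\<tau> * \<sigma>)) * x"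
      using Q x by (intro mult_right_mono) auto
    then have "(Q + 1) * x \<le> 1" by (simp add: x_def exp_minus)
    then have "x / (1 - x) \<le> 1 / Q"
      using Q x by (simp add: field_simps)
    then have lim: "M * exp (1 + r / \<sigma>) * x / (1 - x) \<le> M * exp (1 + r / \<sigma>) / Q"
      using mult_left_mono[of "x / (1 - x)" "1 / Q" "M * exp (1 + r / \<sigma>)"] M by simp
    have g: "((\<lambda>i. M * exp (1 + r / \<sigma>) * x * x ^ i) has_sum (M * exp (1 + r / \<sigma>) * x / (1 - x))) UNIV"
      by (rule has_sum_geometric_nat) (use x in auto)
    have le: "G m \<le> M * exp (1 + r / \<sigma>) * x * x ^ i" if m: "\<bar>real_of_int m\<bar> = real i + 1" for m i
    proof -
      have "\<bar>real_of_int m / \<tau>\<bar> = (real i + 1) / \<tau>"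
        using m tau by (simp add: abs_divide)
      then have "(real i + 1) / \<tau> - r \<le> \<bar>\<xi> - real_of_int m / \<tau>\<bar>"
        using xi by linarith
      then have "((real i + 1) / \<tau> - r) / \<sigma> \<le> \<bar>\<xi> - real_of_int m / \<tau>\<bar> / \<sigma>"
        using sigma by (intro divide_right_mono) auto
      then have "exp (1 - \<bar>\<xi> - real_of_int m / \<tau>\<bar> / \<sigma>) \<le> exp ((1 + r / \<sigma>) + - (real (Suc i) / \<tau>) / \<sigma>)"
        by (simp add: diff_divide_distrib add.commute)
      also have "\<dots> = exp (1 + r / \<sigma>) * x ^ Suc i"
        unfolding pw exp_add ..
      finally have "exp (- (\<xi> - of_int m / \<tau>)\<^sup>2 / (4 * \<sigma>\<^sup>2)) \<le> exp (1 + r / \<sigma>) * x ^ Suc i"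
        using exp_gauss_le_exp_lin order_trans by blast
      then show ?thesis
        unfolding G_def using M by (simp add: mult_left_mono mult.assoc)
    qed
    have "infsum G (- {- int 0..int 0}) \<le> M * exp (1 + r / \<sigma>) * x / (1 - x) + M * exp (1 + r / \<sigma>) * x / (1 - x)"
    proof (rule infsum_outside_le[OF _ g _ g])
      show "G k \<ge> 0" for k using M by (simp add: G_def)
    qed (rule le, simp)+
    then show ?thesis using lim by linarith
  qed
  finally show ?thesis by (simp add: M_def mult_ac)
qed

text \<open>The nodes are offset by \<open>w\<close>: \<open>m\<close> indices make up for the
  offset, and the remaining \<open>Z\<close> keep the cut at distance at least
  \<open>\<tau> * Z\<close> from the peak. Beyond it, (Z + i + 1)^2 >= Z^2 + (i + 1)^2 splits off
  the small factor from a fixed Gaussian tail.\<close>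

lemma riemann_tail:
  assumes tau: "\<tau> > 0" and w: "\<bar>w\<bar> \<le> \<tau> * m" and H: "m + Z \<le> real H" and Z: "Z \<ge> 0"
  shows "cmod ((\<Sum>\<^sub>\<infinity>j. riemann_term \<tau> w n \<xi> j) - (\<Sum>j\<in>{- int H..int H}. riemann_term \<tau> w n \<xi> j))
    \<le> C\<^sup>2 * (\<sigma> * sqrt (pi / 2)) * B\<^sup>2 * exp (- 2 * pi\<^sup>2 * \<sigma>\<^sup>2 * \<tau>\<^sup>2 * Z\<^sup>2)"
proof -
  define a where "a = 2 * pi\<^sup>2 * \<sigma>\<^sup>2 * \<tau>\<^sup>2"
  have a: "a > 0" using sigma tau by (simp add: a_def)
  define M where "M = \<tau> * (\<sigma>\<^sup>2 * pi * (C * B)\<^sup>2)"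
  have M: "M \<ge> 0" using tau by (simp add: M_def)
  define G where "G = (\<lambda>j::int. M * exp (- 2 * pi\<^sup>2 * \<sigma>\<^sup>2 * (\<tau> * of_int j + w)\<^sup>2))"
  have "(\<Sum>\<^sub>\<infinity>j. riemann_term \<tau> w n \<xi> j) - (\<Sum>j\<in>{- int H..int H}. riemann_term \<tau> w n \<xi> j) = infsum (riemann_term \<tau> w n \<xi>) (- {- int H..int H})"
    using infsum_split_outside[OF riemann_term_summable[OF tau], where N = H] by simp
  also have "cmod \<dots> \<le> infsum G (- {- int H..int H})"
  proof (rule norm_infsum_le_infsum)
    have "G summable_on UNIV"
      unfolding G_def by (intro summable_on_cmult_right summable_on_gauss_grid tau)
    then show "G summable_on (- {- int H..int H})"
      by (rule summable_on_subset_banach) auto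
    show "cmod (riemann_term \<tau> w n \<xi> j) \<le> G j" for j
      unfolding G_def M_def by (rule norm_riemann_term_le[OF tau])
  qed
  also have "\<dots> \<le> M * exp (- a * Z\<^sup>2) * (\<Sum>i. exp (- a * (real i + 1)\<^sup>2)) + M * exp (- a * Z\<^sup>2) * (\<Sum>i. exp (- a * (real i + 1)\<^sup>2))"
  proof -
    have g: "((\<lambda>i. M * exp (- a * Z\<^sup>2) * exp (- a * (real i + 1)\<^sup>2)) has_sum (M * exp (- a * Z\<^sup>2) * (\<Sum>i. exp (- a * (real i + 1)\<^sup>2)))) UNIV"
      by (intro has_sum_cmult_right has_sum_suminf_nonneg gauss_tail_sum(1) a) auto
    have le: "G j \<le> M * exp (- a * Z\<^sup>2) * exp (- a * (real i + 1)\<^sup>2)" if j: "\<bar>real_of_int j\<bar> = real H + 1 + real i" for i j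
    proof -
      have "\<tau> * (m + Z) \<le> \<tau> * real H" using H tau by simp
      moreover have "\<bar>\<tau> * real_of_int j\<bar> = \<tau> * (real H + 1 + real i)"
        unfolding abs_mult j using tau by simp
      ultimately have "\<tau> * (real i + 1 + Z) \<le> \<bar>\<tau> * of_int j + w\<bar>"
        using w by (simp add: algebra_simps)
      moreover have "0 \<le> \<tau> * (real i + 1 + Z)" using tau Z by simp
      ultimately have "(\<tau> * (real i + 1 + Z))\<^sup>2 \<le> (\<tau> * of_int j + w)\<^sup>2"
        by (simp add: abs_le_square_iff[symmetric])
      moreover have "\<tau>\<^sup>2 * (Z\<^sup>2 + (real i + 1)\<^sup>2) \<le> (\<tau> * (real i + 1 + Z))\<^sup>2"
        unfolding power_mult_distrib using Z by (intro mult_left_mono) (auto simp: power2_sum)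
      ultimately have "\<tau>\<^sup>2 * (Z\<^sup>2 + (real i + 1)\<^sup>2) \<le> (\<tau> * of_int j + w)\<^sup>2" by linarith
      then have "2 * pi\<^sup>2 * \<sigma>\<^sup>2 * (\<tau>\<^sup>2 * (Z\<^sup>2 + (real i + 1)\<^sup>2)) \<le> 2 * pi\<^sup>2 * \<sigma>\<^sup>2 * (\<tau> * of_int j + w)\<^sup>2"
        by (intro mult_left_mono) auto
      then have "exp (- 2 * pi\<^sup>2 * \<sigma>\<^sup>2 * (\<tau> * of_int j + w)\<^sup>2) \<le> exp (- a * Z\<^sup>2) * exp (- a * (real i + 1)\<^sup>2)"
        by (simp add: exp_add[symmetric] a_def algebra_simps)
      then show ?thesis unfolding G_def mult.assoc using M by (intro mult_left_mono) (auto simp: mult.assoc)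
    qed
    show ?thesis
    proof (rule infsum_outside_le[OF _ g _ g])
      show "G k \<ge> 0" for k using M by (simp add: G_def)
    qed (rule le, simp)+
  qed
  \<comment> \<open>Each of the two tails is at most half of the Gaussian integral.\<close>
  also have "\<dots> \<le> M * exp (- a * Z\<^sup>2) * sqrt (pi / a)"
    using mult_left_mono[OF gauss_tail_sum(2)[OF a], of "M * exp (- a * Z\<^sup>2)"] M by simp
  also have "sqrt (pi / a) = 1 / (\<sigma> * sqrt (2 * pi)) / \<tau>"
  proof (rule real_sqrt_unique)
    show "(1 / (\<sigma> * sqrt (2 * pi)) / \<tau>)\<^sup>2 = pi / a"
      using sigma tau by (simp add: a_def power_divide power_mult_distrib power2_eq_square)
  qed (use sigma tau in auto)
  also have "M * exp (- a * Z\<^sup>2) * (1 / (\<sigma> * sqrt (2 * pi)) / \<tau>) = C\<^sup>2 * (\<sigma> * sqrt (pi / 2)) * B\<^sup>2 * exp (- 2 * pi\<^sup>2 * \<sigma>\<^sup>2 * \<tau>\<^sup>2 * Z\<^sup>2)"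
    unfolding gauss_constant_eq[symmetric] M_def a_def using tau by (simp add: power_mult_distrib)
  finally show ?thesis .
qed

end

subsection \<open>The dual generator\<close>

text \<open>The theta function after Poisson summation. In this form it is visibly positive, which
  its Fourier series does not show.\<close>

definition theta_real :: "real \<Rightarrow> real \<Rightarrow> real" where
  "theta_real a x = sqrt (pi / a) * (\<Sum>\<^sub>\<infinity>j::int. exp (- (x - 2 * pi * of_int j)\<^sup>2 / (4 * a)))"

lemma theta3_eq:
  "theta3 (of_real (\<beta> / 2 * pi * u)) (of_real (exp (- \<beta>\<^sup>2 / (8 * \<sigma>\<^sup>2))))
   = (\<Sum>\<^sub>\<infinity>n::int. of_real (exp (- (\<beta>\<^sup>2 / (8 * \<sigma>\<^sup>2)) * (of_int n)\<^sup>2)) * cis (pi * \<beta> * u * of_int n))"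
  unfolding theta3_def
proof (rule infsum_cong)
  fix n :: int
  have "complex_of_real (exp (- \<beta>\<^sup>2 / (8 * \<sigma>\<^sup>2))) powi (n\<^sup>2) = of_real (exp (- \<beta>\<^sup>2 / (8 * \<sigma>\<^sup>2)) ^ nat (n\<^sup>2))"
    by (simp add: power_int_def)
  also have "exp (- \<beta>\<^sup>2 / (8 * \<sigma>\<^sup>2)) ^ nat (n\<^sup>2) = exp (- (\<beta>\<^sup>2 / (8 * \<sigma>\<^sup>2)) * (of_int n)\<^sup>2)"
    unfolding exp_of_nat_mult[symmetric] by (simp add: mult.commute)
  finally have 1: "complex_of_real (exp (- \<beta>\<^sup>2 / (8 * \<sigma>\<^sup>2))) powi (n\<^sup>2) = of_real (exp (- (\<beta>\<^sup>2 / (8 * \<sigma>\<^sup>2)) * (of_int n)\<^sup>2))" .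
  have "exp (2 * of_int n * \<i> * complex_of_real (\<beta> / 2 * pi * u)) = cis (pi * \<beta> * u * of_int n)"
    unfolding cis_conv_exp by (intro arg_cong[where f = exp]) (simp add: field_simps)
  with 1 show "complex_of_real (exp (- \<beta>\<^sup>2 / (8 * \<sigma>\<^sup>2))) powi (n\<^sup>2) * exp (2 * of_int n * \<i> * complex_of_real (\<beta> / 2 * pi * u))
    = of_real (exp (- (\<beta>\<^sup>2 / (8 * \<sigma>\<^sup>2)) * (of_int n)\<^sup>2)) * cis (pi * \<beta> * u * of_int n)"
    by (simp only:)
qed

lemma theta_poisson:
  assumes "a > 0"
  shows "(\<Sum>\<^sub>\<infinity>n::int. of_real (exp (- a * (of_int n)\<^sup>2)) * cis (x * of_int n)) = complex_of_real (theta_real a x)"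
proof -
  have "(\<Sum>\<^sub>\<infinity>n::int. of_real (exp (- a * (of_int n)\<^sup>2)) * cis (x * of_int n))
    = (\<Sum>\<^sub>\<infinity>j::int. complex_of_real (sqrt (pi / a) * exp (- (x - 2 * pi * of_int j)\<^sup>2 / (4 * a))))"
    using gauss_poisson[OF assms, of 0 x] by simp
  also have "\<dots> = complex_of_real (theta_real a x)"
    unfolding theta_real_def using gauss_poisson_summable[OF assms, of x]
    by (intro infsumI has_sum_of_real has_sum_cmult_right) auto
  finally show ?thesis .
qed

text \<open>All terms are positive, and the multiple of 2 pi nearest to x is at distance at most pi;
  its term alone gives the bound. Being uniform in x, the bound makes \<open>Lambda\<close>
  integrable.\<close>

lemma theta_real_ge:
  assumes a: "a > 0"
  shows "theta_real a x \<ge> sqrt (pi / a) * exp (- pi\<^sup>2 / (4 * a))"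
proof -
  let ?f = "\<lambda>j::int. exp (- (x - 2 * pi * of_int j)\<^sup>2 / (4 * a))"
  define j where "j = round (x / (2 * pi))"
  have "\<bar>of_int j - x / (2 * pi)\<bar> \<le> 1 / 2"
    unfolding j_def by (rule of_int_round_abs_le)
  then have "2 * pi * \<bar>of_int j - x / (2 * pi)\<bar> \<le> 2 * pi * (1 / 2)"
    by (intro mult_left_mono) auto
  moreover have "2 * pi * \<bar>of_int j - x / (2 * pi)\<bar> = \<bar>2 * pi * (of_int j - x / (2 * pi))\<bar>"
    by (simp add: abs_mult)
  moreover have "2 * pi * (of_int j - x / (2 * pi)) = - (x - 2 * pi * of_int j)"
    by (simp add: field_simps)
  ultimately have "\<bar>x - 2 * pi * of_int j\<bar> \<le> \<bar>pi\<bar>" by simp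
  then have "(x - 2 * pi * of_int j)\<^sup>2 \<le> pi\<^sup>2" by (simp only: abs_le_square_iff)
  then have "exp (- pi\<^sup>2 / (4 * a)) \<le> ?f j"
    using a by (simp add: divide_right_mono)
  also have "?f j = sum ?f {j}" by simp
  also have "\<dots> \<le> infsum ?f UNIV"
    by (rule finite_sum_le_infsum[OF gauss_poisson_summable[OF a]]) auto
  finally show ?thesis
    unfolding theta_real_def using a by (intro mult_left_mono) auto
qed

lemma theta_real_even: "a > 0 \<Longrightarrow> theta_real a (- x) = theta_real a x"
proof -
  assume a: "a > 0"
  have bij: "bij_betw (uminus :: int \<Rightarrow> int) UNIV UNIV"
    by (rule bij_betwI[where g = uminus]) auto
  have "complex_of_real (theta_real a (- x)) = complex_of_real (theta_real a x)"
    unfolding theta_poisson[OF a, symmetric]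
    using infsum_reindex_bij_betw[OF bij, of "\<lambda>n. of_real (exp (- a * (of_int n)\<^sup>2)) * cis (x * of_int n)"]
    by simp
  then show ?thesis by simp
qed

text \<open>Read off the Fourier form, whose terms have a summable majorant independent of
  x.\<close>

lemma continuous_on_theta_real:
  assumes a: "a > 0"
  shows "continuous_on S (theta_real a)"
proof -
  have "continuous_on S (\<lambda>x. \<Sum>\<^sub>\<infinity>n::int. of_real (exp (- a * (of_int n)\<^sup>2)) * cis (x * of_int n))"
    by (rule continuous_on_int_infsum[OF _ _ summable_on_gauss_int[OF a]])
      (auto intro!: continuous_intros simp: norm_mult)
  then have "continuous_on S (\<lambda>x. Re (complex_of_real (theta_real a x)))"
    unfolding theta_poisson[OF a] by (rule continuous_on_Re)
  then show ?thesis by simp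
qed

context gauss_shift_space
begin

definition q :: real where "q = \<beta>\<^sup>2 / (8 * \<sigma>\<^sup>2)"

definition L :: "real \<Rightarrow> complex" where "L = inv_fourier (Lambda \<sigma> \<beta>)"

lemma q_pos: "q > 0"
  using sigma beta by (simp add: q_def)

lemma Lambda_eq: "Lambda \<sigma> \<beta> u = of_real (exp (- pi\<^sup>2 * \<sigma>\<^sup>2 * u\<^sup>2) / theta_real q (pi * \<beta> * u))"
  unfolding Lambda_def theta3_eq q_def[symmetric] theta_poisson[OF q_pos] by simp

lemma theta_real_pos: "theta_real q x > 0"
  using theta_real_ge[OF q_pos, of x] q_pos
  by (intro less_le_trans[OF _ theta_real_ge[OF q_pos]] mult_pos_pos) auto

lemma Lambda_measurable [measurable]: "Lambda \<sigma> \<beta> \<in> borel_measurable borel"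
proof (rule borel_measurable_continuous_onI)
  have "continuous_on UNIV (\<lambda>u. theta_real q (pi * \<beta> * u))"
    by (intro continuous_on_compose2[OF continuous_on_theta_real[OF q_pos, of UNIV]] continuous_intros) auto
  then show "continuous_on UNIV (Lambda \<sigma> \<beta>)"
    unfolding Lambda_eq[abs_def] using theta_real_pos
    by (intro continuous_intros ballI less_imp_neq[symmetric])
qed

lemma Lambda_integrable: "integrable lborel (Lambda \<sigma> \<beta>)"
proof (rule Bochner_Integration.integrable_bound)
  define c0 where "c0 = sqrt (pi / q) * exp (- pi\<^sup>2 / (4 * q))"
  have c0: "c0 > 0" using q_pos by (simp add: c0_def)
  have "pi\<^sup>2 * \<sigma>\<^sup>2 > 0" using sigma by simp
  from gauss_integrable[OF this, of 0]
  show "integrable lborel (\<lambda>u. exp (- (pi\<^sup>2 * \<sigma>\<^sup>2) * (u - 0)\<^sup>2) * (1 / c0))"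
    by (rule integrable_mult_left)
  show "AE u in lborel. norm (Lambda \<sigma> \<beta> u) \<le> norm (exp (- (pi\<^sup>2 * \<sigma>\<^sup>2) * (u - 0)\<^sup>2) * (1 / c0))"
  proof (rule AE_I2)
    fix u
    have "exp (- pi\<^sup>2 * \<sigma>\<^sup>2 * u\<^sup>2) / theta_real q (pi * \<beta> * u) \<le> exp (- pi\<^sup>2 * \<sigma>\<^sup>2 * u\<^sup>2) / c0"
      using theta_real_ge[OF q_pos, of "pi * \<beta> * u"] c0 unfolding c0_def by (intro divide_left_mono) auto
    then show "norm (Lambda \<sigma> \<beta> u) \<le> norm (exp (- (pi\<^sup>2 * \<sigma>\<^sup>2) * (u - 0)\<^sup>2) * (1 / c0))"
      unfolding Lambda_eq norm_of_real using c0 theta_real_pos[of "pi * \<beta> * u"] by simp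
  qed
qed simp

text \<open>Measurability passes from \<open>L\<close> to the local functions and then to the
  output, whose essential supremum is estimated in the end.\<close>

lemma L_measurable [measurable]: "L \<in> borel_measurable borel"
proof -
  have c: "cis \<in> borel_measurable borel"
    by (rule borel_measurable_continuous_onI) (intro continuous_intros)
  have "(\<lambda>t. \<integral>u. Lambda \<sigma> \<beta> u * cis (2 * pi * u * t) \<partial>lborel) \<in> borel_measurable borel"
  proof (rule lborel.borel_measurable_lebesgue_integral)
    show "case_prod (\<lambda>t u. Lambda \<sigma> \<beta> u * cis (2 * pi * u * t)) \<in> borel_measurable (borel \<Otimes>\<^sub>M lborel)"
      unfolding case_prod_beta
      by (intro borel_measurable_times measurable_compose[OF _ c] measurable_compose[OF _ Lambda_measurable]) measurable
  qed
  then show ?thesis unfolding L_def inv_fourier_def .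
qed

text \<open>On the Fourier side the lattice convolution multiplies \<open>Lambda\<close> by the
  theta function in its denominator. Only the Gaussian numerator is left, and the right-hand side is
  its inverse transform.\<close>

lemma L_convolution:
  "(\<Sum>\<^sub>\<infinity>m::int. of_real (exp (- q * (of_int m)\<^sup>2)) * L (t - \<beta> / 2 * of_int m))
   = of_real (1 / (\<sigma> * sqrt pi) * exp (- t\<^sup>2 / \<sigma>\<^sup>2))"
proof -
  define e where "e = (\<lambda>m::int. exp (- q * (of_int m)\<^sup>2))"
  have es: "e summable_on UNIV" unfolding e_def by (rule summable_on_gauss_int[OF q_pos])
  define F where "F = (\<lambda>m u. of_real (e m) * (Lambda \<sigma> \<beta> u * cis (2 * pi * u * (t - \<beta> / 2 * of_int m))))"
  have cm: "(\<lambda>u. cis (2 * pi * u * y)) \<in> borel_measurable borel" for y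
    by (rule borel_measurable_continuous_onI) (intro continuous_intros)
  have nF: "cmod (F m u) = e m * cmod (Lambda \<sigma> \<beta> u)" for m u
    by (simp add: F_def norm_mult e_def)
  have Fi: "integrable lborel (F m)" for m
  proof (rule Bochner_Integration.integrable_bound)
    show "integrable lborel (\<lambda>u. e m * cmod (Lambda \<sigma> \<beta> u))"
      by (intro integrable_mult_right integrable_norm Lambda_integrable)
    show "F m \<in> borel_measurable lborel"
      unfolding F_def using cm Lambda_measurable by (intro borel_measurable_times) auto
  qed (simp add: nF)
  have "(\<Sum>\<^sub>\<infinity>m. of_real (e m) * L (t - \<beta> / 2 * of_int m)) = (\<Sum>\<^sub>\<infinity>m. \<integral>u. F m u \<partial>lborel)"
    unfolding F_def integral_mult_right_zero by (simp add: L_def inv_fourier_def)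
  also have "\<dots> = (\<integral>u. (\<Sum>\<^sub>\<infinity>m. F m u) \<partial>lborel)"
  proof (rule int_infsum_integral(2)[OF Fi, symmetric])
    show "(\<lambda>m. \<integral>u. cmod (F m u) \<partial>lborel) summable_on UNIV"
      unfolding nF integral_mult_right_zero by (intro summable_on_cmult_left es)
    show "(\<lambda>m. cmod (F m u)) summable_on UNIV" for u
      unfolding nF by (intro summable_on_cmult_left es)
  qed
  also have "(\<lambda>u. \<Sum>\<^sub>\<infinity>m. F m u) = (\<lambda>u. of_real (exp (- (pi\<^sup>2 * \<sigma>\<^sup>2) * (u - 0)\<^sup>2)) * cis (2 * pi * t * u))"
  proof
    fix u
    have "F m u = Lambda \<sigma> \<beta> u * cis (2 * pi * t * u) * (of_real (e m) * cis (- (pi * \<beta> * u) * of_int m))" for m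
    proof -
      have "cis (2 * pi * u * (t - \<beta> / 2 * of_int m)) = cis (2 * pi * t * u) * cis (- (pi * \<beta> * u) * of_int m)"
        unfolding cis_mult by (intro arg_cong[where f = cis]) (simp add: field_simps)
      then show ?thesis by (simp add: F_def mult_ac)
    qed
    then have "(\<Sum>\<^sub>\<infinity>m. F m u) = Lambda \<sigma> \<beta> u * cis (2 * pi * t * u) * (\<Sum>\<^sub>\<infinity>m. of_real (e m) * cis (- (pi * \<beta> * u) * of_int m))"
      by (simp only: infsum_cmult_right')
    \<comment> \<open>The shifts yield the theta function at the reflected argument; evenness turns
      it into the denominator of \<open>Lambda\<close>.\<close>
    also have "(\<Sum>\<^sub>\<infinity>m. of_real (e m) * cis (- (pi * \<beta> * u) * of_int m)) = of_real (theta_real q (pi * \<beta> * u))"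
      unfolding e_def theta_poisson[OF q_pos] theta_real_even[OF q_pos] ..
    finally show "(\<Sum>\<^sub>\<infinity>m. F m u) = of_real (exp (- (pi\<^sup>2 * \<sigma>\<^sup>2) * (u - 0)\<^sup>2)) * cis (2 * pi * t * u)"
      unfolding Lambda_eq using theta_real_pos[of "pi * \<beta> * u"] by simp
  qed
  also have "(\<integral>u. of_real (exp (- (pi\<^sup>2 * \<sigma>\<^sup>2) * (u - 0)\<^sup>2)) * cis (2 * pi * t * u) \<partial>lborel)
    = of_real (sqrt (pi / (pi\<^sup>2 * \<sigma>\<^sup>2)) * exp (- (2 * pi * t)\<^sup>2 / (4 * (pi\<^sup>2 * \<sigma>\<^sup>2))))"
    using gauss_fourier[of "pi\<^sup>2 * \<sigma>\<^sup>2" 0 "2 * pi * t"] sigma by simp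
  also have "sqrt (pi / (pi\<^sup>2 * \<sigma>\<^sup>2)) = 1 / (\<sigma> * sqrt pi)"
    by (rule real_sqrt_unique) (use sigma in \<open>auto simp: power_divide power_mult_distrib power2_eq_square\<close>)
  also have "- (2 * pi * t)\<^sup>2 / (4 * (pi\<^sup>2 * \<sigma>\<^sup>2)) = - t\<^sup>2 / \<sigma>\<^sup>2"
    using sigma by (simp add: power_mult_distrib)
  finally show ?thesis unfolding e_def .
qed

text \<open>For a fixed pair (k, l) the substitution n = k + l + m brings the sum over n to
  \<open>L_convolution\<close>. The resulting Gaussian recombines with the remaining pair weight to
  the product of the generators at \<open>p + \<xi>\<close> and \<open>p\<close>. This explains the
  shift by \<xi> / 2 in the dual generator; its exponential factor cancels the decay of
  \<open>gram\<close> in \<xi>.\<close>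

theorem gram_reconstruction:
  assumes nu: "\<nu> > 0" and L_le: "\<And>t. cmod (L t) \<le> K * exp (- \<nu> * \<bar>t\<bar>)"
  shows "(\<Sum>\<^sub>\<infinity>n. gram n \<xi> * (of_real (sqrt 2 * exp (\<xi>\<^sup>2 / (4 * \<sigma>\<^sup>2))) * L (p + \<xi> / 2 - \<beta> / 2 * of_int n))) = f (p + \<xi>) * cnj (f p)"
proof -
  have "0 \<le> K" using order_trans[OF norm_ge_zero L_le[of 0]] by simp
  define y where "y = p + \<xi> / 2"
  define T where "T = (\<lambda>n (k, l). c k * cnj (c l) * of_real (pair_weight n \<xi> (k, l)) * L (y - \<beta> / 2 * of_int n))"
  define ee where "ee = (\<lambda>n::int. exp (- \<nu> * \<bar>y - \<beta> / 2 * of_int n\<bar>))"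
  have ees: "ee summable_on UNIV"
    unfolding ee_def using nu beta by (intro exp_abs_lattice_sum) auto
  have swap: "(\<Sum>\<^sub>\<infinity>n. \<Sum>\<^sub>\<infinity>z. T n z) = (\<Sum>\<^sub>\<infinity>z. \<Sum>\<^sub>\<infinity>n. T n z)"
  proof (rule infsum_swap_dominated(1))
    show "cmod (T n z) \<le> C\<^sup>2 * (K * ee n) * pair_weight n \<xi> z" for n z
    proof (cases z)
      case (Pair k l)
      have "cmod (T n z) = cmod (c k * cnj (c l)) * cmod (L (y - \<beta> / 2 * of_int n)) * pair_weight n \<xi> z"
        using pair_weight_pos[of n \<xi> z] by (simp add: T_def Pair norm_mult abs_of_pos mult_ac)
      also have "\<dots> \<le> C\<^sup>2 * (K * ee n) * pair_weight n \<xi> z"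
        using pair_weight_pos[of n \<xi> z] unfolding ee_def
        by (intro mult_right_mono mult_mono cc_le L_le) auto
      finally show ?thesis .
    qed
    show "(\<lambda>z. C\<^sup>2 * (K * ee n) * pair_weight n \<xi> z) summable_on UNIV" for n
      by (intro summable_on_cmult_right pair_weight_summable)
    show "(\<Sum>\<^sub>\<infinity>z. C\<^sup>2 * (K * ee n) * pair_weight n \<xi> z) \<le> C\<^sup>2 * (K * ee n) * (exp (- \<xi>\<^sup>2 / (4 * \<sigma>\<^sup>2)) * B\<^sup>2)" for n
      unfolding infsum_cmult_right' using \<open>0 \<le> K\<close>
      by (intro mult_left_mono pair_weight_sum_le) (auto simp: ee_def)
    show "(\<lambda>n. C\<^sup>2 * (K * ee n) * (exp (- \<xi>\<^sup>2 / (4 * \<sigma>\<^sup>2)) * B\<^sup>2)) summable_on UNIV"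
      by (intro summable_on_cmult_left summable_on_cmult_right ees)
  qed
  define \<phi> where "\<phi> = (\<lambda>k t. exp (- (\<beta> * of_int k - t)\<^sup>2 / (2 * \<sigma>\<^sup>2)))"
  have col: "(\<Sum>\<^sub>\<infinity>n. T n (k, l)) = of_real (exp (- \<xi>\<^sup>2 / (4 * \<sigma>\<^sup>2)) / (\<sigma> * sqrt pi)) * ((c k * of_real (\<phi> k (p + \<xi>))) * cnj (c l * of_real (\<phi> l p)))" for k l
  proof -
    define E where "E = exp (- \<xi>\<^sup>2 / (4 * \<sigma>\<^sup>2)) * exp (- (\<beta> * (of_int k - of_int l) - \<xi>)\<^sup>2 / (4 * \<sigma>\<^sup>2))"
    define t where "t = y - \<beta> / 2 * of_int (k + l)"
    have bij: "bij_betw (\<lambda>m. k + l + m) UNIV UNIV"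
      by (rule bij_betwI[where g = "\<lambda>n. n - (k + l)"]) auto
    have "(\<Sum>\<^sub>\<infinity>n. T n (k, l)) = (\<Sum>\<^sub>\<infinity>m. T (k + l + m) (k, l))"
      using infsum_reindex_bij_betw[OF bij, of "\<lambda>n. T n (k, l)"] by simp
    also have "\<dots> = (\<Sum>\<^sub>\<infinity>m. c k * cnj (c l) * of_real E * (of_real (exp (- q * (of_int m)\<^sup>2)) * L (t - \<beta> / 2 * of_int m)))"
    proof (rule infsum_cong)
      fix m :: int
      have "k + l - (k + l + m) = - m" by simp
      then have "pair_weight (k + l + m) \<xi> (k, l) = E * exp (- q * (of_int m)\<^sup>2)"
        unfolding pair_weight_eq E_def q_def by (simp only: of_int_minus power2_minus) simp
      moreover have "y - \<beta> / 2 * of_int (k + l + m) = t - \<beta> / 2 * of_int m"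
        by (simp add: t_def field_simps)
      ultimately show "T (k + l + m) (k, l) = c k * cnj (c l) * of_real E * (of_real (exp (- q * (of_int m)\<^sup>2)) * L (t - \<beta> / 2 * of_int m))"
        by (simp add: T_def mult_ac)
    qed
    also have "\<dots> = c k * cnj (c l) * of_real E * of_real (1 / (\<sigma> * sqrt pi) * exp (- t\<^sup>2 / \<sigma>\<^sup>2))"
      unfolding infsum_cmult_right' L_convolution ..
    also have "\<dots> = of_real (exp (- \<xi>\<^sup>2 / (4 * \<sigma>\<^sup>2)) / (\<sigma> * sqrt pi)) * ((c k * of_real (\<phi> k (p + \<xi>))) * cnj (c l * of_real (\<phi> l p)))"
    proof -
      \<comment> \<open>The parallelogram law for \<beta> k - (p + \<xi>) and \<beta> l - p: the
        first square on the left is that of their difference, and \<open>t\<close> is half their sum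
        up to sign.\<close>
      have "- (\<beta> * (of_int k - of_int l) - \<xi>)\<^sup>2 / (4 * \<sigma>\<^sup>2) + - t\<^sup>2 / \<sigma>\<^sup>2 = - (\<beta> * of_int k - (p + \<xi>))\<^sup>2 / (2 * \<sigma>\<^sup>2) + - (\<beta> * of_int l - p)\<^sup>2 / (2 * \<sigma>\<^sup>2)"
        unfolding t_def y_def using sigma by (simp add: field_simps power2_eq_square)
      then have "exp (- (\<beta> * (of_int k - of_int l) - \<xi>)\<^sup>2 / (4 * \<sigma>\<^sup>2)) * exp (- t\<^sup>2 / \<sigma>\<^sup>2) = \<phi> k (p + \<xi>) * \<phi> l p"
        unfolding \<phi>_def exp_add[symmetric] by (rule arg_cong)
      then have "E * (1 / (\<sigma> * sqrt pi) * exp (- t\<^sup>2 / \<sigma>\<^sup>2)) = exp (- \<xi>\<^sup>2 / (4 * \<sigma>\<^sup>2)) / (\<sigma> * sqrt pi) * (\<phi> k (p + \<xi>) * \<phi> l p)"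
        unfolding E_def by (simp add: field_simps)
      then have "complex_of_real E * of_real (1 / (\<sigma> * sqrt pi) * exp (- t\<^sup>2 / \<sigma>\<^sup>2)) = of_real (exp (- \<xi>\<^sup>2 / (4 * \<sigma>\<^sup>2)) / (\<sigma> * sqrt pi)) * (of_real (\<phi> k (p + \<xi>)) * of_real (\<phi> l p))"
        by (simp only: of_real_mult[symmetric])
      then show ?thesis by (simp only: mult.assoc complex_cnj_mult complex_cnj_complex_of_real) (simp only: mult_ac)
    qed
    finally show ?thesis .
  qed
  have prod: "(\<Sum>\<^sub>\<infinity>(k, l). (c k * of_real (\<phi> k (p + \<xi>))) * cnj (c l * of_real (\<phi> l p))) = f (p + \<xi>) * cnj (f p)"
  proof -
    have "((\<lambda>(k, l). (c k * of_real (\<phi> k (p + \<xi>))) * cnj (c l * of_real (\<phi> l p))) has_sum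
        ((\<Sum>\<^sub>\<infinity>k. c k * of_real (\<phi> k (p + \<xi>))) * (\<Sum>\<^sub>\<infinity>l. cnj (c l * of_real (\<phi> l p))))) UNIV"
    proof (rule has_sum_times[OF f_term_summable _ f_term_summable])
      show "cmod (c k * of_real (\<phi> k (p + \<xi>))) \<le> C * exp (- (\<beta> * of_int k - (p + \<xi>))\<^sup>2 / (2 * \<sigma>\<^sup>2))" for k
        unfolding \<phi>_def by (rule f_term_le)
      show "cmod (cnj (c l * of_real (\<phi> l p))) \<le> C * exp (- (\<beta> * of_int l - p)\<^sup>2 / (2 * \<sigma>\<^sup>2))" for l
        unfolding \<phi>_def complex_mod_cnj by (rule f_term_le)
    qed
    then show ?thesis unfolding f_eq infsum_cnj \<phi>_def by (rule infsumI)
  qed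
  \<comment> \<open>The normalizations of \<open>gram\<close> and of the dual generator; together
    they cancel the constant left by \<open>L_convolution\<close>.\<close>
  define s where "s = complex_of_real (\<sigma> * sqrt (pi / 2)) * of_real (sqrt 2 * exp (\<xi>\<^sup>2 / (4 * \<sigma>\<^sup>2)))"
  have "gram n \<xi> * (of_real (sqrt 2 * exp (\<xi>\<^sup>2 / (4 * \<sigma>\<^sup>2))) * L (p + \<xi> / 2 - \<beta> / 2 * of_int n)) = s * (\<Sum>\<^sub>\<infinity>z. T n z)" for n
  proof -
    have "(\<Sum>\<^sub>\<infinity>z. T n z) = (\<Sum>\<^sub>\<infinity>z. (case z of (k, l) \<Rightarrow> c k * cnj (c l) * of_real (pair_weight n \<xi> (k, l))) * L (y - \<beta> / 2 * of_int n))"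
      by (intro infsum_cong) (auto simp: T_def)
    also have "\<dots> = (\<Sum>\<^sub>\<infinity>(k, l). c k * cnj (c l) * of_real (pair_weight n \<xi> (k, l))) * L (y - \<beta> / 2 * of_int n)"
      by (rule infsum_cmult_left')
    finally show ?thesis unfolding gram_def s_def y_def by (simp only: mult_ac)
  qed
  then have "(\<Sum>\<^sub>\<infinity>n. gram n \<xi> * (of_real (sqrt 2 * exp (\<xi>\<^sup>2 / (4 * \<sigma>\<^sup>2))) * L (p + \<xi> / 2 - \<beta> / 2 * of_int n))) = s * (\<Sum>\<^sub>\<infinity>z. \<Sum>\<^sub>\<infinity>n. T n z)"
    by (simp only: infsum_cmult_right' swap)
  also have "(\<Sum>\<^sub>\<infinity>z. \<Sum>\<^sub>\<infinity>n. T n z) = (\<Sum>\<^sub>\<infinity>z. of_real (exp (- \<xi>\<^sup>2 / (4 * \<sigma>\<^sup>2)) / (\<sigma> * sqrt pi)) * (case z of (k, l) \<Rightarrow> (c k * of_real (\<phi> k (p + \<xi>))) * cnj (c l * of_real (\<phi> l p))))"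
    by (intro infsum_cong) (auto simp: col)
  also have "\<dots> = of_real (exp (- \<xi>\<^sup>2 / (4 * \<sigma>\<^sup>2)) / (\<sigma> * sqrt pi)) * (f (p + \<xi>) * cnj (f p))"
    unfolding infsum_cmult_right' prod ..
  also have "s * \<dots> = f (p + \<xi>) * cnj (f p)"
  proof -
    have "\<sigma> * sqrt (pi / 2) * (sqrt 2 * exp (\<xi>\<^sup>2 / (4 * \<sigma>\<^sup>2))) * (exp (- \<xi>\<^sup>2 / (4 * \<sigma>\<^sup>2)) / (\<sigma> * sqrt pi)) = 1"
      using sigma by (simp add: real_sqrt_divide exp_minus field_simps)
    then have "s * of_real (exp (- \<xi>\<^sup>2 / (4 * \<sigma>\<^sup>2)) / (\<sigma> * sqrt pi)) = 1"
      unfolding s_def of_real_mult[symmetric] by (simp only: of_real_1)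
    then show ?thesis by (simp add: mult.assoc[symmetric])
  qed
  finally show ?thesis .
qed

end

subsection \<open>Error of the sampled reconstruction formula\<close>

text \<open>The main theorem uses \<open>X = 16 s C\<^sup>2 / (r \<epsilon>)\<close>, so that \<open>C\<^sup>2 / X = r \<epsilon> / (16 s)\<close> is the share of each of the
  four errors.\<close>

locale sampling_scheme = gauss_shift_space +
  fixes A :: "real^2^2" and K \<nu> h r s X :: real and N H :: nat
  assumes b_pos: "A $ 1 $ 2 > 0" and K_pos: "K > 0" and nu: "\<nu> > 0"
    and L_le: "\<And>t. cmod (L t) \<le> K * exp (- \<nu> * \<bar>t\<bar>)"
    and h_pos: "h > 0" and X_pos: "X > 0"
    and N_ge: "real N \<ge> of_int \<lceil>2 / \<beta> * (s + r / 2)\<rceil> + 2 / (\<nu> * \<beta>) * ln (X * D1 \<sigma> \<beta> K \<nu> r)"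
    and h_le: "1 / h \<ge> \<sigma> / (A $ 1 $ 2) * ln (X * D2 \<sigma> \<beta> K \<nu> r + 1)"
    and H_ge: "real H \<ge> of_int \<lceil>\<bar>A $ 1 $ 1\<bar> * \<beta> * real N / (2 * h)\<rceil>
           + (A $ 1 $ 2) / (sqrt 2 * pi * \<sigma> * h) * sqrt (ln (X * D3 \<sigma> \<beta> K \<nu> r))"
    and XD3_ge_1: "X * D3 \<sigma> \<beta> K \<nu> r \<ge> 1"
begin

definition gen :: "real \<Rightarrow> real \<Rightarrow> int \<Rightarrow> complex" where
  "gen \<xi> p n = translate (\<beta> / 2 * of_int n) (dual_generator \<sigma> \<beta> \<xi>) (p + \<xi>)"

text \<open>A majorant of the generator values valid for all |\<xi>| <= r; the argument
  \<open>y\<close> stands for p + \<xi> / 2.\<close>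

definition g :: "real \<Rightarrow> int \<Rightarrow> real" where
  "g y n = sqrt 2 * exp (r\<^sup>2 / (4 * \<sigma>\<^sup>2)) * K * exp (- \<nu> * \<bar>y - \<beta> / 2 * of_int n\<bar>)"

definition M :: real where "M = C\<^sup>2 * (\<sigma> * sqrt (pi / 2)) * B\<^sup>2"

lemma M_nonneg: "M \<ge> 0"
  using sigma by (simp add: M_def)

lemma sqrt2_sqrt_half_pi: "sqrt 2 * sqrt (pi / 2) = sqrt pi"
  by (simp add: real_sqrt_mult[symmetric])

lemma D_pos: "D1 \<sigma> \<beta> K \<nu> r > 0" "D2 \<sigma> \<beta> K \<nu> r > 0" "D3 \<sigma> \<beta> K \<nu> r > 0" "D4 \<sigma> \<beta> K \<nu> r > 0"
proof -
  have B: "(1 + 2 * sqrt (2 * pi) * \<sigma> / \<beta>)\<^sup>2 > 0" using B_ge_1 unfolding B_def[symmetric] by simp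
  have nb: "1 + 2 / (\<nu> * \<beta>) > 0" using nu beta by (simp add: add_pos_pos)
  show "D1 \<sigma> \<beta> K \<nu> r > 0" "D2 \<sigma> \<beta> K \<nu> r > 0" "D3 \<sigma> \<beta> K \<nu> r > 0" "D4 \<sigma> \<beta> K \<nu> r > 0"
    unfolding D1_def D2_def D3_def D4_def using B nb sigma beta nu K_pos by (intro mult_pos_pos divide_pos_pos; simp)+
qed

lemma gen_eq: "gen \<xi> p n = of_real (sqrt 2 * exp (\<xi>\<^sup>2 / (4 * \<sigma>\<^sup>2))) * L (p + \<xi> / 2 - \<beta> / 2 * of_int n)"
proof -
  have "p + \<xi> - \<beta> / 2 * of_int n - \<xi> / 2 = p + \<xi> / 2 - \<beta> / 2 * of_int n" by simp
  then show ?thesis unfolding gen_def translate_def dual_generator_def L_def by (simp only:)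
qed

lemma norm_gen_le:
  assumes "\<bar>\<xi>\<bar> \<le> r"
  shows "cmod (gen \<xi> p n) \<le> g (p + \<xi> / 2) n"
proof -
  have "\<xi>\<^sup>2 \<le> r\<^sup>2" using assms by (intro abs_le_square_iff[THEN iffD1]) auto
  then have "exp (\<xi>\<^sup>2 / (4 * \<sigma>\<^sup>2)) \<le> exp (r\<^sup>2 / (4 * \<sigma>\<^sup>2))"
    by (simp add: divide_right_mono)
  then have "sqrt 2 * exp (\<xi>\<^sup>2 / (4 * \<sigma>\<^sup>2)) * cmod (L (p + \<xi> / 2 - \<beta> / 2 * of_int n))
      \<le> sqrt 2 * exp (r\<^sup>2 / (4 * \<sigma>\<^sup>2)) * (K * exp (- \<nu> * \<bar>p + \<xi> / 2 - \<beta> / 2 * of_int n\<bar>))"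
    by (intro mult_mono L_le) auto
  then show ?thesis unfolding gen_eq g_def by (simp add: norm_mult)
qed

lemma g_nonneg: "g y n \<ge> 0"
  using K_pos by (simp add: g_def)

lemma g_summable: "g y summable_on UNIV"
  unfolding g_def using nu beta by (intro summable_on_cmult_right exp_abs_lattice_sum) auto

text \<open>A row error reaches the result multiplied by a generator value, so a uniform row error
  is amplified by at most this sum; \<open>D4\<close> is its bound.\<close>

lemma sum_g_le: "(\<Sum>n\<in>{- int N..int N}. g y n) \<le> D4 \<sigma> \<beta> K \<nu> r"
proof -
  have "(\<Sum>n\<in>{- int N..int N}. g y n) \<le> infsum (g y) UNIV"
    by (rule finite_sum_le_infsum[OF g_summable]) (auto simp: g_nonneg)
  also have "\<dots> = sqrt 2 * exp (r\<^sup>2 / (4 * \<sigma>\<^sup>2)) * K * (\<Sum>\<^sub>\<infinity>n::int. exp (- \<nu> * \<bar>y - \<beta> / 2 * of_int n\<bar>))"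
    unfolding g_def infsum_cmult_right' ..
  also have "\<dots> \<le> sqrt 2 * exp (r\<^sup>2 / (4 * \<sigma>\<^sup>2)) * K * (2 * (1 + 1 / (\<nu> * (\<beta> / 2))))"
    using nu beta K_pos by (intro mult_left_mono exp_abs_lattice_sum) auto
  also have "\<dots> = D4 \<sigma> \<beta> K \<nu> r" by (simp add: D4_def)
  finally show ?thesis .
qed

text \<open>The evaluation point has modulus at most s + r / 2. The ceiling in the condition on N
  moves the discarded generators past it, and the logarithm supplies the factor 1 / (X D1). The rest
  of the geometric tail times the bound \<open>M\<close> on \<open>gram\<close> is exactly C^2
  D1.\<close>

lemma truncation_error:
  assumes p: "\<bar>p\<bar> \<le> s" and xi: "\<bar>\<xi>\<bar> \<le> r"
  shows "cmod (infsum (\<lambda>n. gram n \<xi> * gen \<xi> p n) (- {- int N..int N})) \<le> C\<^sup>2 / X"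
proof -
  define y where "y = p + \<xi> / 2"
  define s' where "s' = s + r / 2"
  have y: "\<bar>y\<bar> \<le> s'" using p xi unfolding y_def s'_def by linarith
  define Q where "Q = X * D1 \<sigma> \<beta> K \<nu> r"
  have Q: "Q > 0" using X_pos D_pos by (simp add: Q_def)
  define x where "x = \<nu> * \<beta> / 2"
  have x: "x > 0" using nu beta by (simp add: x_def)
  have nM: "cmod (gram n \<xi>) \<le> M" for n
  proof -
    have "cmod (gram n \<xi>) \<le> M * exp (- \<xi>\<^sup>2 / (4 * \<sigma>\<^sup>2))"
      using norm_gram_le by (simp add: M_def)
    also have "\<dots> \<le> M * 1" using M_nonneg by (intro mult_left_mono) auto
    finally show ?thesis by simp
  qed
  have "cmod (infsum (\<lambda>n. gram n \<xi> * gen \<xi> p n) (- {- int N..int N})) \<le> infsum (\<lambda>n. M * g y n) (- {- int N..int N})"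
  proof (rule norm_infsum_le_infsum)
    show "(\<lambda>n. M * g y n) summable_on (- {- int N..int N})"
      by (intro summable_on_cmult_right summable_on_subset_banach[OF g_summable]) auto
    show "cmod (gram n \<xi> * gen \<xi> p n) \<le> M * g y n" for n
      unfolding norm_mult y_def using M_nonneg by (intro mult_mono nM norm_gen_le xi) auto
  qed
  also have "\<dots> \<le> M * (sqrt 2 * exp (r\<^sup>2 / (4 * \<sigma>\<^sup>2)) * K) * (1 / Q * (1 / x)) + M * (sqrt 2 * exp (r\<^sup>2 / (4 * \<sigma>\<^sup>2)) * K) * (1 / Q * (1 / x))"
  proof -
    let ?c = "M * (sqrt 2 * exp (r\<^sup>2 / (4 * \<sigma>\<^sup>2)) * K)"
    have c: "?c \<ge> 0" using M_nonneg K_pos by simp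
    have g: "((\<lambda>i. ?c * (1 / Q * exp (- x)) * exp (- x) ^ i) has_sum (?c * (1 / Q * exp (- x)) / (1 - exp (- x)))) UNIV"
      by (rule has_sum_geometric_nat) (use x in auto)
    \<comment> \<open>The tail starts at N + 1; its extra factor \<open>exp (- x)\<close> improves 1
      + 1 / x to 1 / x, which is why \<open>D1\<close> carries 1 / (\<nu> \<beta>) alone.\<close>
    have "exp (- x) / (1 - exp (- x)) \<le> 1 / x"
      using geometric_le[OF x] x by (simp add: field_simps)
    then have "?c * (1 / Q) * (exp (- x) / (1 - exp (- x))) \<le> ?c * (1 / Q) * (1 / x)"
      using c Q by (intro mult_left_mono) auto
    then have lim: "?c * (1 / Q * exp (- x)) / (1 - exp (- x)) \<le> ?c * (1 / Q * (1 / x))"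
      by (simp add: mult.assoc)
    \<comment> \<open>The condition on N, without rounding and multiplied by \<open>x\<close>, the
      decay of the generator per lattice step.\<close>
    have main: "\<nu> * s' + ln Q \<le> x * real N"
    proof -
      have "2 / \<beta> * s' + 2 / (\<nu> * \<beta>) * ln Q \<le> real N"
        using N_ge le_of_int_ceiling[of "2 / \<beta> * s'"] unfolding Q_def s'_def by linarith
      then have "x * (2 / \<beta> * s' + 2 / (\<nu> * \<beta>) * ln Q) \<le> x * real N"
        using x by (intro mult_left_mono) auto
      also have "x * (2 / \<beta> * s' + 2 / (\<nu> * \<beta>) * ln Q) = \<nu> * s' + ln Q"
        unfolding x_def using nu beta by (simp add: field_simps)
      finally show ?thesis .
    qed
    have le: "M * g y n \<le> ?c * (1 / Q * exp (- x)) * exp (- x) ^ i" if n: "\<bar>real_of_int n\<bar> = real N + 1 + real i" for n i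
    proof -
      have "\<bar>\<beta> / 2 * real_of_int n\<bar> = \<beta> / 2 * (real N + 1 + real i)"
        unfolding abs_mult n using beta by simp
      then have "\<beta> / 2 * (real N + 1 + real i) - s' \<le> \<bar>y - \<beta> / 2 * of_int n\<bar>"
        using y by linarith
      then have "\<nu> * (\<beta> / 2 * (real N + 1 + real i) - s') \<le> \<nu> * \<bar>y - \<beta> / 2 * of_int n\<bar>"
        using nu by (intro mult_left_mono) auto
      moreover have "\<nu> * (\<beta> / 2 * (real N + 1 + real i) - s') = x * real N + x + real i * x - \<nu> * s'"
        by (simp add: x_def field_simps)
      ultimately have "- \<nu> * \<bar>y - \<beta> / 2 * of_int n\<bar> \<le> - ln Q + (- x + real i * (- x))"
        using main by simp
      then have "exp (- \<nu> * \<bar>y - \<beta> / 2 * of_int n\<bar>) \<le> exp (- ln Q + (- x + real i * (- x)))"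
        by simp
      also have "\<dots> = 1 / Q * (exp (- x) * exp (- x) ^ i)"
        unfolding exp_add exp_of_nat_mult[symmetric] using Q by (simp add: exp_minus inverse_eq_divide)
      finally have "?c * exp (- \<nu> * \<bar>y - \<beta> / 2 * of_int n\<bar>) \<le> ?c * (1 / Q * (exp (- x) * exp (- x) ^ i))"
        using c by (rule mult_left_mono)
      then show ?thesis unfolding g_def by (simp only: mult.assoc)
    qed
    have "infsum (\<lambda>n. M * g y n) (- {- int N..int N}) \<le> ?c * (1 / Q * exp (- x)) / (1 - exp (- x)) + ?c * (1 / Q * exp (- x)) / (1 - exp (- x))"
    proof (rule infsum_outside_le[OF _ g _ g])
      show "M * g y n \<ge> 0" for n using M_nonneg g_nonneg by simp
    qed (rule le, simp)+
    then show ?thesis using lim by linarith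
  qed
  also have "\<dots> = C\<^sup>2 / X"
  proof -
    have D: "D1 \<sigma> \<beta> K \<nu> r * C\<^sup>2 = 2 * (M * (sqrt 2 * exp (r\<^sup>2 / (4 * \<sigma>\<^sup>2)) * K) * (1 / x))"
      unfolding D1_def B_def[symmetric] M_def x_def sqrt2_sqrt_half_pi[symmetric] using nu beta by (simp add: field_simps)
    have "M * (sqrt 2 * exp (r\<^sup>2 / (4 * \<sigma>\<^sup>2)) * K) * (1 / Q * (1 / x)) + M * (sqrt 2 * exp (r\<^sup>2 / (4 * \<sigma>\<^sup>2)) * K) * (1 / Q * (1 / x))
      = D1 \<sigma> \<beta> K \<nu> r * C\<^sup>2 / Q"
      unfolding D by (simp add: mult_ac)
    then show ?thesis
      using D_pos(1) X_pos unfolding Q_def by simp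
  qed
  finally show ?thesis .
qed

text \<open>Scaled by \<open>D4\<close>, the amplification of row errors. Aliasing and the
  truncation in frequency then cost C^2 / X each: \<open>D2\<close> and \<open>D3\<close> are
  \<open>D4\<close> times the respective bounds, up to C^2.\<close>

lemma row_error:
  assumes n: "n \<in> {- int N..int N}" and xi: "\<bar>\<xi>\<bar> \<le> r"
  shows "D4 \<sigma> \<beta> K \<nu> r * cmod ((\<Sum>j\<in>{- int H..int H}. riemann_term (h / (A $ 1 $ 2)) (- (A $ 1 $ 1 * (\<beta> / 2 * of_int n)) / (A $ 1 $ 2)) n \<xi> j) - gram n \<xi>)
     \<le> 2 * C\<^sup>2 / X"
proof -
  let ?a = "A $ 1 $ 1" and ?b = "A $ 1 $ 2"
  define \<tau> where "\<tau> = h / ?b"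
  define w where "w = - (?a * (\<beta> / 2 * of_int n)) / ?b"
  define Z where "Z = ?b / (sqrt 2 * pi * \<sigma> * h) * sqrt (ln (X * D3 \<sigma> \<beta> K \<nu> r))"
  define Q2 where "Q2 = X * D2 \<sigma> \<beta> K \<nu> r"
  define Q3 where "Q3 = X * D3 \<sigma> \<beta> K \<nu> r"
  have Q: "Q2 > 0" "Q3 > 0" using X_pos D_pos by (simp_all add: Q2_def Q3_def)
  have tau: "\<tau> > 0" using h_pos b_pos by (simp add: \<tau>_def)
  have lnQ: "ln Q3 \<ge> 0" using XD3_ge_1 by (simp add: Q3_def)
  have Q2_le: "Q2 + 1 \<le> exp (1 / (\<tau> * \<sigma>))"
  proof -
    have "?b / \<sigma> * (\<sigma> / ?b * ln (Q2 + 1)) \<le> ?b / \<sigma> * (1 / h)"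
      using h_le b_pos sigma unfolding Q2_def by (intro mult_left_mono) auto
    moreover have "?b / \<sigma> * (\<sigma> / ?b * ln (Q2 + 1)) = ln (Q2 + 1)"
      using b_pos sigma by simp
    moreover have "?b / \<sigma> * (1 / h) = 1 / (\<tau> * \<sigma>)"
      by (simp add: \<tau>_def mult.commute)
    ultimately have "ln (Q2 + 1) \<le> 1 / (\<tau> * \<sigma>)" by linarith
    then have "exp (ln (Q2 + 1)) \<le> exp (1 / (\<tau> * \<sigma>))" by simp
    then show ?thesis using Q by simp
  qed
  have al: "cmod ((\<Sum>\<^sub>\<infinity>j. riemann_term \<tau> w n \<xi> j) - gram n \<xi>) \<le> M * (2 * exp (1 + r / \<sigma>) / Q2)"
    unfolding M_def by (rule aliasing_error[OF tau xi Q(1) Q2_le])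
  \<comment> \<open>The offset grows with |n|, so |n| = N is the worst case; in units of
    \<open>\<tau>\<close> its bound is the number under the ceiling in the condition on H.\<close>
  have w_le: "\<bar>w\<bar> \<le> \<tau> * of_int \<lceil>\<bar>?a\<bar> * \<beta> * real N / (2 * h)\<rceil>"
  proof -
    have "\<bar>real_of_int n\<bar> \<le> real N" using n by auto
    then have "\<bar>?a\<bar> * (\<beta> / 2 * \<bar>real_of_int n\<bar>) / ?b \<le> \<bar>?a\<bar> * (\<beta> / 2 * real N) / ?b"
      using beta b_pos by (intro divide_right_mono mult_left_mono) auto
    moreover have "\<bar>w\<bar> = \<bar>?a\<bar> * (\<beta> / 2 * \<bar>real_of_int n\<bar>) / ?b"
      unfolding w_def using b_pos beta by (simp add: abs_mult)
    moreover have "\<bar>?a\<bar> * (\<beta> / 2 * real N) / ?b = \<tau> * (\<bar>?a\<bar> * \<beta> * real N / (2 * h))"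
      unfolding \<tau>_def using h_pos by simp
    moreover have "\<tau> * (\<bar>?a\<bar> * \<beta> * real N / (2 * h)) \<le> \<tau> * of_int \<lceil>\<bar>?a\<bar> * \<beta> * real N / (2 * h)\<rceil>"
      using tau by (intro mult_left_mono le_of_int_ceiling) auto
    ultimately show ?thesis by linarith
  qed
  have Z: "Z \<ge> 0" using lnQ b_pos sigma h_pos unfolding Z_def Q3_def by simp
  \<comment> \<open>\<open>Z\<close> is the number of indices after which the Gaussian factor has
    dropped to 1 / Q3; \<open>Q3\<close> >= 1 keeps the square root of the logarithm
    meaningful.\<close>
  have "2 * pi\<^sup>2 * \<sigma>\<^sup>2 * \<tau>\<^sup>2 * Z\<^sup>2 = ln Q3"
    using lnQ b_pos sigma h_pos unfolding Z_def Q3_def[symmetric] \<tau>_def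
    by (simp add: power_mult_distrib power_divide)
  then have eQ: "exp (- 2 * pi\<^sup>2 * \<sigma>\<^sup>2 * \<tau>\<^sup>2 * Z\<^sup>2) = 1 / Q3"
    using Q by (simp add: exp_minus inverse_eq_divide)
  have tl: "cmod ((\<Sum>\<^sub>\<infinity>j. riemann_term \<tau> w n \<xi> j) - (\<Sum>j\<in>{- int H..int H}. riemann_term \<tau> w n \<xi> j)) \<le> M * (1 / Q3)"
  proof -
    have "of_int \<lceil>\<bar>?a\<bar> * \<beta> * real N / (2 * h)\<rceil> + Z \<le> real H"
      using H_ge by (simp only: Z_def)
    from riemann_tail[OF tau w_le this Z, of n \<xi>] show ?thesis
      unfolding eQ M_def .
  qed
  have "cmod ((\<Sum>j\<in>{- int H..int H}. riemann_term \<tau> w n \<xi> j) - gram n \<xi>) \<le> M * (2 * exp (1 + r / \<sigma>) / Q2) + M * (1 / Q3)"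
    using norm_triangle_le_diff[of "(\<Sum>\<^sub>\<infinity>j. riemann_term \<tau> w n \<xi> j) - gram n \<xi>" "(\<Sum>\<^sub>\<infinity>j. riemann_term \<tau> w n \<xi> j) - (\<Sum>j\<in>{- int H..int H}. riemann_term \<tau> w n \<xi> j)"] al tl
    by simp
  then have "D4 \<sigma> \<beta> K \<nu> r * cmod ((\<Sum>j\<in>{- int H..int H}. riemann_term \<tau> w n \<xi> j) - gram n \<xi>)
     \<le> D4 \<sigma> \<beta> K \<nu> r * (M * (2 * exp (1 + r / \<sigma>) / Q2) + M * (1 / Q3))"
    using D_pos(4) by (intro mult_left_mono) auto
  also have "\<dots> = C\<^sup>2 / X + C\<^sup>2 / X"
  proof -
    have DM3: "D4 \<sigma> \<beta> K \<nu> r * M = C\<^sup>2 * D3 \<sigma> \<beta> K \<nu> r"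
      unfolding D4_def D3_def B_def[symmetric] M_def sqrt2_sqrt_half_pi[symmetric] by simp
    have DM2: "D4 \<sigma> \<beta> K \<nu> r * M * (2 * exp (1 + r / \<sigma>)) = C\<^sup>2 * D2 \<sigma> \<beta> K \<nu> r"
      unfolding D4_def D2_def B_def[symmetric] M_def sqrt2_sqrt_half_pi[symmetric] by simp
    have "D4 \<sigma> \<beta> K \<nu> r * M * (2 * exp (1 + r / \<sigma>)) / Q2 = C\<^sup>2 / X"
      unfolding Q2_def DM2 using D_pos X_pos by simp
    moreover have "D4 \<sigma> \<beta> K \<nu> r * M / Q3 = C\<^sup>2 / X"
      unfolding Q3_def DM3 using D_pos X_pos by simp
    ultimately show ?thesis by (simp add: distrib_left)
  qed
  finally show ?thesis unfolding \<tau>_def w_def by simp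
qed

text \<open>With \<xi> = 0 this controls the function of Step 1, with general \<xi> the local
  functions. Aliasing, truncation in frequency and noise are row errors amplified by
  \<open>D4\<close>; truncation in time is the fourth share.\<close>

theorem sampling_error:
  assumes p: "\<bar>p\<bar> \<le> s" and xi: "\<bar>\<xi>\<bar> \<le> r"
    and Y: "\<And>n k. n \<in> {- int N..int N} \<Longrightarrow> k \<in> {- int H..int H} \<Longrightarrow>
           Y n k = (cmod (stlct A (chirped_gaussian A \<sigma>) f (\<beta> * of_int n / 2) (h * of_int k)))\<^sup>2 + \<eta> n k"
    and eta: "row_sum_norm N H \<eta> \<le> C\<^sup>2 / (X * h * D4 \<sigma> \<beta> K \<nu> r)"
  shows "cmod (of_real h * (\<Sum>n\<in>{- int N..int N}. cis (- (pi * A $ 1 $ 1 * \<beta> * of_int n * \<xi> / A $ 1 $ 2)) *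
       (\<Sum>k\<in>{- int H..int H}. of_real (Y n k) * cis (2 * pi * \<xi> * h * of_int k / A $ 1 $ 2) * gen \<xi> p n))
     - f (p + \<xi>) * cnj (f p)) \<le> 4 * C\<^sup>2 / X"
proof -
  let ?a = "A $ 1 $ 1" and ?b = "A $ 1 $ 2" and ?D = "D4 \<sigma> \<beta> K \<nu> r"
  let ?N = "{- int N..int N}" and ?H = "{- int H..int H}"
  define \<tau> where "\<tau> = h / ?b"
  define w where "w = (\<lambda>n::int. - (?a * (\<beta> / 2 * of_int n)) / ?b)"
  define ph where "ph = (\<lambda>n k. cis (- (pi * ?a * \<beta> * of_int n * \<xi> / ?b)) * cis (2 * pi * \<xi> * h * of_int k / ?b))"
  define S where "S = (\<lambda>n. \<Sum>k\<in>?H. riemann_term \<tau> (w n) n \<xi> k)"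
  define E where "E = (\<lambda>n. \<Sum>k\<in>?H. of_real (h * \<eta> n k) * ph n k)"
  \<comment> \<open>The two phase factors of the algorithm combine to the character at the frequency
    \<open>\<tau> * of_int k + w n\<close>, so the noiseless data are Riemann terms.\<close>
  have term_eq: "of_real h * (cis (- (pi * ?a * \<beta> * of_int n * \<xi> / ?b)) * (of_real (Y n k) * cis (2 * pi * \<xi> * h * of_int k / ?b) * gen \<xi> p n))
     = (riemann_term \<tau> (w n) n \<xi> k + of_real (h * \<eta> n k) * ph n k) * gen \<xi> p n"
    if nk: "n \<in> ?N" "k \<in> ?H" for n k
  proof -
    have wn: "\<tau> * of_int k + w n = (h * of_int k - ?a * (\<beta> / 2 * of_int n)) / ?b"
      by (simp add: \<tau>_def w_def diff_divide_distrib)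
    have "riemann_term \<tau> (w n) n \<xi> k = of_real (h * (cmod (stlct A (chirped_gaussian A \<sigma>) f (\<beta> * of_int n / 2) (h * of_int k)))\<^sup>2) * cis (2 * pi * (\<tau> * of_int k + w n) * \<xi>)"
      unfolding riemann_term_def norm_stlct_sq[OF b_pos wn] by (simp add: \<tau>_def)
    moreover have "cis (2 * pi * (\<tau> * of_int k + w n) * \<xi>) = ph n k"
      unfolding ph_def cis_mult \<tau>_def w_def using b_pos by (intro arg_cong[where f = cis]) (simp add: field_simps)
    ultimately show ?thesis
      unfolding Y[OF nk] by (simp add: ph_def algebra_simps)
  qed
  have T: "of_real h * (\<Sum>n\<in>?N. cis (- (pi * ?a * \<beta> * of_int n * \<xi> / ?b)) * (\<Sum>k\<in>?H. of_real (Y n k) * cis (2 * pi * \<xi> * h * of_int k / ?b) * gen \<xi> p n))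
     = (\<Sum>n\<in>?N. (S n + E n) * gen \<xi> p n)"
  proof -
    have "of_real h * (cis (- (pi * ?a * \<beta> * of_int n * \<xi> / ?b)) * (\<Sum>k\<in>?H. of_real (Y n k) * cis (2 * pi * \<xi> * h * of_int k / ?b) * gen \<xi> p n))
      = (S n + E n) * gen \<xi> p n" if "n \<in> ?N" for n
      unfolding sum_distrib_left S_def E_def sum.distrib[symmetric] sum_distrib_right
      by (intro sum.cong refl term_eq that)
    then show ?thesis unfolding sum_distrib_left[of "of_real h" _ ?N] by (intro sum.cong) auto
  qed
  have "(\<lambda>n. gram n \<xi> * gen \<xi> p n) summable_on UNIV"
  proof (rule summable_on_norm_le)
    show "(\<lambda>n. M * exp (- \<xi>\<^sup>2 / (4 * \<sigma>\<^sup>2)) * g (p + \<xi> / 2) n) summable_on UNIV"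
      by (intro summable_on_cmult_right g_summable)
    show "cmod (gram n \<xi> * gen \<xi> p n) \<le> M * exp (- \<xi>\<^sup>2 / (4 * \<sigma>\<^sup>2)) * g (p + \<xi> / 2) n" for n
      unfolding norm_mult M_def using sigma by (intro mult_mono norm_gram_le norm_gen_le xi) auto
  qed
  then have F: "f (p + \<xi>) * cnj (f p) = (\<Sum>n\<in>?N. gram n \<xi> * gen \<xi> p n) + infsum (\<lambda>n. gram n \<xi> * gen \<xi> p n) (- ?N)"
    unfolding gram_reconstruction[OF nu L_le, of \<xi> p, symmetric] gen_eq[symmetric]
    by (rule infsum_split_outside)
  have En: "?D * cmod (E n) \<le> C\<^sup>2 / X" if n: "n \<in> ?N" for n
  proof -
    have "cmod (E n) \<le> (\<Sum>k\<in>?H. h * \<bar>\<eta> n k\<bar>)"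
      unfolding E_def using h_pos by (intro sum_norm_le) (simp add: norm_mult ph_def abs_mult)
    also have "\<dots> = h * (\<Sum>k\<in>?H. \<bar>\<eta> n k\<bar>)" by (rule sum_distrib_left[symmetric])
    also have "\<dots> \<le> h * row_sum_norm N H \<eta>"
      unfolding row_sum_norm_def using h_pos n by (intro mult_left_mono Max_ge) auto
    also have "\<dots> \<le> h * (C\<^sup>2 / (X * h * ?D))"
      using eta h_pos by (intro mult_left_mono) auto
    finally have "?D * cmod (E n) \<le> ?D * (h * (C\<^sup>2 / (X * h * ?D)))"
      using D_pos(4) by (intro mult_left_mono) auto
    then show ?thesis using D_pos(4) h_pos by simp
  qed
  have row: "cmod (S n - gram n \<xi> + E n) \<le> 3 * C\<^sup>2 / X / ?D" if n: "n \<in> ?N" for n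
  proof -
    have "?D * cmod (S n - gram n \<xi>) \<le> 2 * C\<^sup>2 / X"
      unfolding S_def \<tau>_def w_def by (rule row_error[OF n xi])
    then have "?D * (cmod (S n - gram n \<xi>) + cmod (E n)) \<le> 3 * C\<^sup>2 / X"
      using En[OF n] by (simp add: distrib_left)
    then have "cmod (S n - gram n \<xi>) + cmod (E n) \<le> 3 * C\<^sup>2 / X / ?D"
      using D_pos(4) by (subst pos_le_divide_eq) (simp_all only: mult.commute)
    then show ?thesis using norm_triangle_ineq order_trans by blast
  qed
  have nn: "3 * C\<^sup>2 / X / ?D \<ge> 0" using X_pos D_pos(4) by simp
  have "cmod (\<Sum>n\<in>?N. (S n - gram n \<xi> + E n) * gen \<xi> p n) \<le> (\<Sum>n\<in>?N. 3 * C\<^sup>2 / X / ?D * g (p + \<xi> / 2) n)"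
  proof (rule sum_norm_le)
    show "cmod ((S n - gram n \<xi> + E n) * gen \<xi> p n) \<le> 3 * C\<^sup>2 / X / ?D * g (p + \<xi> / 2) n" if "n \<in> ?N" for n
      unfolding norm_mult using nn by (intro mult_mono row[OF that] norm_gen_le xi) auto
  qed
  also have "\<dots> = 3 * C\<^sup>2 / X / ?D * (\<Sum>n\<in>?N. g (p + \<xi> / 2) n)"
    by (rule sum_distrib_left[symmetric])
  also have "\<dots> \<le> 3 * C\<^sup>2 / X / ?D * ?D"
    by (intro mult_left_mono sum_g_le nn)
  also have "\<dots> = 3 * C\<^sup>2 / X" using D_pos(4) by simp
  finally have 1: "cmod (\<Sum>n\<in>?N. (S n - gram n \<xi> + E n) * gen \<xi> p n) \<le> 3 * C\<^sup>2 / X" .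
  have "(\<Sum>n\<in>?N. (S n + E n) * gen \<xi> p n) - f (p + \<xi>) * cnj (f p)
     = (\<Sum>n\<in>?N. (S n - gram n \<xi> + E n) * gen \<xi> p n) - infsum (\<lambda>n. gram n \<xi> * gen \<xi> p n) (- ?N)"
    unfolding F by (simp add: algebra_simps sum.distrib sum_subtractf)
  also have "cmod \<dots> \<le> 3 * C\<^sup>2 / X + C\<^sup>2 / X"
    using norm_triangle_ineq4 1 truncation_error[OF p xi] by (meson add_mono order_trans)
  finally show ?thesis unfolding T by simp
qed

end

subsection \<open>Phase propagation\<close>

text \<open>Dividing both numbers by the modulus of \<open>w\<close> costs one |z - w|, and
  correcting the modulus of \<open>z\<close> costs at most another. Only |w| appears below, for
  which a lower bound is known in the application.\<close>

lemma sgn_diff_le: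
  fixes z w :: complex
  assumes "z \<noteq> 0" "w \<noteq> 0"
  shows "cmod (sgn z - sgn w) \<le> 2 * cmod (z - w) / cmod w"
proof -
  have "sgn z - sgn w = (z - w) / of_real (cmod w) + sgn z * of_real ((cmod w - cmod z) / cmod w)"
    using assms by (simp add: complex_sgn_def scaleR_conv_of_real field_simps)
  also have "cmod \<dots> \<le> cmod (z - w) / cmod w + \<bar>cmod w - cmod z\<bar> / cmod w"
    using assms by (intro order_trans[OF norm_triangle_ineq] add_mono)
      (simp_all only: norm_divide norm_mult norm_of_real abs_divide norm_sgn, simp_all)
  also have "\<bar>cmod w - cmod z\<bar> / cmod w \<le> cmod (z - w) / cmod w"
    using norm_triangle_ineq3[of w z] by (intro divide_right_mono) (auto simp: norm_minus_commute)
  finally show ?thesis by simp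
qed

text \<open>The gluing, separated from the sampling: of the data it sees only numbers
  \<open>a j\<close> close to |f (p j)|^2 and functions \<open>R j\<close> whose rescaled values are
  close to the products.\<close>

locale phase_propagation =
  fixes f :: "real \<Rightarrow> complex" and R :: "nat \<Rightarrow> real \<Rightarrow> complex" and p a :: "nat \<Rightarrow> real"
    and J :: nat and r s \<gamma> \<delta> m :: real
  assumes J: "J \<ge> 2" and p1: "p 1 = - s" and pJ: "p J = s"
    and p_less: "\<And>j. j \<in> {1..J-1} \<Longrightarrow> p j < p (j + 1)"
    and p_gap: "\<And>j. j \<in> {1..J-1} \<Longrightarrow> p (j + 1) - p j \<le> r"
    and p_gap2: "\<And>j. J \<ge> 3 \<Longrightarrow> j \<in> {1..J-2} \<Longrightarrow> p (j + 2) - p j \<ge> r"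
    and r: "r > 0" and gamma: "\<gamma> > 0" and delta: "0 \<le> \<delta>" "\<delta> \<le> \<gamma>\<^sup>2 / 2"
    and a_ge: "\<And>j. j \<in> {1..J} \<Longrightarrow> a j \<ge> 3 / 2 * \<gamma>\<^sup>2"
    and a_approx: "\<And>j. j \<in> {1..J} \<Longrightarrow> \<bar>a j - (cmod (f (p j)))\<^sup>2\<bar> \<le> \<delta>"
    and R_approx: "\<And>j \<xi>. j \<in> {1..J} \<Longrightarrow> \<bar>\<xi>\<bar> \<le> r \<Longrightarrow> cmod (of_real (sqrt (a j)) * R j \<xi> - f (p j + \<xi>) * cnj (f (p j))) \<le> \<delta>"
    and f_le: "\<And>t. t \<in> {-s..s} \<Longrightarrow> cmod (f t) \<le> m"
begin

lemma p_mono: "1 \<le> i \<Longrightarrow> i < j \<Longrightarrow> j \<le> J \<Longrightarrow> p i < p j"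
proof (induction j)
  case (Suc j)
  have "p j < p (Suc j)" using p_less[of j] Suc by simp
  moreover have "i = j \<or> p i < p j" using Suc by (cases "i = j") auto
  ultimately show ?case by auto
qed simp

lemma p_mono_le: "1 \<le> i \<Longrightarrow> i \<le> j \<Longrightarrow> j \<le> J \<Longrightarrow> p i \<le> p j"
  using p_mono[of i j] by (cases "i = j") auto

lemma p_in: "j \<in> {1..J} \<Longrightarrow> p j \<in> {-s..s}"
  using p_mono_le[of 1 j] p_mono_le[of j J] p1 pJ J by auto

text \<open>The threshold 3/2 \<gamma>^2 exceeds \<gamma>^2 by \<gamma>^2 / 2, enough to absorb the
  error \<delta>.\<close>

lemma anchor_ge: "j \<in> {1..J} \<Longrightarrow> cmod (f (p j)) \<ge> \<gamma>"
proof -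
  assume j: "j \<in> {1..J}"
  then have "\<gamma>\<^sup>2 \<le> (cmod (f (p j)))\<^sup>2"
    using a_ge[OF j] a_approx[OF j] delta by linarith
  then show ?thesis by (rule power2_le_imp_le) simp
qed

lemma sqrt_a_ge: "j \<in> {1..J} \<Longrightarrow> sqrt (a j) \<ge> \<gamma>"
proof -
  assume j: "j \<in> {1..J}"
  have "0 < \<gamma>\<^sup>2" using gamma by simp
  then have "\<gamma>\<^sup>2 \<le> a j" using a_ge[OF j] by linarith
  then show ?thesis by (rule real_le_rsqrt)
qed

text \<open>The unknown constant on piece j: \<open>R j \<xi>\<close> approximates
  \<open>f (p j + \<xi>) * u j\<close>.\<close>

definition u :: "nat \<Rightarrow> complex" where "u j = cnj (sgn (f (p j)))"

lemma norm_u: "j \<in> {1..J} \<Longrightarrow> cmod (u j) = 1"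
  using anchor_ge[of j] gamma by (auto simp: u_def norm_sgn)

lemma u_cnj: "j \<in> {1..J} \<Longrightarrow> u j * cnj (u j) = 1" "j \<in> {1..J} \<Longrightarrow> cnj (u j) * u j = 1"
  using norm_u[of j] by (simp_all add: complex_norm_square[symmetric] mult.commute[of "cnj (u j)"])

text \<open>Two sources: the error of the product, divided by \<open>sqrt (a j)\<close>, and the use
  of \<open>sqrt (a j)\<close> in place of |f (p j)|. For the second, the squares differ by at most
  \<delta> and the sum of the roots is at least 2 \<gamma>, so the roots differ by at most \<delta>
  / (2 \<gamma>).\<close>

lemma local_error:
  assumes j: "j \<in> {1..J}" and xi: "\<bar>\<xi>\<bar> \<le> r" and t: "p j + \<xi> \<in> {-s..s}"
  shows "cmod (R j \<xi> - f (p j + \<xi>) * u j) \<le> \<delta> / \<gamma> + m * \<delta> / (2 * \<gamma>\<^sup>2)"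
proof -
  define \<alpha> where "\<alpha> = sqrt (a j)"
  define \<phi> where "\<phi> = cmod (f (p j))"
  have "\<alpha> \<ge> \<gamma>" "\<phi> \<ge> \<gamma>"
    unfolding \<alpha>_def \<phi>_def by (rule sqrt_a_ge[OF j] anchor_ge[OF j])+
  then have al: "\<alpha> \<ge> \<gamma>" "\<alpha> > 0" "\<phi> \<ge> \<gamma>" "\<phi> > 0"
    using gamma by linarith+
  have al2: "\<alpha>\<^sup>2 = a j" using al(2) unfolding \<alpha>_def by simp
  have cu: "cnj (f (p j)) = of_real \<phi> * u j"
    using al(4) by (simp add: u_def \<phi>_def complex_sgn_def scaleR_conv_of_real)
  have "R j \<xi> - f (p j + \<xi>) * u j = (of_real \<alpha> * R j \<xi> - f (p j + \<xi>) * cnj (f (p j))) / of_real \<alpha> + f (p j + \<xi>) * u j * of_real ((\<phi> - \<alpha>) / \<alpha>)"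
    unfolding cu using al by (simp add: field_simps)
  also have "cmod \<dots> \<le> \<delta> / \<gamma> + m * \<delta> / (2 * \<gamma>\<^sup>2)"
  proof (intro order_trans[OF norm_triangle_ineq] add_mono)
    have "cmod (of_real \<alpha> * R j \<xi> - f (p j + \<xi>) * cnj (f (p j))) / \<alpha> \<le> \<delta> / \<gamma>"
      using R_approx[OF j xi] al gamma delta unfolding \<alpha>_def by (intro frac_le) auto
    then show "cmod ((of_real \<alpha> * R j \<xi> - f (p j + \<xi>) * cnj (f (p j))) / of_real \<alpha>) \<le> \<delta> / \<gamma>"
      using al by (simp add: norm_divide)
    have "\<bar>\<phi> - \<alpha>\<bar> * (\<phi> + \<alpha>) = \<bar>(\<phi> - \<alpha>) * (\<phi> + \<alpha>)\<bar>"
      using al unfolding abs_mult by simp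
    also have "(\<phi> - \<alpha>) * (\<phi> + \<alpha>) = \<phi>\<^sup>2 - a j"
      unfolding al2[symmetric] by (simp add: power2_eq_square algebra_simps)
    finally have "\<bar>\<phi> - \<alpha>\<bar> * (\<phi> + \<alpha>) \<le> \<delta>"
      using a_approx[OF j] by (simp add: \<phi>_def abs_minus_commute)
    moreover have "\<bar>\<phi> - \<alpha>\<bar> * (2 * \<gamma>) \<le> \<bar>\<phi> - \<alpha>\<bar> * (\<phi> + \<alpha>)"
      using al by (intro mult_left_mono) auto
    ultimately have "\<bar>\<phi> - \<alpha>\<bar> \<le> \<delta> / (2 * \<gamma>)"
      using gamma by (simp add: field_simps)
    then have "\<bar>\<phi> - \<alpha>\<bar> / \<alpha> \<le> \<delta> / (2 * \<gamma>) / \<gamma>"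
      using al gamma delta by (intro frac_le) auto
    then have "cmod (f (p j + \<xi>)) * (\<bar>\<phi> - \<alpha>\<bar> / \<alpha>) \<le> m * (\<delta> / (2 * \<gamma>) / \<gamma>)"
      using f_le[OF t] order_trans[OF norm_ge_zero f_le[OF t]] al by (intro mult_mono) auto
    then show "cmod (f (p j + \<xi>) * u j * of_real ((\<phi> - \<alpha>) / \<alpha>)) \<le> m * \<delta> / (2 * \<gamma>\<^sup>2)"
      unfolding norm_mult norm_u[OF j] norm_of_real using al by (simp add: abs_divide power2_eq_square mult.assoc)
  qed
  finally show ?thesis .
qed

text \<open>At the next anchor the exact product has modulus at least \<gamma>^2 while its error is
  at most \<gamma>^2 / 2, so the approximation cannot vanish. The phase of the exact product is
  \<open>cnj (u (j + 1)) * u j\<close>.\<close>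

lemma transition:
  assumes j: "j \<in> {1..J-1}"
  shows transition_nonzero: "R j (p (j + 1) - p j) \<noteq> 0"
    and norm_rho: "cmod (alg_rho R p j) = 1"
    and rho_error: "cmod (alg_rho R p j - cnj (u (j + 1)) * u j) \<le> 2 * \<delta> / \<gamma>\<^sup>2"
proof -
  let ?x = "p (j + 1) - p j"
  have jj: "j \<in> {1..J}" "j + 1 \<in> {1..J}" using j by auto
  define z where "z = of_real (sqrt (a j)) * R j ?x"
  define w where "w = f (p (j + 1)) * cnj (f (p j))"
  have "\<bar>?x\<bar> \<le> r" using p_less[OF j] p_gap[OF j] by simp
  from R_approx[OF jj(1) this] have zw: "cmod (z - w) \<le> \<delta>"
    by (simp add: z_def w_def)
  have w: "cmod w \<ge> \<gamma>\<^sup>2"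
    unfolding w_def norm_mult power2_eq_square complex_mod_cnj
    using anchor_ge[OF jj(1)] anchor_ge[OF jj(2)] gamma by (intro mult_mono) auto
  have g2: "\<gamma>\<^sup>2 > 0" using gamma by simp
  have w0: "w \<noteq> 0" using w g2 by auto
  have z0: "z \<noteq> 0"
  proof
    assume "z = 0"
    then have "cmod w \<le> \<delta>" using zw by simp
    then show False using w delta g2 by linarith
  qed
  then show R0: "R j ?x \<noteq> 0" by (auto simp: z_def)
  have "sqrt (a j) > 0" using sqrt_a_ge[OF jj(1)] gamma by linarith
  then have "sgn (complex_of_real (sqrt (a j))) = 1"
    unfolding sgn_of_real by (simp only: sgn_pos of_real_1)
  then have "sgn z = alg_rho R p j"
    unfolding z_def sgn_mult alg_rho_def sgn_eq[of "R j ?x"] by simp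
  moreover have "sgn w = cnj (u (j + 1)) * u j"
    by (simp add: w_def u_def norm_mult complex_sgn_def scaleR_conv_of_real)
  moreover have "2 * cmod (z - w) / cmod w \<le> 2 * \<delta> / \<gamma>\<^sup>2"
    using zw w g2 delta by (intro frac_le) auto
  ultimately show "cmod (alg_rho R p j - cnj (u (j + 1)) * u j) \<le> 2 * \<delta> / \<gamma>\<^sup>2"
    using sgn_diff_le[OF z0 w0] by simp
  show "cmod (alg_rho R p j) = 1" using R0 by (simp add: alg_rho_def norm_divide)
qed

lemma prod_rho_error:
  assumes "1 \<le> i" "i \<le> j" "j \<le> J"
  shows "cmod (\<Prod>k\<in>{i..<j}. alg_rho R p k) = 1"
    and "cmod ((\<Prod>k\<in>{i..<j}. alg_rho R p k) - cnj (u j) * u i) \<le> real (j - i) * (2 * \<delta> / \<gamma>\<^sup>2)"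
proof -
  have "cmod (\<Prod>k\<in>{i..<j}. alg_rho R p k) = (\<Prod>k\<in>{i..<j}. 1)"
    unfolding prod_norm[symmetric] using assms by (intro prod.cong norm_rho) auto
  then show "cmod (\<Prod>k\<in>{i..<j}. alg_rho R p k) = 1" by simp
  show "cmod ((\<Prod>k\<in>{i..<j}. alg_rho R p k) - cnj (u j) * u i) \<le> real (j - i) * (2 * \<delta> / \<gamma>\<^sup>2)"
    using assms(2,3)
  proof (induction j rule: dec_induct)
    case base
    then show ?case using u_cnj[of i] assms by simp
  next
    case (step j)
    define P where "P = (\<Prod>k\<in>{i..<j}. alg_rho R p k)"
    have j: "j \<in> {1..J-1}" "j \<in> {1..J}" "i \<in> {1..J}" using step assms by auto
    \<comment> \<open>Telescoping: the middle phases cancel because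
      \<open>u j * cnj (u j) = 1\<close>, and all factors have modulus 1, so the errors merely add
      up.\<close>
    have "(\<Prod>k\<in>{i..<Suc j}. alg_rho R p k) - cnj (u (Suc j)) * u i
       = (P - cnj (u j) * u i) * alg_rho R p j + cnj (u j) * u i * (alg_rho R p j - cnj (u (j + 1)) * u j)"
    proof -
      have "cnj (u j) * u i * (cnj (u (j + 1)) * u j) = cnj (u (j + 1)) * u i * (u j * cnj (u j))"
        by (simp only: mult_ac)
      then show ?thesis
        using step u_cnj(1)[OF j(2)] by (simp add: P_def algebra_simps)
    qed
    also have "cmod \<dots> \<le> real (j - i) * (2 * \<delta> / \<gamma>\<^sup>2) + 2 * \<delta> / \<gamma>\<^sup>2"
      using step rho_error[OF j(1)] norm_rho[OF j(1)] norm_u[OF j(2)] norm_u[OF j(3)]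
      by (intro order_trans[OF norm_triangle_ineq] add_mono) (auto simp: norm_mult P_def)
    also have "\<dots> = real (Suc j - i) * (2 * \<delta> / \<gamma>\<^sup>2)"
      using step(1) by (simp add: Suc_diff_le distrib_right add_divide_distrib)
    finally show ?case .
  qed
qed

lemma mu_eq: "alg_mu J = (J + 1) div 2"
proof -
  have "\<lceil>real J / 2\<rceil> = int ((J + 1) div 2)"
  proof (rule ceiling_unique)
    show "real_of_int (int ((J + 1) div 2)) - 1 < real J / 2" "real J / 2 \<le> real_of_int (int ((J + 1) div 2))"
      by (cases "even J"; auto elim!: evenE oddE)+
  qed
  then show ?thesis by (simp add: alg_mu_def)
qed

lemma mu: "1 \<le> alg_mu J" "alg_mu J \<le> J - 1" "J \<le> 2 * alg_mu J" "2 * alg_mu J \<le> J + 1"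
  using J unfolding mu_eq by auto

text \<open>Two consecutive steps advance by at least r, and the \<open>alg_mu J - 1\<close> double
  steps from anchor 1 end at anchor \<open>2 * alg_mu J - 1\<close>, which is at most J. They fit
  into length 2 s; gluing from the middle uses only that many single steps per side.\<close>

lemma steps_le: "real (alg_mu J - 1) * r \<le> 2 * s"
proof -
  have "2 * i + 1 \<le> J \<Longrightarrow> real i * r \<le> p (2 * i + 1) + s" for i
  proof (induction i)
    case 0
    then show ?case using p1 by simp
  next
    case (Suc i)
    have "p (2 * i + 1 + 2) - p (2 * i + 1) \<ge> r"
      using Suc by (intro p_gap2) auto
    then show ?case using Suc by (simp add: algebra_simps)
  qed
  from this[of "alg_mu J - 1"] have "real (alg_mu J - 1) * r \<le> p (2 * (alg_mu J - 1) + 1) + s"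
    using mu by linarith
  moreover have "p (2 * (alg_mu J - 1) + 1) \<le> s"
    using p_in[of "2 * (alg_mu J - 1) + 1"] mu by auto
  ultimately show ?thesis by linarith
qed

lemma phase_error:
  assumes j: "j \<in> {1..J-1}"
  shows "cmod (alg_phase J R p j) = 1"
    and "cmod (alg_phase J R p j * u j - u (alg_mu J)) \<le> 2 * s / r * (2 * \<delta> / \<gamma>\<^sup>2)"
proof -
  let ?\<mu> = "alg_mu J"
  have jj: "j \<in> {1..J}" "?\<mu> \<in> {1..J}" using j mu by auto
  have K: "real k * (2 * \<delta> / \<gamma>\<^sup>2) \<le> 2 * s / r * (2 * \<delta> / \<gamma>\<^sup>2)" if "k \<le> ?\<mu> - 1" for k
  proof (rule mult_right_mono)
    have "real k * r \<le> real (?\<mu> - 1) * r" using that r by (intro mult_right_mono) auto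
    then have "real k * r \<le> 2 * s" using steps_le by linarith
    then show "real k \<le> 2 * s / r" using r by (simp add: pos_le_divide_eq)
    show "2 * \<delta> / \<gamma>\<^sup>2 \<ge> 0" using delta by simp
  qed
  have "cmod (alg_phase J R p j) = 1 \<and> cmod (alg_phase J R p j * u j - u ?\<mu>) \<le> 2 * s / r * (2 * \<delta> / \<gamma>\<^sup>2)"
  proof (cases "j < ?\<mu>")
    case True
    define P where "P = (\<Prod>i\<in>{j..<?\<mu>}. alg_rho R p i)"
    have P: "cmod P = 1" "cmod (P - cnj (u ?\<mu>) * u j) \<le> real (?\<mu> - j) * (2 * \<delta> / \<gamma>\<^sup>2)"
      using prod_rho_error[of j ?\<mu>] True j jj by (auto simp: P_def)
    \<comment> \<open>To the left the transitions are passed backwards; having modulus 1, they are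
      inverted by conjugation.\<close>
    have "alg_phase J R p j * u j - u ?\<mu> = cnj (P - cnj (u ?\<mu>) * u j) * u j"
      using True u_cnj(2)[OF jj(1)] by (simp add: alg_phase_def P_def algebra_simps)
    then have "cmod (alg_phase J R p j * u j - u ?\<mu>) = cmod (P - cnj (u ?\<mu>) * u j)"
      by (simp only: norm_mult complex_mod_cnj norm_u[OF jj(1)])
    also have "\<dots> \<le> 2 * s / r * (2 * \<delta> / \<gamma>\<^sup>2)"
      using P(2) K[of "?\<mu> - j"] j by (simp only: atLeastAtMost_iff) (meson diff_le_mono2 order_trans)
    finally have "cmod (alg_phase J R p j * u j - u ?\<mu>) \<le> 2 * s / r * (2 * \<delta> / \<gamma>\<^sup>2)" .
    moreover have "alg_phase J R p j = cnj P"
      by (simp only: alg_phase_def P_def True if_True)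
    ultimately show ?thesis using P(1) by (simp only: complex_mod_cnj)
  next
    case False
    define P where "P = (\<Prod>i\<in>{?\<mu>..<j}. alg_rho R p i)"
    have P: "cmod P = 1" "cmod (P - cnj (u j) * u ?\<mu>) \<le> real (j - ?\<mu>) * (2 * \<delta> / \<gamma>\<^sup>2)"
      using prod_rho_error[of ?\<mu> j] False j jj by (auto simp: P_def)
    have "alg_phase J R p j * u j - u ?\<mu> = (P - cnj (u j) * u ?\<mu>) * u j"
      using False u_cnj(2)[OF jj(1)] by (simp add: alg_phase_def P_def algebra_simps)
    then have "cmod (alg_phase J R p j * u j - u ?\<mu>) = cmod (P - cnj (u j) * u ?\<mu>)"
      by (simp only: norm_mult norm_u[OF jj(1)])
    \<comment> \<open>From j <= J - 1 and J <= 2 \<mu>: the right side takes no more steps than the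
      left.\<close>
    moreover have "j - ?\<mu> \<le> ?\<mu> - 1" using j mu by auto
    ultimately show ?thesis
      using False P K[of "j - ?\<mu>"] by (auto simp: alg_phase_def P_def)
  qed
  then show "cmod (alg_phase J R p j) = 1"
    and "cmod (alg_phase J R p j * u j - u (alg_mu J)) \<le> 2 * s / r * (2 * \<delta> / \<gamma>\<^sup>2)" by auto
qed

section \<open>The pieces and the output function\<close>

lemma piece_unique:
  assumes i: "i \<in> {1..J-1}" "t \<in> alg_piece J p i" and j: "j \<in> {1..J-1}" "t \<in> alg_piece J p j"
  shows "i = j"
proof -
  have "False" if ij: "i \<in> {1..J-1}" "j \<in> {1..J-1}" "t \<in> alg_piece J p i" "t \<in> alg_piece J p j" "i < j" for i j
  proof -
    have 1: "t \<le> p (i + 1)" "p j \<le> t" using ij(3,4) by (auto simp: alg_piece_def split: if_splits)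
    have "p (i + 1) \<le> p j" using ij by (intro p_mono_le) auto
    \<comment> \<open>Only a shared endpoint is possible. If i is left of the middle, its piece
      excludes the right endpoint; otherwise j is right of the middle, and its piece excludes the
      left one.\<close>
    then have "t = p (i + 1)" "t = p j" using 1 by auto
    then show False using ij by (auto simp: alg_piece_def split: if_splits)
  qed
  then show ?thesis using assms by (metis linorder_neqE_nat)
qed

lemma piece_exists:
  assumes t: "t \<in> {-s..s}"
  shows "\<exists>j\<in>{1..J-1}. t \<in> alg_piece J p j"
proof (cases "t < p (alg_mu J)")
  case True
  have "\<lbrakk>1 \<le> n; n \<le> alg_mu J; t < p n\<rbrakk> \<Longrightarrow> \<exists>j\<in>{1..<n}. p j \<le> t \<and> t < p (j + 1)" for n
  proof (induction n)
    case (Suc n)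
    show ?case
    proof (cases "1 \<le> n \<and> t < p n")
      case True
      with Suc show ?thesis by fastforce
    next
      case False
      have "n \<noteq> 0" using Suc.prems(3) t p1 by (cases "n = 0") auto
      then show ?thesis using False Suc.prems by (intro bexI[of _ n]) auto
    qed
  qed simp
  from this[of "alg_mu J"] obtain j where "j \<in> {1..<alg_mu J}" "p j \<le> t" "t < p (j + 1)"
    using True mu by auto
  then show ?thesis using mu by (intro bexI[of _ j]) (auto simp: alg_piece_def)
next
  case False
  have "\<lbrakk>alg_mu J \<le> n; n \<le> J - 1; t \<le> p (n + 1)\<rbrakk> \<Longrightarrow> \<exists>j\<in>{1..J-1}. t \<in> alg_piece J p j" for n
  proof (induction n rule: dec_induct)
    case base
    then show ?case using False mu by (intro bexI[of _ "alg_mu J"]) (auto simp: alg_piece_def)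
  next
    case (step n)
    show ?case
    proof (cases "t \<le> p (n + 1)")
      case True
      with step show ?thesis by auto
    next
      case False
      with step show ?thesis by (intro bexI[of _ "Suc n"]) (auto simp: alg_piece_def)
    qed
  qed
  from this[of "J - 1"] show ?thesis using mu J t pJ by auto
qed

lemma alg_output_eq:
  assumes "j \<in> {1..J-1}" "t \<in> alg_piece J p j"
  shows "alg_output J R p t = alg_phase J R p j * R j (t - p j)"
proof -
  have "(THE j. j \<in> {1..J-1} \<and> t \<in> alg_piece J p j) = j"
    using assms piece_unique by (intro the_equality) blast+
  then show ?thesis by (simp add: alg_output_def)
qed

theorem output_error:
  assumes t: "t \<in> {-s..s}"
  shows "cmod (f t - cnj (u (alg_mu J)) * alg_output J R p t)
    \<le> \<delta> / \<gamma> + m * \<delta> / (2 * \<gamma>\<^sup>2) + 2 * s / r * (2 * \<delta> / \<gamma>\<^sup>2) * m"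
proof -
  let ?\<mu> = "alg_mu J"
  obtain j where j: "j \<in> {1..J-1}" "t \<in> alg_piece J p j" using piece_exists[OF t] by blast
  define \<xi> where "\<xi> = t - p j"
  have jj: "j \<in> {1..J}" "?\<mu> \<in> {1..J}" using j mu by auto
  have tp: "p j \<le> t" "t \<le> p (j + 1)" using j(2) by (auto simp: alg_piece_def split: if_splits)
  have xi: "\<bar>\<xi>\<bar> \<le> r" using tp p_gap[OF j(1)] by (simp add: \<xi>_def)
  have ft: "f (p j + \<xi>) = f t" "p j + \<xi> \<in> {-s..s}" using t by (auto simp: \<xi>_def)
  let ?P = "alg_phase J R p j"
  note le = local_error[OF jj(1) xi ft(2), unfolded ft(1)]
  note P = phase_error[OF j(1)]
  have uu: "cnj (u ?\<mu>) * u ?\<mu> = 1" by (rule u_cnj(2)[OF jj(2)])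
  have eq: "f t - cnj (u ?\<mu>) * alg_output J R p t = - cnj (u ?\<mu>) * (?P * (R j \<xi> - f t * u j) + (?P * u j - u ?\<mu>) * f t)"
  proof -
    have "cnj (u ?\<mu>) * (u ?\<mu> * f t) = f t" using uu by (simp add: mult.assoc[symmetric])
    then show ?thesis unfolding alg_output_eq[OF j] \<xi>_def[symmetric] by (simp add: algebra_simps)
  qed
  have "cmod (f t - cnj (u ?\<mu>) * alg_output J R p t) = cmod (?P * (R j \<xi> - f t * u j) + (?P * u j - u ?\<mu>) * f t)"
    unfolding eq by (simp only: norm_mult norm_minus_cancel complex_mod_cnj norm_u[OF jj(2)])
  also have "\<dots> \<le> cmod (R j \<xi> - f t * u j) + cmod (?P * u j - u ?\<mu>) * cmod (f t)"
    using norm_triangle_ineq[of "?P * (R j \<xi> - f t * u j)" "(?P * u j - u ?\<mu>) * f t"] by (simp add: norm_mult P(1))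
  also have "\<dots> \<le> (\<delta> / \<gamma> + m * \<delta> / (2 * \<gamma>\<^sup>2)) + 2 * s / r * (2 * \<delta> / \<gamma>\<^sup>2) * m"
    using le P(2) f_le[OF t] order_trans[OF norm_ge_zero P(2)] by (intro add_mono mult_mono) auto
  finally show ?thesis by simp
qed

text \<open>On the interval the output is a finite sum of indicator functions times measurable
  functions. The estimate of the essential supremum asks for this.\<close>

lemma alg_output_measurable:
  assumes "\<And>j. R j \<in> borel_measurable borel"
  shows "alg_output J R p \<in> borel_measurable (lebesgue_on {-s..s})"
proof -
  define F where "F = (\<lambda>t. \<Sum>j\<in>{1..J-1}. indicator (alg_piece J p j) t *\<^sub>R (alg_phase J R p j * R j (t - p j)))"
  have [measurable]: "alg_piece J p j \<in> sets borel" for j by (simp add: alg_piece_def)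
  have [measurable]: "R j \<in> borel_measurable borel" for j by (rule assms)
  have "F \<in> borel_measurable borel" unfolding F_def by measurable
  then have "F \<in> borel_measurable lebesgue"
    by (intro measurable_completion) simp
  then have "F \<in> borel_measurable (lebesgue_on {-s..s})"
    by (rule measurable_restrict_space1)
  moreover have "alg_output J R p t = F t" if "t \<in> space (lebesgue_on {-s..s})" for t
  proof -
    have "t \<in> {-s..s}" using that by simp
    then obtain j where j: "j \<in> {1..J-1}" "t \<in> alg_piece J p j" using piece_exists by blast
    have "F t = (\<Sum>i\<in>{1..J-1}. if i = j then alg_phase J R p j * R j (t - p j) else 0)"
      unfolding F_def using j piece_unique by (intro sum.cong) (auto simp: indicator_def)
    then show ?thesis using j alg_output_eq[OF j] by simp
  qed
  ultimately show ?thesis by (subst measurable_cong) auto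
qed

end

subsection \<open>Reconstruction up to a global phase\<close>

text \<open>Where a continuous function exceeds the essential supremum it does so on an open set,
  which cannot be negligible. The bound \<open>b\<close> makes the norm finite, and the lemma turns
  it into a real bound that holds at every point.\<close>

lemma Linf_norm_continuous:
  assumes s: "s > 0" and cont: "continuous_on UNIV f" and bnd: "\<And>t. cmod (f t) \<le> b"
  obtains m where "Linf_norm {-s..s} f = ereal m" "\<And>t. t \<in> {-s..s} \<Longrightarrow> cmod (f t) \<le> m"
proof -
  let ?M = "lebesgue_on {-s..s}"
  define E where "E = Linf_norm {-s..s} f"
  have "f \<in> borel_measurable borel" using cont by (rule borel_measurable_continuous_onI)
  then have "(\<lambda>t. ereal (cmod (f t))) \<in> borel_measurable borel" by measurable
  then have "(\<lambda>t. ereal (cmod (f t))) \<in> borel_measurable lebesgue"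
    by (intro measurable_completion) simp
  then have meas: "(\<lambda>t. ereal (cmod (f t))) \<in> borel_measurable ?M"
    by (rule measurable_restrict_space1)
  have up: "E \<le> ereal b"
    unfolding E_def Linf_norm_def by (rule esssup_I[OF meas]) (use bnd in auto)
  have "AE t in ?M. ereal (cmod (f t)) \<le> E"
    unfolding E_def Linf_norm_def by (rule esssup_AE)
  then have "AE t in lebesgue. t \<in> {-s..s} \<longrightarrow> ereal (cmod (f t)) \<le> E"
    by (subst (asm) AE_restrict_space_iff) auto
  then obtain Z where Z: "Z \<in> null_sets lebesgue"
    "\<And>t. t \<in> space lebesgue - Z \<Longrightarrow> t \<in> {-s..s} \<longrightarrow> ereal (cmod (f t)) \<le> E"
    by (rule AE_E3) blast
  have pt: "ereal (cmod (f t)) \<le> E" if t: "t \<in> {-s..s}" for t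
  proof (rule ccontr)
    assume n: "\<not> ereal (cmod (f t)) \<le> E"
    define U where "U = {x. E < ereal (cmod (f x))}"
    have oU: "open U"
      unfolding U_def using cont by (intro open_Collect_less continuous_intros)
    have "t \<in> U" using n by (simp add: U_def)
    \<comment> \<open>Passing through the closure also covers the endpoints -s and s.\<close>
    moreover have "t \<in> closure {-s<..<s}" using s t by simp
    ultimately have "U \<inter> {-s<..<s} \<noteq> {}"
      using open_Int_closure_eq_empty[OF oU] by blast
    moreover have "U \<inter> {-s<..<s} \<subseteq> Z"
      using Z(2) by (fastforce simp: U_def)
    then have "negligible (U \<inter> {-s<..<s})"
      using Z(1) negligible_iff_null_sets negligible_subset by blast
    ultimately show False using oU open_not_negligible by (meson open_Int open_greaterThanLessThan)
  qed
  have "0 \<le> E" using pt[of 0] s by (metis atLeastAtMost_iff ereal_less_eq(5) less_eq_real_def neg_le_0_iff_le norm_ge_zero order_trans)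
  then obtain m where m: "E = ereal m" using up by (cases E) auto
  show ?thesis
    by (rule that[of m]) (use m pt E_def in auto)
qed

theorem theorem5p4:
  fixes \<sigma> \<beta> K \<nu> r \<gamma> s \<epsilon> h :: real
    and A :: "real^2^2"
    and c :: "int \<Rightarrow> complex" and f :: "real \<Rightarrow> complex"
    and N H J :: nat
    and \<eta> Y :: "int \<Rightarrow> int \<Rightarrow> real"
    and p :: "nat \<Rightarrow> real"
  assumes "\<sigma> > 0" and "\<beta> > 0" and "det A = 1" and "A $ 1 $ 2 > 0"
    and "K > 0" and "\<nu> > 0"
    and "\<And>t. cmod (inv_fourier (Lambda \<sigma> \<beta>) t) \<le> K * exp (- \<nu> * \<bar>t\<bar>)"
    and "bounded (range c)" and "c \<noteq> (\<lambda>_. 0)"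
    and "f = shift_series \<beta> (gaussian \<sigma>) c"
    and "r > 0" and "\<gamma> > 0" and "s > 0" and "r \<le> 2 * s"
    and "\<epsilon> > 0"
    and "ereal \<epsilon> \<le> min (ereal (\<gamma>\<^sup>2)) (ereal (\<gamma> ^ 3) / Linf_norm {-s..s} f)"
    and "16 * s * D3 \<sigma> \<beta> K \<nu> r * (linf_seq_norm c)\<^sup>2 \<ge> r * \<epsilon>"
    and "h > 0"
    and "real N \<ge> of_int \<lceil>2 / \<beta> * (s + r / 2)\<rceil>
           + 2 / (\<nu> * \<beta>) * ln (16 * s * D1 \<sigma> \<beta> K \<nu> r * (linf_seq_norm c)\<^sup>2 / (r * \<epsilon>))"
    and "1 / h \<ge> \<sigma> / (A $ 1 $ 2)
           * ln (16 * s * D2 \<sigma> \<beta> K \<nu> r * (linf_seq_norm c)\<^sup>2 / (r * \<epsilon>) + 1)"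
    and "real H \<ge> of_int \<lceil>\<bar>A $ 1 $ 1\<bar> * \<beta> * real N / (2 * h)\<rceil>
           + (A $ 1 $ 2) / (sqrt 2 * pi * \<sigma> * h)
             * sqrt (ln (16 * s * D3 \<sigma> \<beta> K \<nu> r * (linf_seq_norm c)\<^sup>2 / (r * \<epsilon>)))"
    and "\<And>n k. n \<in> {- int N..int N} \<Longrightarrow> k \<in> {- int H..int H} \<Longrightarrow>
           Y n k = (cmod (stlct A (chirped_gaussian A \<sigma>) f (\<beta> * of_int n / 2) (h * of_int k)))\<^sup>2 + \<eta> n k"
    and "row_sum_norm N H \<eta> \<le> r * \<epsilon> / (16 * s * h * D4 \<sigma> \<beta> K \<nu> r)"
    and "anchor_points (alg_A \<sigma> \<beta> h N H Y) r (3 / 2 * \<gamma>\<^sup>2) s J p"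
  shows "(\<forall>j\<in>{1..J}. cmod (f (p j)) \<ge> \<gamma>) \<and>
    (\<forall>j\<in>{1..J-1}. alg_R A \<sigma> \<beta> h N H Y p j (p (j + 1) - p j) \<noteq> 0) \<and>
    (\<exists>\<tau>. cmod \<tau> = 1 \<and>
       Linf_norm {-s..s} (\<lambda>t. f t - \<tau> * alg_output J (alg_R A \<sigma> \<beta> h N H Y p) p t)
         \<le> ereal (11 / 4 * \<epsilon>) * kappa {-s..s} f \<gamma>)"
proof -
  let ?b = "A $ 1 $ 2" and ?R = "alg_R A \<sigma> \<beta> h N H Y p" and ?A = "alg_A \<sigma> \<beta> h N H Y"
  note sigma = assms(1) and beta = assms(2) and b = assms(4) and Kpos = assms(5) and nu = assms(6) and L_le = assms(7)
    and f_def = assms(10) and r = assms(11) and gamma = assms(12) and s = assms(13) and rs = assms(14) and eps = assms(15)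
    and eps_le = assms(16) and D3_ge = assms(17) and h = assms(18) and N_ge = assms(19) and h_le = assms(20) and H_ge = assms(21)
    and Y_eq = assms(22) and eta = assms(23) and anchors = assms(24)
  define C where "C = linf_seq_norm c"
  define X where "X = 16 * s * C\<^sup>2 / (r * \<epsilon>)"
  \<comment> \<open>The four shares together, 4 C^2 / X.\<close>
  define \<delta> where "\<delta> = r * \<epsilon> / (4 * s)"
  have c_le: "cmod (c k) \<le> C" for k
    unfolding C_def linf_seq_norm_def using assms(8)
    by (intro cSUP_upper) (auto simp: bounded_iff bdd_above_def)
  have C: "C > 0"
  proof -
    obtain k where "c k \<noteq> 0" using assms(9) by auto
    then show ?thesis using c_le[of k] by (auto intro: less_le_trans[of 0 "cmod (c k)"])
  qed
  have X: "X > 0" using C s r eps by (simp add: X_def)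
  have XD: "16 * s * D * C\<^sup>2 / (r * \<epsilon>) = X * D" for D
    by (simp add: X_def)
  interpret G: gauss_shift_space \<sigma> \<beta> C c
    by unfold_locales (use sigma beta c_le in auto)
  interpret S: sampling_scheme \<sigma> \<beta> C c A K \<nu> h r s X N H
  proof
    show "cmod (G.L t) \<le> K * exp (- \<nu> * \<bar>t\<bar>)" for t
      unfolding G.L_def by (rule L_le)
    show "1 \<le> X * D3 \<sigma> \<beta> K \<nu> r"
      using D3_ge r eps unfolding C_def[symmetric] XD[symmetric] by (subst pos_le_divide_eq) auto
    show "1 / h \<ge> \<sigma> / ?b * ln (X * D2 \<sigma> \<beta> K \<nu> r + 1)"
      using h_le unfolding C_def[symmetric] XD .
    show "real N \<ge> of_int \<lceil>2 / \<beta> * (s + r / 2)\<rceil> + 2 / (\<nu> * \<beta>) * ln (X * D1 \<sigma> \<beta> K \<nu> r)"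
      using N_ge unfolding C_def[symmetric] XD .
    show "real H \<ge> of_int \<lceil>\<bar>A $ 1 $ 1\<bar> * \<beta> * real N / (2 * h)\<rceil>
           + ?b / (sqrt 2 * pi * \<sigma> * h) * sqrt (ln (X * D3 \<sigma> \<beta> K \<nu> r))"
      using H_ge unfolding C_def[symmetric] XD .
  qed (use b Kpos nu h X in auto)
  have f: "f = G.f" unfolding f_def G.f_def ..
  have d4: "4 * C\<^sup>2 / X = \<delta>"
    using C s r eps by (simp add: X_def \<delta>_def field_simps)
  have eta': "row_sum_norm N H \<eta> \<le> C\<^sup>2 / (X * h * D4 \<sigma> \<beta> K \<nu> r)"
  proof -
    have "C\<^sup>2 / (X * h * D4 \<sigma> \<beta> K \<nu> r) = r * \<epsilon> / (16 * s * h * D4 \<sigma> \<beta> K \<nu> r)"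
      using C s r eps by (simp add: X_def)
    then show ?thesis using eta by simp
  qed
  note err = S.sampling_error[OF _ _ _ eta', unfolded d4 f[symmetric], OF _ _ Y_eq]
  have A_err: "\<bar>?A t - (cmod (f t))\<^sup>2\<bar> \<le> \<delta>" if t: "\<bar>t\<bar> \<le> s" for t
  proof -
    let ?T = "of_real h * (\<Sum>n\<in>{- int N..int N}. \<Sum>k\<in>{- int H..int H}.
           of_real (Y n k) * translate (\<beta> / 2 * of_int n) (dual_generator \<sigma> \<beta> 0) t)"
    \<comment> \<open>At \<xi> = 0 all phase factors are 1, and the reconstructed product is |f
      t|^2.\<close>
    have "cmod (?T - f t * cnj (f t)) \<le> \<delta>"
      using err[OF t, of 0] r by (simp add: S.gen_def)
    moreover have "?A t - (cmod (f t))\<^sup>2 = Re (?T - f t * cnj (f t))"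
      unfolding alg_A_def complex_norm_square[symmetric]
      by (simp only: minus_complex.sel Re_complex_of_real)
    ultimately show ?thesis using abs_Re_le_cmod[of "?T - f t * cnj (f t)"] by linarith
  qed
  obtain m where m: "Linf_norm {-s..s} f = ereal m" "\<And>t. t \<in> {-s..s} \<Longrightarrow> cmod (f t) \<le> m"
    using Linf_norm_continuous[OF s G.continuous_on_f G.norm_f_le] unfolding f by blast
  have del: "0 \<le> \<delta>" "\<delta> \<le> \<epsilon> / 2"
  proof -
    show "0 \<le> \<delta>" using r eps s by (simp add: \<delta>_def)
    have "r * \<epsilon> \<le> 2 * s * \<epsilon>" using rs eps by (intro mult_right_mono) auto
    then show "\<delta> \<le> \<epsilon> / 2" using s by (simp add: \<delta>_def field_simps)
  qed
  have eps2: "\<epsilon> \<le> \<gamma>\<^sup>2" using eps_le by simp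
  note anc = anchors[unfolded anchor_points_def]
  have J: "J \<ge> 2" and p1: "p 1 = - s" and pJ: "p J = s" using anc by blast+
  have pl: "\<And>j. j \<in> {1..J-1} \<Longrightarrow> p j < p (j + 1)" using anc by blast
  have pA: "\<And>j. j \<in> {1..J} \<Longrightarrow> ?A (p j) \<ge> 3 / 2 * \<gamma>\<^sup>2" using anc by blast
  have pg: "\<And>j. j \<in> {1..J-1} \<Longrightarrow> p (j + 1) - p j \<le> r" using anc by blast
  have pg2: "\<And>j. J \<ge> 3 \<Longrightarrow> j \<in> {1..J-2} \<Longrightarrow> p (j + 2) - p j \<ge> r" using anc by blast
  \<comment> \<open>The anchors have to be placed in [-s, s] beforehand, because the error estimates
    demanded by \<open>phase_propagation\<close> hold for such points.\<close>
  have up: "\<lbrakk>1 \<le> j; j \<le> J\<rbrakk> \<Longrightarrow> - s \<le> p j" for j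
  proof (induction j)
    case (Suc j)
    show ?case
    proof (cases "j = 0")
      case False
      then have "j \<in> {1..J-1}" "- s \<le> p j" using Suc by auto
      then show ?thesis using pl[of j] by simp
    qed (use p1 in simp)
  qed simp
  have dn: "\<lbrakk>j \<le> J; 1 \<le> j\<rbrakk> \<Longrightarrow> p j \<le> s" for j
  proof (induction j rule: inc_induct)
    case base
    then show ?case using pJ by simp
  next
    case (step j)
    then have "j \<in> {1..J-1}" "p (Suc j) \<le> s" by auto
    then show ?case using pl[of j] by simp
  qed
  have p_in: "\<bar>p j\<bar> \<le> s" if "j \<in> {1..J}" for j
    using up[of j] dn[of j] that by (auto simp: abs_le_iff)
  \<comment> \<open>The threshold makes the value of Step 1 positive at the anchors, so multiplying
    by its root undoes the normalization exactly.\<close>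
  have R_eq: "of_real (sqrt (?A (p j))) * ?R j \<xi> = of_real h * (\<Sum>n\<in>{- int N..int N}. cis (- (pi * A $ 1 $ 1 * \<beta> * of_int n * \<xi> / ?b)) *
       (\<Sum>k\<in>{- int H..int H}. of_real (Y n k) * cis (2 * pi * \<xi> * h * of_int k / ?b) * S.gen \<xi> (p j) n))"
    if "j \<in> {1..J}" for j \<xi>
  proof -
    have "0 < 3 / 2 * \<gamma>\<^sup>2" using gamma by simp
    then have "?A (p j) > 0" using pA[OF that] by linarith
    then have "sqrt (?A (p j)) * (h / sqrt (?A (p j))) = h" by simp
    then have "complex_of_real (sqrt (?A (p j))) * of_real (h / sqrt (?A (p j))) = of_real h"
      unfolding of_real_mult[symmetric] by (rule arg_cong)
    then show ?thesis
      unfolding alg_R_def S.gen_def by (simp only: mult.assoc[symmetric])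
  qed
  interpret P: phase_propagation f ?R p "\<lambda>j. ?A (p j)" J r s \<gamma> \<delta> m
  proof
    show "cmod (of_real (sqrt (?A (p j))) * ?R j \<xi> - f (p j + \<xi>) * cnj (f (p j))) \<le> \<delta>"
      if "j \<in> {1..J}" "\<bar>\<xi>\<bar> \<le> r" for j \<xi>
      unfolding R_eq[OF that(1)] by (rule err[OF p_in[OF that(1)] that(2)])
    show "\<delta> \<le> \<gamma>\<^sup>2 / 2" using del eps2 by linarith
    show "\<bar>?A (p j) - (cmod (f (p j)))\<^sup>2\<bar> \<le> \<delta>" if "j \<in> {1..J}" for j
      by (rule A_err[OF p_in[OF that]])
  qed (use J p1 pJ pl pg pg2 r gamma del pA m in auto)
  have m0: "m > 0" using P.anchor_ge[of 1] J gamma p1 m(2)[of "- s"] s by auto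
  define \<kappa> where "\<kappa> = max 1 m / min \<gamma> (\<gamma>\<^sup>2)"
  have g: "min \<gamma> (\<gamma>\<^sup>2) > 0" using gamma by simp
  have kap: "kappa {-s..s} f \<gamma> = ereal \<kappa>"
  proof -
    define d where "d = min \<gamma> (\<gamma>\<^sup>2)"
    define M where "M = max 1 m"
    have max_M: "max 1 (ereal m) = ereal M" by (simp add: max_def M_def)
    show ?thesis
      using g unfolding kappa_def m \<kappa>_def max_M d_def[symmetric] M_def[symmetric] by simp
  qed
  have k1: "1 / \<gamma> \<le> \<kappa>" and k2: "m / \<gamma>\<^sup>2 \<le> \<kappa>"
    unfolding \<kappa>_def using g m0 by (intro frac_le; simp)+
  \<comment> \<open>The phase of f at the middle anchor, where the output carries no transition
    factor.\<close>
  define \<tau> where "\<tau> = cnj (P.u (alg_mu J))"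
  have tau: "cmod \<tau> = 1"
    unfolding \<tau>_def complex_mod_cnj using P.mu by (intro P.norm_u) auto
  have pt: "cmod (f t - \<tau> * alg_output J ?R p t) \<le> 11 / 4 * \<epsilon> * \<kappa>" if t: "t \<in> {-s..s}" for t
  proof -
    have "cmod (f t - \<tau> * alg_output J ?R p t) \<le> \<delta> / \<gamma> + m * \<delta> / (2 * \<gamma>\<^sup>2) + 2 * s / r * (2 * \<delta> / \<gamma>\<^sup>2) * m"
      unfolding \<tau>_def by (rule P.output_error[OF t])
    \<comment> \<open>Since 4 s \<delta> / r = \<epsilon>, the accumulated phase error is \<epsilon>
      m / \<gamma>^2, whatever the number of anchors.\<close>
    also have "\<delta> / \<gamma> + m * \<delta> / (2 * \<gamma>\<^sup>2) + 2 * s / r * (2 * \<delta> / \<gamma>\<^sup>2) * m = \<delta> * (1 / \<gamma>) + \<delta> * (m / \<gamma>\<^sup>2) / 2 + \<epsilon> * (m / \<gamma>\<^sup>2)"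
      unfolding \<delta>_def using s r by simp
    \<comment> \<open>By \<delta> <= \<epsilon> / 2 the coefficients are 1/2, 1/4 and 1; their sum
      7/4 stays below 11/4.\<close>
    also have "\<dots> \<le> \<epsilon> / 2 * \<kappa> + \<epsilon> / 2 * \<kappa> / 2 + \<epsilon> * \<kappa>"
      using k1 k2 del eps gamma m0 by (intro add_mono divide_right_mono mult_mono) auto
    also have "\<dots> \<le> 11 / 4 * \<epsilon> * \<kappa>"
    proof -
      have "0 \<le> \<epsilon> * \<kappa>" using eps k1 gamma by (intro mult_nonneg_nonneg) (auto intro: order_trans[of 0 "1 / \<gamma>"])
      then show ?thesis by simp
    qed
    finally show ?thesis .
  qed
  have R_meas: "?R j \<in> borel_measurable borel" for j
  proof -
    have gm: "(\<lambda>\<xi>. S.gen \<xi> y n) \<in> borel_measurable borel" for y n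
      unfolding S.gen_eq by measurable
    have "cis \<in> borel_measurable borel"
      by (intro borel_measurable_continuous_onI continuous_intros)
    note cm = measurable_compose[OF _ this]
    have ph: "(\<lambda>\<xi>. cis (- (y * \<xi> / z))) \<in> borel_measurable borel"
      "(\<lambda>\<xi>. cis (2 * pi * \<xi> * h * w / z)) \<in> borel_measurable borel" for y w z
      by (rule cm, measurable)+
    show ?thesis
      unfolding alg_R_def S.gen_def[symmetric]
      by (intro borel_measurable_times borel_measurable_sum borel_measurable_const ph gm)
  qed
  have meas: "(\<lambda>t. ereal (cmod (f t - \<tau> * alg_output J ?R p t))) \<in> borel_measurable (lebesgue_on {-s..s})"
  proof -
    have "f \<in> borel_measurable borel"
      unfolding f by (rule borel_measurable_continuous_onI[OF G.continuous_on_f])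
    then have "f \<in> borel_measurable lebesgue"
      by (intro measurable_completion) simp
    then have [measurable]: "f \<in> borel_measurable (lebesgue_on {-s..s})"
      by (rule measurable_restrict_space1)
    have [measurable]: "alg_output J ?R p \<in> borel_measurable (lebesgue_on {-s..s})"
      by (rule P.alg_output_measurable[OF R_meas])
    show ?thesis by measurable
  qed
  have "Linf_norm {-s..s} (\<lambda>t. f t - \<tau> * alg_output J ?R p t) \<le> ereal (11 / 4 * \<epsilon> * \<kappa>)"
    unfolding Linf_norm_def by (rule esssup_I[OF meas]) (use pt in auto)
  also have "\<dots> = ereal (11 / 4 * \<epsilon>) * kappa {-s..s} f \<gamma>"
    unfolding kap by simp
  finally show ?thesis
    using P.anchor_ge P.transition_nonzero tau by auto
qed

end
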